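(* Let $N\ge 2$ and let $H\subset\mathbb R^N$ be a hyperplane through the origin. (1) Let $1<p<+\infty$ and let $B\subset\mathbb R^N$ be the unit ball of the $\ell_p$ norm. If $K=B\cap H$, or if $K=P(B)$ for some linear projection $P$ of $\mathbb R^N$ onto $H$, then $$\operatorname{vol}_{N-1}(K)\cdot\operatorname{vol}_{N-1}(K^\circ)\ \ge\ \frac{4^{N-1}}{(N-1)!}.$$ (2) The same inequality holds if $K=[-1,1]^N\cap H$ is a hyperplane section of the cube, and if $K=P(C)$ is the image of the cross-polytope $C=\{x\in\mathbb R^N:\sum_i|x_i|\le 1\}$ under a linear projection $P$ of $\mathbb R^N$ onto $H$. Here $K$ is regarded as a centrally symmetric convex body in the $(N-1)$-dimensional Euclidean space $H$, and $K^\circ\subset H$ is its polar in $H$.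
   Context: For a centrally symmetric (about the origin) convex body $K$ in an $n$-dimensional Euclidean space $V$, the polar is $K^\circ=\{y\in V : \langle x,y\rangle\le 1 \text{ for all } x\in K\}$. Mahler's conjecture for such $K$ is the inequality $\operatorname{vol}_n(K)\operatorname{vol}_n(K^\circ)\ge 4^n/n!$; it is invariant under linear isomorphisms of $V$. The unit ball of the $\ell_p$ norm in $\mathbb R^N$, $1\le p<\infty$, is $\{x : \sum_i|x_i|^p\le 1\}$. A linear projection onto $H$ is a linear map $P:\mathbb R^N\to\mathbb R^N$ with $P^2=P$ and image $H$; it need not be orthogonal. *)

theory Defs
  imports "HOL-Analysis.Analysis"
begin

definition orthonormal_basis_of :: "'a::euclidean_space set \<Rightarrow> 'a set \<Rightarrow> bool" where
  "orthonormal_basis_of H B \<longleftrightarrow>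
     pairwise orthogonal B \<and> (\<forall>b\<in>B. norm b = 1) \<and> span B = H"

lemma orthonormal_basis_of_exists:
  assumes "subspace H"
  shows "\<exists>B. orthonormal_basis_of H B"
  using orthonormal_basis_subspace[OF assms] unfolding orthonormal_basis_of_def by metis

(* Lebesgue measure of the Euclidean space H, carried by the ambient space: the same
   construction as lborel, with an orthonormal basis of H in place of Basis. By rotation
   invariance of Lebesgue measure it does not depend on the chosen basis. *)
definition subspace_lborel :: "'a::euclidean_space set \<Rightarrow> 'a measure" where
  "subspace_lborel H =
     (let B = (SOME B. orthonormal_basis_of H B)
      in distr (\<Pi>\<^sub>M b\<in>B. lborel) borel (\<lambda>c. \<Sum>b\<in>B. c b *\<^sub>R b))"

definition subspace_vol :: "'a::euclidean_space set \<Rightarrow> 'a set \<Rightarrow> real" where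
  "subspace_vol H K = measure (subspace_lborel H) K"

definition polar_in :: "'a::euclidean_space set \<Rightarrow> 'a set \<Rightarrow> 'a set" where
  "polar_in H K = {y \<in> H. \<forall>x\<in>K. x \<bullet> y \<le> 1}"

definition lp_ball :: "real \<Rightarrow> (real ^ 'n) set" where
  "lp_ball p = {x. (\<Sum>i\<in>UNIV. \<bar>x $ i\<bar> powr p) \<le> 1}"

definition cube :: "(real ^ 'n) set" where
  "cube = {x. \<forall>i. x $ i \<in> {-1..1}}"

definition cross_polytope :: "(real ^ 'n) set" where
  "cross_polytope = {x. (\<Sum>i\<in>UNIV. \<bar>x $ i\<bar>) \<le> 1}"

definition linear_projection_onto :: "'a::real_vector set \<Rightarrow> ('a \<Rightarrow> 'a) \<Rightarrow> bool" where
  "linear_projection_onto H P \<longleftrightarrow> linear P \<and> P \<circ> P = P \<and> range P = H"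

end

theory Submission
  imports Defs
begin

text \<open>
  The argument is Karasev's symplectic one, turned into an integral inequality that needs
  only Fubini's theorem and the fundamental theorem of calculus.

  Let \<open>n\<close> be a unit normal of \<open>H\<close>, let \<open>1/p + 1/q = 1\<close> and let \<open>N\<close> be the dimension. The polar
  in \<open>H\<close> of the section \<open>B\<^sub>p \<inter> H\<close> contains the orthogonal projection of \<open>B\<^sub>q\<close> to \<open>H\<close>, so it
  suffices to bound below the product of the volumes of these two sets
  (\<open>section_projection_volume\<close>). On \<open>\<real>\<^sup>N \<times> \<real>\<^sup>N\<close> put the energy
  \<open>F(x, y) = (\<Sum>i. max (\<bar>x\<^sub>i\<bar>\<^sup>p) (\<bar>y\<^sub>i\<bar>\<^sup>q))\<close> and the measure with density \<open>exp (- F)\<close>. In each coordinate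
  plane the level set \<open>{max (\<bar>x\<bar>\<^sup>p) (\<bar>y\<bar>\<^sup>q) \<le> t}\<close> is a rectangle of area \<open>4 t\<close>, so the Hamiltonian
  flow of \<open>F\<close> runs around rectangles, it has period 4, its half period is \<open>z \<mapsto> - z\<close>, and the
  measure has total mass \<open>4\<^sup>N\<close>. The sublevel sets of \<open>F\<close> thus behave like balls, and the product of
  \<open>B\<^sub>p \<inter> H\<close> with the projection of \<open>B\<^sub>q\<close> contains the symplectic reduction of \<open>{F \<le> 1}\<close> by \<open>n \<bullet> x = 0\<close>.

  The flux of the flow through the hyperplane \<open>n \<bullet> x = 0\<close> in the direction of increasing \<open>n \<bullet> x\<close> is
  computed in two ways.

  \<^item> From below (\<open>gibbs_crossing\<close>): an orbit that starts on the negative side is on the positive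
    side after half a period, so it crosses upwards. Half of the mass starts on the negative side,
    hence in time 2 the flux is at least \<open>4\<^sup>N / 2\<close>.

  \<^item> From above (\<open>gibbs_ascent_le\<close>): along the flow the derivative of \<open>n \<bullet> x\<close> equals the derivative
    of \<open>F\<close> in the direction \<open>(0, n)\<close>. For fixed \<open>x\<close> and on a line \<open>y + \<real> n\<close> the function \<open>F\<close> is
    convex, so the integral of the positive part of this derivative against \<open>exp (- F)\<close> is
    \<open>exp (- min F)\<close>. Slicing \<open>exp (- min F)\<close> into level sets bounds the flux per unit of time by
    \<open>vol (B\<^sub>p \<inter> H) * vol (proj B\<^sub>q)\<close> times \<open>\<integral> exp (- t) * t ^ ((N - 1) / p + (N - 1) / q) dt = (N - 1)!\<close>.

  Comparing the two gives the bound \<open>4\<^sup>N / 2 \<le> 2 (N - 1)! vol (B\<^sub>p \<inter> H) vol (proj B\<^sub>q)\<close>, which is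
  the claim for sections. The hyperplane is first replaced by a bump of width \<open>\<delta>\<close> and then
  \<open>\<delta>\<close> tends to 0.

  For a projection \<open>P\<close> along a unit vector \<open>e\<close>, let \<open>E\<close> be the hyperplane orthogonal to \<open>e\<close>. The orthogonal
  projection to \<open>E\<close> turns \<open>P B\<^sub>p\<close> into the orthogonal projection of \<open>B\<^sub>p\<close>, and the transpose of \<open>P\<close> maps
  part of the polar of \<open>P B\<^sub>p\<close> onto \<open>B\<^sub>q \<inter> E\<close>. The two volumes change by reciprocal factors (\<open>emeasure_oblique_section\<close>), so the bound for sections
  applies with \<open>p\<close> and \<open>q\<close> exchanged. The cube and the cross-polytope are the limits
  \<open>p \<rightarrow> \<infinity>\<close> and \<open>p \<rightarrow> 1\<close>.
\<close>

section \<open>Lebesgue measure on a hyperplane\<close>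

lemma orthonormal_basis_of_inner:
  assumes "orthonormal_basis_of H B" "b \<in> B" "c \<in> B"
  shows "b \<bullet> c = (if b = c then 1 else 0)"
  using assms unfolding orthonormal_basis_of_def pairwise_def orthogonal_def
  by (metis norm_eq_1)

lemma orthonormal_basis_of_finite:
  fixes H :: "'a::euclidean_space set"
  assumes "orthonormal_basis_of H B"
  shows "finite B" "independent B" "card B = dim H"
proof -
  have "0 \<notin> B" using assms unfolding orthonormal_basis_of_def by auto
  then show i: "independent B"
    using assms pairwise_orthogonal_independent unfolding orthonormal_basis_of_def by blast
  show "finite B" using i independent_imp_finite by blast
  show "card B = dim H" using i assms dim_span_eq_card_independent
    unfolding orthonormal_basis_of_def by metis
qed

text \<open>Weil's argument for the uniqueness of Haar measure: both sides are the
  integral of the indicator of \<open>A\<close> at \<open>x\<close> times the indicator of \<open>B\<close> at \<open>y - x\<close> over pairs \<open>(x, y)\<close>, computed in the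
  two orders of integration and with translation invariance applied in each.\<close>

lemma translation_invariant_measure_unique:
  fixes M :: "'a::euclidean_space measure"
  assumes sf: "sigma_finite_measure M" and [measurable_cong]: "sets M = sets borel"
    and inv: "\<And>a. distr M borel (\<lambda>x. x + a) = M"
    and [measurable]: "A \<in> sets borel" "B \<in> sets borel"
  shows "emeasure M A * emeasure lborel B = emeasure lborel A * emeasure M (uminus -` B)"
proof -
  interpret M: sigma_finite_measure M by fact
  interpret P: pair_sigma_finite M "lborel :: 'a measure" ..
  have spM: "space M = UNIV" using sets_eq_imp_space_eq[OF assms(2)] by simp
  have transl: "(\<integral>\<^sup>+y. h (y + a) \<partial>lborel) = (\<integral>\<^sup>+y. h y \<partial>lborel)"
    if [measurable]: "h \<in> borel_measurable borel" for h :: "'a \<Rightarrow> ennreal" and a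
  proof -
    have "(\<integral>\<^sup>+y. h y \<partial>lborel) = (\<integral>\<^sup>+y. h y \<partial>distr lborel borel ((+) a))"
      by (simp add: lborel_distr_plus)
    then show ?thesis by (simp add: nn_integral_distr add.commute)
  qed
  have translM: "(\<integral>\<^sup>+y. h (y + a) \<partial>M) = (\<integral>\<^sup>+y. h y \<partial>M)"
    if [measurable]: "h \<in> borel_measurable borel" for h :: "'a \<Rightarrow> ennreal" and a
  proof -
    have "(\<integral>\<^sup>+y. h y \<partial>M) = (\<integral>\<^sup>+y. h y \<partial>distr M borel (\<lambda>x. x + a))"
      by (simp add: inv)
    then show ?thesis by (simp add: nn_integral_distr)
  qed
  have [measurable]: "uminus -` B \<in> sets borel"
    using measurable_sets[of uminus borel borel B] by simp
  have "emeasure M A * emeasure lborel B = (\<integral>\<^sup>+x. indicator A x * (\<integral>\<^sup>+y. indicator B y \<partial>lborel) \<partial>M)"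
    by (simp add: nn_integral_multc)
  also have "\<dots> = (\<integral>\<^sup>+x. indicator A x * (\<integral>\<^sup>+y. indicator B (y + - x) \<partial>lborel) \<partial>M)"
    by (subst transl) simp_all
  also have "\<dots> = (\<integral>\<^sup>+x. (\<integral>\<^sup>+y. indicator A x * indicator B (y + - x) \<partial>lborel) \<partial>M)"
    by (simp add: nn_integral_cmult)
  also have "\<dots> = (\<integral>\<^sup>+y. (\<integral>\<^sup>+x. indicator A x * indicator B (y + - x) \<partial>M) \<partial>lborel)"
    by (rule P.Fubini'[symmetric]) measurable
  also have "\<dots> = (\<integral>\<^sup>+y. (\<integral>\<^sup>+x. indicator A (x + y) * indicator B (y + - (x + y)) \<partial>M) \<partial>lborel)"
    by (intro nn_integral_cong translM[symmetric]) measurable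
  also have "\<dots> = (\<integral>\<^sup>+y. (\<integral>\<^sup>+x. indicator A (y + x) * indicator B (- x) \<partial>M) \<partial>lborel)"
    by (simp add: add.commute)
  also have "\<dots> = (\<integral>\<^sup>+x. (\<integral>\<^sup>+y. indicator A (y + x) * indicator B (- x) \<partial>lborel) \<partial>M)"
    by (rule P.Fubini') measurable
  also have "\<dots> = (\<integral>\<^sup>+x. (\<integral>\<^sup>+y. indicator A (y + x) \<partial>lborel) * indicator B (- x) \<partial>M)"
    by (simp add: nn_integral_multc)
  also have "\<dots> = (\<integral>\<^sup>+x. emeasure lborel A * indicator (uminus -` B) x \<partial>M)"
    by (subst transl) (simp_all add: indicator_def)
  also have "\<dots> = emeasure lborel A * emeasure M (uminus -` B)"
    by (subst nn_integral_cmult_indicator) (auto simp: assms(2))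
  finally show ?thesis .
qed

text \<open>The image measure is translation invariant, hence a multiple of Lebesgue
  measure, and the factor is 1 because the unit ball is preserved.\<close>

lemma distr_lborel_orthogonal:
  fixes f :: "'a::euclidean_space \<Rightarrow> 'a"
  assumes f: "orthogonal_transformation f"
  shows "distr lborel borel f = lborel"
proof (rule measure_eqI)
  have lin: "linear f" using f by (simp add: orthogonal_transformation_def)
  have [measurable]: "f \<in> borel_measurable borel"
    using lin by (intro borel_measurable_continuous_onI linear_continuous_on)
       (simp add: linear_linear)
  have nf: "norm (f x) = norm x" for x using f by (rule orthogonal_transformation_norm)
  have cb: "f -` cball 0 r = cball 0 r" for r by (auto simp: nf)
  have em: "emeasure (distr lborel borel f) (cball 0 r) = emeasure lborel (cball (0::'a) r)" for r
    by (subst emeasure_distr) (auto simp: cb)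
  have sf: "sigma_finite_measure (distr lborel borel f)"
  proof (rule sigma_finite_measure.intro, intro exI conjI)
    show "countable (range (\<lambda>k::nat. cball (0::'a) (real k)))" by simp
    show "range (\<lambda>k::nat. cball (0::'a) (real k)) \<subseteq> sets (distr lborel borel f)" by auto
    show "\<Union> (range (\<lambda>k::nat. cball (0::'a) (real k))) = space (distr lborel borel f)"
      by (auto simp: real_arch_simple)
    show "\<forall>a\<in>range (\<lambda>k::nat. cball (0::'a) (real k)). emeasure (distr lborel borel f) a \<noteq> \<infinity>"
      using em emeasure_lborel_cball_finite by (auto simp: less_top)
  qed
  have inv: "distr (distr lborel borel f) borel (\<lambda>x. x + a) = distr lborel borel f" for a
  proof -
    obtain b where b: "a = f b" using orthogonal_transformation_surj[OF f] by (metis surjD)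
    have "distr (distr lborel borel f) borel (\<lambda>x. x + a) = distr lborel borel ((\<lambda>x. x + a) \<circ> f)"
      by (rule distr_distr) auto
    also have "(\<lambda>x. x + a) \<circ> f = f \<circ> (+) b"
      by (auto simp: b linear_add[OF lin] add.commute)
    also have "distr lborel borel (f \<circ> (+) b) = distr (distr lborel borel ((+) b)) borel f"
      by (rule distr_distr[symmetric]) auto
    finally show ?thesis by (simp add: lborel_distr_plus)
  qed
  fix A assume "A \<in> sets (distr lborel borel f)"
  then have [measurable]: "A \<in> sets borel" by simp
  have um: "uminus -` cball (0::'a) 1 = cball 0 1" by auto
  have fin: "emeasure lborel (cball (0::'a) 1) \<noteq> top"
    using emeasure_lborel_cball_finite[of "0::'a" 1] by simp
  have pos: "emeasure lborel (cball (0::'a) 1) \<noteq> 0"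
    by (simp add: emeasure_cball unit_ball_vol_pos less_imp_neq[symmetric])
  have "emeasure (distr lborel borel f) A * emeasure lborel (cball (0::'a) 1)
     = emeasure lborel A * emeasure lborel (cball (0::'a) 1)"
    using translation_invariant_measure_unique[OF sf _ inv, of A "cball 0 1"] by (simp add: em um)
  then show "emeasure (distr lborel borel f) A = emeasure lborel A"
    using fin pos by (simp add: mult.commute[of _ "emeasure lborel (cball 0 1)"] ennreal_mult_cancel_left)
qed simp

lemma lborel_orthonormal_basis:
  fixes B :: "'a::euclidean_space set"
  assumes B: "orthonormal_basis_of UNIV B"
  shows "distr (\<Pi>\<^sub>M b\<in>B. lborel) borel (\<lambda>c. \<Sum>b\<in>B. c b *\<^sub>R b) = lborel"
proof -
  let ?P = "\<Pi>\<^sub>M b\<in>(Basis :: 'a set). lborel :: real measure"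
  let ?Q = "\<Pi>\<^sub>M b\<in>B. lborel :: real measure"
  let ?S = "\<lambda>c :: 'a \<Rightarrow> real. \<Sum>b\<in>Basis. c b *\<^sub>R b"
  let ?R = "\<lambda>c. \<Sum>b\<in>B. c b *\<^sub>R b"
  note fin[simp] = orthonormal_basis_of_finite(1)[OF B]
  have "card B = card (Basis :: 'a set)"
    using orthonormal_basis_of_finite(3)[OF B] by simp
  then obtain r where r: "bij_betw r (Basis :: 'a set) B"
    using finite_same_card_bij[OF finite_Basis[where 'a="'a"] fin] by auto
  define f :: "'a \<Rightarrow> 'a" where "f x = (\<Sum>b\<in>Basis. (x \<bullet> b) *\<^sub>R r b)" for x
  have rB: "r b \<in> B" if "b \<in> Basis" for b using r that by (auto simp: bij_betw_def)
  have rr: "r b \<bullet> r c = (if b = c then 1 else 0)" if "b \<in> Basis" "c \<in> Basis" for b c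
    using orthonormal_basis_of_inner[OF B rB[OF that(1)] rB[OF that(2)]] r that
    by (auto simp: bij_betw_def inj_on_def)
  have lin: "linear f" unfolding f_def
    by (intro linearI) (simp_all add: inner_add_left scaleR_add_left sum.distrib scaleR_sum_right)
  have ff: "f v \<bullet> f w = v \<bullet> w" for v w
  proof -
    have "f v \<bullet> f w = (\<Sum>b\<in>Basis. \<Sum>c\<in>Basis. (v \<bullet> b) * (w \<bullet> c) * (r b \<bullet> r c))"
      unfolding f_def inner_sum_left inner_sum_right
      by (subst sum.swap) (simp add: mult_ac)
    also have "\<dots> = (\<Sum>b\<in>Basis. \<Sum>c\<in>Basis. if b = c then (v \<bullet> b) * (w \<bullet> c) else 0)"
      by (intro sum.cong refl) (simp add: rr)
    also have "\<dots> = v \<bullet> w" by (simp add: euclidean_inner[of v w])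
    finally show ?thesis .
  qed
  have ot: "orthogonal_transformation f" using lin ff by (simp add: orthogonal_transformation_def)
  have [measurable]: "f \<in> borel_measurable borel"
    using lin by (intro borel_measurable_continuous_onI linear_continuous_on)
       (simp add: linear_linear)
  define T where "T c = (\<lambda>b\<in>B. c (inv_into Basis r b))" for c :: "'a \<Rightarrow> real"
  have iB: "inv_into Basis r b \<in> Basis" if "b \<in> B" for b
    using r that by (metis bij_betw_def inv_into_into)
  have Tm[measurable]: "T \<in> ?P \<rightarrow>\<^sub>M ?Q"
    unfolding T_def using iB by (intro measurable_restrict) (auto intro!: measurable_component_singleton)
  interpret product_sigma_finite "\<lambda>b::'a. lborel :: real measure" ..
  have "distr ?P ?Q T = ?Q"
  proof (rule PiM_eqI)
    fix A :: "'a \<Rightarrow> real set" assume A: "\<And>i. i \<in> B \<Longrightarrow> A i \<in> sets lborel"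
    have "T -` Pi\<^sub>E B A \<inter> space ?P = Pi\<^sub>E Basis (\<lambda>b. A (r b))"
    proof (intro set_eqI iffI)
      fix c assume c: "c \<in> T -` Pi\<^sub>E B A \<inter> space ?P"
      have "c b \<in> A (r b)" if "b \<in> Basis" for b
      proof -
        have "T c (r b) \<in> A (r b)" using c rB[OF that] by auto
        then show ?thesis using rB[OF that] r that by (simp add: T_def bij_betw_def)
      qed
      then show "c \<in> Pi\<^sub>E Basis (\<lambda>b. A (r b))" using c by (auto simp: space_PiM PiE_def)
    next
      fix c assume c: "c \<in> Pi\<^sub>E Basis (\<lambda>b. A (r b))"
      then have "T c \<in> Pi\<^sub>E B A" unfolding T_def using r iB
        by (auto simp: bij_betw_def Pi_iff f_inv_into_f dest!: PiE_mem)
      then show "c \<in> T -` Pi\<^sub>E B A \<inter> space ?P" using c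
        by (auto simp: space_PiM PiE_def)
    qed
    then have "emeasure (distr ?P ?Q T) (Pi\<^sub>E B A)
        = emeasure ?P (Pi\<^sub>E Basis (\<lambda>b. A (r b)))"
      using A by (subst emeasure_distr) (auto intro!: sets_PiM_I_finite)
    also have "\<dots> = (\<Prod>b\<in>Basis. emeasure lborel (A (r b)))"
      using A rB by (subst emeasure_PiM) auto
    also have "\<dots> = (\<Prod>b\<in>B. emeasure lborel (A b))"
      using r by (rule prod.reindex_bij_betw)
    finally show "emeasure (distr ?P ?Q T) (Pi\<^sub>E B A) = (\<Prod>b\<in>B. emeasure lborel (A b))" .
  qed simp_all
  then have "distr ?Q borel ?R
     = distr (distr ?P ?Q T) borel ?R" by simp
  also have "\<dots> = distr ?P borel (?R \<circ> T)"
    by (rule distr_distr) auto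
  also have "?R \<circ> T = f \<circ> ?S"
  proof
    fix c
    have "(?R \<circ> T) c = (\<Sum>b\<in>B. c (inv_into Basis r b) *\<^sub>R b)"
      by (simp add: T_def)
    also have "\<dots> = (\<Sum>b\<in>Basis. c b *\<^sub>R r b)"
      using r by (subst sum.reindex_bij_betw[symmetric, OF r], intro sum.cong) (auto simp: bij_betw_def)
    also have "\<dots> = (f \<circ> ?S) c"
      by (simp add: f_def inner_sum_left inner_Basis if_distrib cong: if_cong)
    finally show "(?R \<circ> T) c = (f \<circ> ?S) c" .
  qed
  also have "distr ?P borel (f \<circ> ?S)
     = distr (distr ?P borel ?S) borel f"
    by (rule distr_distr[symmetric]) auto
  also have "\<dots> = distr lborel borel f" by (simp add: lborel_eq[symmetric])
  also have "\<dots> = lborel" by (rule distr_lborel_orthogonal[OF ot])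
  finally show ?thesis .
qed

abbreviation hyperplane :: "'a::real_inner \<Rightarrow> 'a set" where
  "hyperplane n \<equiv> {x. n \<bullet> x = 0}"

abbreviation hyperplane_lborel :: "'a::euclidean_space \<Rightarrow> 'a measure" where
  "hyperplane_lborel n \<equiv> subspace_lborel (hyperplane n)"

text \<open>The orthogonal projection to \<open>hyperplane n\<close> when \<open>n\<close> is a unit vector.\<close>

abbreviation flatten :: "'a::real_inner \<Rightarrow> 'a \<Rightarrow> 'a" where
  "flatten n \<equiv> \<lambda>x. x - (n \<bullet> x) *\<^sub>R n"

text \<open>The measure of the hyperplane is defined through some orthonormal basis.
  Adding the normal completes that basis to one of the whole space, so both measures are products over the same coordinates.\<close>

lemma hyperplane_lborel_coordinates:
  fixes n :: "'a::euclidean_space"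
  assumes n: "norm n = 1"
  obtains B where "finite B" "n \<notin> B" "\<And>b. b \<in> B \<Longrightarrow> n \<bullet> b = 0"
    "hyperplane_lborel n = distr (\<Pi>\<^sub>M b\<in>B. lborel) borel (\<lambda>c. \<Sum>b\<in>B. c b *\<^sub>R b)"
    "lborel = distr (\<Pi>\<^sub>M b\<in>insert n B. lborel) borel (\<lambda>c. \<Sum>b\<in>insert n B. c b *\<^sub>R b)"
proof -
  define H where "H = hyperplane n"
  have sub: "subspace H" unfolding H_def by (rule subspace_hyperplane)
  define B where "B = (SOME B. orthonormal_basis_of H B)"
  have B: "orthonormal_basis_of H B" unfolding B_def
    using orthonormal_basis_of_exists[OF sub] by (rule someI_ex)
  have BH: "n \<bullet> b = 0" if "b \<in> B" for b
    using B that span_superset[of B] unfolding orthonormal_basis_of_def H_def by auto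
  have nn: "n \<bullet> n = 1" using n by (simp add: norm_eq_1)
  have nB[simp]: "n \<notin> B" using BH nn by auto
  have full: "orthonormal_basis_of UNIV (insert n B)"
    unfolding orthonormal_basis_of_def
  proof (intro conjI)
    show "pairwise orthogonal (insert n B)"
      using B BH unfolding orthonormal_basis_of_def pairwise_insert
      by (auto simp: orthogonal_def inner_commute)
    show "\<forall>b\<in>insert n B. norm b = 1" using B n by (auto simp: orthonormal_basis_of_def)
    show "span (insert n B) = UNIV"
    proof (intro set_eqI iffI)
      fix x :: "'a"
      have "x - (n \<bullet> x) *\<^sub>R n \<in> H" by (simp add: H_def inner_diff_right nn)
      then have "x - (n \<bullet> x) *\<^sub>R n \<in> span B" using B by (simp add: orthonormal_basis_of_def)
      then show "x \<in> span (insert n B)" by (subst span_insert) auto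
    qed simp
  qed
  show thesis
    by (rule that[of B, OF orthonormal_basis_of_finite(1)[OF B] nB BH _ lborel_orthonormal_basis[OF full, symmetric]])
       (auto simp: subspace_lborel_def Let_def B_def H_def)
qed

lemma sets_subspace_lborel[simp, measurable_cong]: "sets (subspace_lborel H) = sets borel"
  and space_subspace_lborel[simp]: "space (subspace_lborel H) = UNIV"
  by (simp_all add: subspace_lborel_def Let_def)

lemma nn_integral_hyperplane:
  fixes n :: "'a::euclidean_space" and h :: "'a \<Rightarrow> ennreal"
  assumes n: "norm n = 1" and [measurable]: "h \<in> borel_measurable borel"
  shows "(\<integral>\<^sup>+x. h x \<partial>lborel) = (\<integral>\<^sup>+w. (\<integral>\<^sup>+u. h (w + u *\<^sub>R n) \<partial>lborel) \<partial>hyperplane_lborel n)"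
    and "(\<integral>\<^sup>+x. h x \<partial>lborel) = (\<integral>\<^sup>+u. (\<integral>\<^sup>+w. h (w + u *\<^sub>R n) \<partial>hyperplane_lborel n) \<partial>lborel)"
proof -
  obtain B where B: "finite B" "n \<notin> B" and B0: "\<And>b. b \<in> B \<Longrightarrow> n \<bullet> b = 0" and
    B3: "hyperplane_lborel n = distr (\<Pi>\<^sub>M b\<in>B. lborel) borel (\<lambda>c. \<Sum>b\<in>B. c b *\<^sub>R b)" and
    B4: "lborel = distr (\<Pi>\<^sub>M b\<in>insert n B. lborel) borel (\<lambda>c. \<Sum>b\<in>insert n B. c b *\<^sub>R b)"
    by (rule hyperplane_lborel_coordinates[OF n]) blast
  interpret product_sigma_finite "\<lambda>b::'a. lborel :: real measure" ..
  have upd: "(\<Sum>b\<in>insert n B. (c(n := u)) b *\<^sub>R b) = (\<Sum>b\<in>B. c b *\<^sub>R b) + u *\<^sub>R n" for c u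
  proof -
    have "(\<Sum>b\<in>B. (c(n:=u)) b *\<^sub>R b) = (\<Sum>b\<in>B. c b *\<^sub>R b)" using B(2) by (intro sum.cong) auto
    then show ?thesis using B(1,2) by simp
  qed
  have *: "(\<integral>\<^sup>+x. h x \<partial>lborel) = (\<integral>\<^sup>+c. h (\<Sum>b\<in>insert n B. c b *\<^sub>R b) \<partial>(\<Pi>\<^sub>M b\<in>insert n B. lborel))"
    by (subst B4, subst nn_integral_distr) measurable
  show "(\<integral>\<^sup>+x. h x \<partial>lborel) = (\<integral>\<^sup>+w. (\<integral>\<^sup>+u. h (w + u *\<^sub>R n) \<partial>lborel) \<partial>hyperplane_lborel n)"
    unfolding * B3
    by (subst nn_integral_distr, measurable, subst product_nn_integral_insert[OF B(1,2)], measurable)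
       (simp only: upd)
  show "(\<integral>\<^sup>+x. h x \<partial>lborel) = (\<integral>\<^sup>+u. (\<integral>\<^sup>+w. h (w + u *\<^sub>R n) \<partial>hyperplane_lborel n) \<partial>lborel)"
    unfolding * B3
    by (subst nn_integral_distr, measurable, subst product_nn_integral_insert_rev[OF B(1,2)], measurable)
       (simp only: upd)
qed

lemma AE_subspace_lborel_hyperplane:
  fixes n :: "'a::euclidean_space"
  assumes n: "norm n = 1"
  shows "AE w in hyperplane_lborel n. n \<bullet> w = 0"
proof -
  obtain B where B: "\<And>b. b \<in> B \<Longrightarrow> n \<bullet> b = 0" and
    B2: "hyperplane_lborel n = distr (\<Pi>\<^sub>M b\<in>B. lborel) borel (\<lambda>c. \<Sum>b\<in>B. c b *\<^sub>R b)"
    by (rule hyperplane_lborel_coordinates[OF n]) blast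
  show ?thesis unfolding B2 by (subst AE_distr_iff) (auto simp: inner_sum_right B)
qed

text \<open>This moves volumes in the hyperplane to volumes of cylinders in the
  ambient space, where translations and dilations are understood.\<close>

lemma nn_integral_hyperplane_cylinder:
  fixes n :: "'a::euclidean_space" and g :: "real \<Rightarrow> ennreal"
  assumes n: "norm n = 1" and [measurable]: "g \<in> borel_measurable borel" "S \<in> sets borel"
  shows "(\<integral>\<^sup>+x. g (n \<bullet> x) * indicator S (x - (n \<bullet> x) *\<^sub>R n) \<partial>lborel) =
           (\<integral>\<^sup>+u. g u \<partial>lborel) * emeasure (hyperplane_lborel n) S"
proof -
  have nn: "n \<bullet> n = 1" using n by (simp add: norm_eq_1)
  have "(\<integral>\<^sup>+x. g (n \<bullet> x) * indicator S (x - (n \<bullet> x) *\<^sub>R n) \<partial>lborel) =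
    (\<integral>\<^sup>+w. (\<integral>\<^sup>+u. g (n \<bullet> (w + u *\<^sub>R n)) * indicator S ((w + u *\<^sub>R n) - (n \<bullet> (w + u *\<^sub>R n)) *\<^sub>R n) \<partial>lborel) \<partial>hyperplane_lborel n)"
    by (rule nn_integral_hyperplane(1)[OF n]) measurable
  also have "\<dots> = (\<integral>\<^sup>+w. (\<integral>\<^sup>+u. g u * indicator S w \<partial>lborel) \<partial>hyperplane_lborel n)"
    using AE_subspace_lborel_hyperplane[OF n]
    by (intro nn_integral_cong_AE) (auto simp: inner_add_right nn)
  also have "\<dots> = (\<integral>\<^sup>+w. (\<integral>\<^sup>+u. g u \<partial>lborel) * indicator S w \<partial>hyperplane_lborel n)"
    by (simp add: nn_integral_multc)
  finally show ?thesis by (simp add: nn_integral_cmult_indicator)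
qed

lemma emeasure_hyperplane_slab:
  fixes n :: "'a::euclidean_space"
  assumes n: "norm n = 1" and [measurable]: "S \<in> sets borel" and r: "0 \<le> r"
  shows "emeasure lborel {x. 0 \<le> n \<bullet> x \<and> n \<bullet> x \<le> r \<and> x - (n \<bullet> x) *\<^sub>R n \<in> S}
       = ennreal r * emeasure (hyperplane_lborel n) S"
proof -
  have "emeasure lborel {x. 0 \<le> n \<bullet> x \<and> n \<bullet> x \<le> r \<and> x - (n \<bullet> x) *\<^sub>R n \<in> S}
     = (\<integral>\<^sup>+x. indicator {x. 0 \<le> n \<bullet> x \<and> n \<bullet> x \<le> r \<and> x - (n \<bullet> x) *\<^sub>R n \<in> S} x \<partial>lborel)"
    by (subst nn_integral_indicator) measurable
  also have "\<dots> = (\<integral>\<^sup>+x. indicator {0..r} (n \<bullet> x) * indicator S (x - (n \<bullet> x) *\<^sub>R n) \<partial>lborel)"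
    by (intro nn_integral_cong) (auto simp: indicator_def)
  also have "\<dots> = (\<integral>\<^sup>+u. indicator {0..r} u \<partial>lborel) * emeasure (hyperplane_lborel n) S"
    by (rule nn_integral_hyperplane_cylinder[OF n]) auto
  finally show ?thesis using r by simp
qed

text \<open>Dilating a slab of height 1 gives a slab of height \<open>r\<close>, which accounts
  for one of the \<open>DIM('a)\<close> factors \<open>r\<close>.\<close>

lemma emeasure_subspace_scaleR:
  fixes n :: "'a::euclidean_space"
  assumes n: "norm n = 1" and [measurable]: "S \<in> sets borel" and r: "0 < r"
  shows "emeasure (hyperplane_lborel n) ((\<lambda>x. r *\<^sub>R x) ` S)
     = ennreal (r ^ (DIM('a) - 1)) * emeasure (hyperplane_lborel n) S"
proof -
  let ?M = "hyperplane_lborel n"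
  have imb: "(\<lambda>x. r *\<^sub>R x) ` S = (\<lambda>x. (1/r) *\<^sub>R x) -` S"
    using r by (auto simp: image_iff intro!: bexI[where x="(1/r) *\<^sub>R _"])
  have im[measurable]: "(\<lambda>x. r *\<^sub>R x) ` S \<in> sets borel"
    unfolding imb using measurable_sets[of "\<lambda>x::'a. (1/r) *\<^sub>R x" borel borel S] by simp
  define A where "A = {x. 0 \<le> n \<bullet> x \<and> n \<bullet> x \<le> 1 \<and> x - (n \<bullet> x) *\<^sub>R n \<in> S}"
  have [measurable]: "A \<in> sets borel" unfolding A_def by measurable
  have "ennreal r * emeasure ?M ((\<lambda>x. r *\<^sub>R x) ` S) =
      emeasure lborel {x. 0 \<le> n \<bullet> x \<and> n \<bullet> x \<le> r \<and> x - (n \<bullet> x) *\<^sub>R n \<in> (\<lambda>x. r *\<^sub>R x) ` S}"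
    using r by (subst emeasure_hyperplane_slab[OF n]) auto
  also have "{x. 0 \<le> n \<bullet> x \<and> n \<bullet> x \<le> r \<and> x - (n \<bullet> x) *\<^sub>R n \<in> (\<lambda>x. r *\<^sub>R x) ` S} = (\<lambda>x. (1/r) *\<^sub>R x) -` A"
    unfolding imb A_def using r by (auto simp: field_simps scaleR_diff_right)
  also have "emeasure lborel \<dots> = emeasure (distr lborel borel (\<lambda>x. 0 + (1/r) *\<^sub>R x)) A"
    by (subst emeasure_distr) auto
  also have "\<dots> = ennreal (r ^ DIM('a)) * emeasure lborel A"
  proof -
    have "emeasure lborel A = emeasure (density (distr lborel borel (\<lambda>x::'a. 0 + (1/r) *\<^sub>R x)) (\<lambda>_. ennreal (\<bar>1/r\<bar> ^ DIM('a)))) A"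
      using r by (subst lborel_affine[of "1/r" 0]) auto
    also have "\<dots> = ennreal (\<bar>1/r\<bar> ^ DIM('a)) * emeasure (distr lborel borel (\<lambda>x. 0 + (1/r) *\<^sub>R x)) A"
      by (subst emeasure_density) (auto simp: nn_integral_cmult_indicator)
    finally have "ennreal (r ^ DIM('a)) * emeasure lborel A = (ennreal (r ^ DIM('a)) * ennreal (\<bar>1/r\<bar> ^ DIM('a))) * emeasure (distr lborel borel (\<lambda>x. 0 + (1/r) *\<^sub>R x)) A"
      by (simp add: mult.assoc)
    also have "ennreal (r ^ DIM('a)) * ennreal (\<bar>1/r\<bar> ^ DIM('a)) = 1"
      using r by (simp add: ennreal_mult[symmetric] power_mult_distrib[symmetric] del: ennreal_mult)
    finally show ?thesis by simp
  qed
  also have "emeasure lborel A = emeasure ?M S"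
    unfolding A_def using emeasure_hyperplane_slab[OF n, of S 1] by simp
  also have "ennreal (r ^ DIM('a)) = ennreal r * ennreal (r ^ (DIM('a) - 1))"
    using r power_eq_if[of r "DIM('a)"] by (simp add: ennreal_mult[symmetric])
  finally have "ennreal r * emeasure ?M ((\<lambda>x. r *\<^sub>R x) ` S)
     = ennreal r * (ennreal (r ^ (DIM('a) - 1)) * emeasure ?M S)" by (simp only: mult.assoc)
  then show ?thesis using r by (subst (asm) ennreal_mult_cancel_left) auto
qed

lemma emeasure_subspace_translate:
  fixes n :: "'a::euclidean_space"
  assumes n: "norm n = 1" and [measurable]: "S \<in> sets borel" and k: "n \<bullet> k = 0"
  shows "emeasure (hyperplane_lborel n) ((\<lambda>x. x + k) -` S)
     = emeasure (hyperplane_lborel n) S"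
proof -
  have [measurable]: "(\<lambda>x. x + k) -` S \<in> sets borel"
    using measurable_sets[of "\<lambda>x. x + k" borel borel S] by simp
  let ?A = "\<lambda>S. {x. 0 \<le> n \<bullet> x \<and> n \<bullet> x \<le> 1 \<and> x - (n \<bullet> x) *\<^sub>R n \<in> S}"
  have [measurable]: "?A S \<in> sets borel" by measurable
  have "emeasure lborel (?A ((\<lambda>x. x + k) -` S)) = emeasure lborel ((+) k -` ?A S)"
    by (intro arg_cong[where f="emeasure lborel"]) (auto simp: inner_add_right k algebra_simps)
  also have "\<dots> = emeasure (distr lborel borel ((+) k)) (?A S)"
    by (subst emeasure_distr) auto
  finally show ?thesis
    using emeasure_hyperplane_slab[OF n, of S 1] emeasure_hyperplane_slab[OF n, of "(\<lambda>x. x + k) -` S" 1]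
    by (simp add: lborel_distr_plus)
qed

text \<open>The cosine rule for projections between two hyperplanes. The map
  \<open>w \<mapsto> w - ((e \<bullet> w) / (n \<bullet> e)) n\<close> is the inverse of the orthogonal projection, along \<open>n\<close>, of the hyperplane
  of \<open>e\<close> to that of \<open>n\<close>. Both sides are the volume of the cylinder with unit segments in direction \<open>n\<close>
  over the part of \<open>S\<close> in the hyperplane of \<open>e\<close>, sliced
  along lines parallel to \<open>n\<close> and along hyperplanes orthogonal to \<open>e\<close>.\<close>

lemma emeasure_oblique_section:
  fixes n e :: "'a::euclidean_space"
  assumes n: "norm n = 1" and e: "norm e = 1" and c: "0 < n \<bullet> e" and [measurable]: "S \<in> sets borel"
  shows "emeasure (hyperplane_lborel n) ((\<lambda>w. w - ((e \<bullet> w) / (n \<bullet> e)) *\<^sub>R n) -` S)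
     = ennreal (n \<bullet> e) * emeasure (hyperplane_lborel e) S"
proof -
  define c where "c = n \<bullet> e"
  have c0: "0 < c" and en: "e \<bullet> n = c" using assms by (auto simp: c_def inner_commute)
  have nn: "n \<bullet> n = 1" "e \<bullet> e = 1" using n e by (simp_all add: norm_eq_1)
  define h :: "'a \<Rightarrow> ennreal" where
    "h x = indicator {0..c} (e \<bullet> x) * indicator S (x - ((e \<bullet> x) / c) *\<^sub>R n)" for x
  have [measurable]: "h \<in> borel_measurable borel" unfolding h_def by measurable
  let ?p = "\<lambda>w. w - ((e \<bullet> w) / c) *\<^sub>R n"
  have [measurable]: "?p -` S \<in> sets borel"
    using measurable_sets[of ?p borel borel S] by simp
  have "(\<integral>\<^sup>+x. h x \<partial>lborel) = (\<integral>\<^sup>+w. (\<integral>\<^sup>+u. h (w + u *\<^sub>R n) \<partial>lborel) \<partial>hyperplane_lborel n)"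
    by (rule nn_integral_hyperplane(1)[OF n]) measurable
  also have "\<dots> = (\<integral>\<^sup>+w. (\<integral>\<^sup>+u. indicator {- (e \<bullet> w) / c .. 1 - (e \<bullet> w) / c} u * indicator S (?p w) \<partial>lborel) \<partial>hyperplane_lborel n)"
  proof (intro nn_integral_cong)
    fix w u
    have 1: "e \<bullet> (w + u *\<^sub>R n) = e \<bullet> w + u * c" by (simp add: inner_add_right en)
    have 2: "(e \<bullet> w + u * c) / c = (e \<bullet> w) / c + u" using c0 by (simp add: add_divide_distrib)
    have 3: "w + u *\<^sub>R n - ((e \<bullet> w) / c + u) *\<^sub>R n = ?p w" by (simp add: scaleR_add_left)
    have 4: "0 \<le> e \<bullet> w + u * c \<and> e \<bullet> w + u * c \<le> c \<longleftrightarrow> - (e \<bullet> w) / c \<le> u \<and> u \<le> 1 - (e \<bullet> w) / c"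
      using c0 by (simp add: field_simps) linarith
    show "h (w + u *\<^sub>R n) = indicator {- (e \<bullet> w) / c .. 1 - (e \<bullet> w) / c} u * indicator S (?p w)"
      unfolding h_def 1 2 3 using 4 by (simp add: indicator_def)
  qed
  also have "\<dots> = (\<integral>\<^sup>+w. indicator (?p -` S) w \<partial>hyperplane_lborel n)"
  proof (intro nn_integral_cong)
    fix w
    have "indicator S (?p w) = (indicator (?p -` S) w :: ennreal)" by (simp add: indicator_def)
    then show "(\<integral>\<^sup>+u. indicator {- (e \<bullet> w) / c .. 1 - (e \<bullet> w) / c} u * indicator S (?p w) \<partial>lborel) = indicator (?p -` S) w"
      by (simp add: nn_integral_multc)
  qed
  also have "\<dots> = emeasure (hyperplane_lborel n) (?p -` S)" by simp
  finally have 1: "(\<integral>\<^sup>+x. h x \<partial>lborel) = emeasure (hyperplane_lborel n) (?p -` S)" .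
  have "(\<integral>\<^sup>+x. h x \<partial>lborel) = (\<integral>\<^sup>+u. (\<integral>\<^sup>+w. h (w + u *\<^sub>R e) \<partial>hyperplane_lborel e) \<partial>lborel)"
    by (rule nn_integral_hyperplane(2)[OF e]) measurable
  also have "\<dots> = (\<integral>\<^sup>+u. (\<integral>\<^sup>+w. indicator {0..c} u * indicator ((\<lambda>x. x + u *\<^sub>R (e - (1/c) *\<^sub>R n)) -` S) w \<partial>hyperplane_lborel e) \<partial>lborel)"
    using AE_subspace_lborel_hyperplane[OF e]
    by (intro nn_integral_cong nn_integral_cong_AE)
       (auto simp: h_def inner_add_right nn indicator_def algebra_simps)
  also have "\<dots> = (\<integral>\<^sup>+u. indicator {0..c} u * emeasure (hyperplane_lborel e) S \<partial>lborel)"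
  proof (intro nn_integral_cong)
    fix u
    have m[measurable]: "(\<lambda>x. x + u *\<^sub>R (e - (1/c) *\<^sub>R n)) -` S \<in> sets borel"
      using measurable_sets[of "\<lambda>x. x + u *\<^sub>R (e - (1/c) *\<^sub>R n)" borel borel S] by simp
    have k: "e \<bullet> (u *\<^sub>R (e - (1/c) *\<^sub>R n)) = 0" using c0 by (simp add: inner_diff_right nn en)
    show "(\<integral>\<^sup>+w. indicator {0..c} u * indicator ((\<lambda>x. x + u *\<^sub>R (e - (1/c) *\<^sub>R n)) -` S) w \<partial>hyperplane_lborel e)
      = indicator {0..c} u * emeasure (hyperplane_lborel e) S"
      using emeasure_subspace_translate[OF e _ k, of S] by (simp add: nn_integral_cmult_indicator)
  qed
  also have "\<dots> = ennreal c * emeasure (hyperplane_lborel e) S"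
    using c0 by (simp add: nn_integral_multc)
  finally show ?thesis using 1 by (simp add: c_def)
qed

lemma emeasure_subspace_lborel_bounded:
  fixes n :: "'a::euclidean_space"
  assumes n: "norm n = 1" and S[measurable]: "S \<in> sets borel" and b: "bounded S"
  shows "emeasure (hyperplane_lborel n) S < \<infinity>"
proof -
  obtain r where r: "\<And>x. x \<in> S \<Longrightarrow> norm x \<le> r" using b unfolding bounded_iff by blast
  have "{x. 0 \<le> n \<bullet> x \<and> n \<bullet> x \<le> 1 \<and> x - (n \<bullet> x) *\<^sub>R n \<in> S} \<subseteq> cball 0 (r + 1)"
  proof
    fix x assume x: "x \<in> {x. 0 \<le> n \<bullet> x \<and> n \<bullet> x \<le> 1 \<and> x - (n \<bullet> x) *\<^sub>R n \<in> S}"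
    have "norm x \<le> norm (x - (n \<bullet> x) *\<^sub>R n) + norm ((n \<bullet> x) *\<^sub>R n)"
      by (metis diff_add_cancel norm_triangle_ineq)
    also have "\<dots> \<le> r + 1" using x r[of "x - (n \<bullet> x) *\<^sub>R n"] n by auto
    finally show "x \<in> cball 0 (r + 1)" by simp
  qed
  then have "emeasure lborel {x. 0 \<le> n \<bullet> x \<and> n \<bullet> x \<le> 1 \<and> x - (n \<bullet> x) *\<^sub>R n \<in> S} \<le> emeasure lborel (cball (0::'a) (r + 1))"
    by (rule emeasure_mono) simp
  also have "\<dots> < \<infinity>" by (rule emeasure_lborel_cball_finite)
  finally show ?thesis using emeasure_hyperplane_slab[OF n S, of 1] by simp
qed

lemma sigma_finite_subspace_lborel:
  fixes n :: "'a::euclidean_space"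
  assumes n: "norm n = 1"
  shows "sigma_finite_measure (hyperplane_lborel n)"
proof (rule sigma_finite_measure.intro, intro exI conjI)
  show "countable (range (\<lambda>k::nat. cball (0::'a) (real k)))" by simp
  show "range (\<lambda>k::nat. cball (0::'a) (real k)) \<subseteq> sets (hyperplane_lborel n)" by auto
  show "\<Union> (range (\<lambda>k::nat. cball (0::'a) (real k))) = space (hyperplane_lborel n)"
    by (auto simp: real_arch_simple)
  show "\<forall>a\<in>range (\<lambda>k::nat. cball (0::'a) (real k)). emeasure (hyperplane_lborel n) a \<noteq> \<infinity>"
  proof
    fix a assume "a \<in> range (\<lambda>k::nat. cball (0::'a) (real k))"
    then obtain k :: nat where "a = cball 0 (real k)" by auto
    then show "emeasure (hyperplane_lborel n) a \<noteq> \<infinity>"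
      using emeasure_subspace_lborel_bounded[OF n, of "cball 0 (real k)"] by auto
  qed
qed

section \<open>Action-angle coordinates in the plane\<close>

text \<open>The orbit of energy 1 in the plane runs around the boundary of the square
  \<open>[-1,1]\<^sup>2\<close>. Starting in the corner \<open>(-1, 1)\<close> it traverses the top side with speed \<open>q\<close> in the time \<open>2/q\<close> and then the right
  side with speed \<open>p\<close> in the time \<open>2/p\<close>. As \<open>2/q + 2/p = 2\<close>, the half period is 2. These are the two coordinates on
  the first half of the orbit.\<close>

definition halfwave_x :: "real \<Rightarrow> real \<Rightarrow> real" where
  "halfwave_x q \<theta> = min 1 (q * \<theta> - 1)"
definition halfwave_y :: "real \<Rightarrow> real \<Rightarrow> real" where
  "halfwave_y p \<theta> = min 1 (p * (2 - \<theta>) - 1)"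

text \<open>The second half of an orbit is the negative of the first. A starting time in \<open>[0,4)\<close> and an
  elapsed time in \<open>[0,2]\<close> add up to less than 6, so three half periods are enough.\<close>

definition half_turns :: "(real \<Rightarrow> real) \<Rightarrow> real \<Rightarrow> real" where
  "half_turns f \<theta> = (if \<theta> < 2 then f \<theta> else if \<theta> < 4 then - f (\<theta> - 2) else f (\<theta> - 4))"

lemma half_turns_measurable[measurable]:
  assumes [measurable]: "f \<in> borel_measurable borel"
  shows "half_turns f \<in> borel_measurable borel"
  unfolding half_turns_def[abs_def] by measurable

lemma halfwave_measurable[measurable]:
  "halfwave_x q \<in> borel_measurable borel" "halfwave_y q \<in> borel_measurable borel"
  unfolding halfwave_x_def[abs_def] halfwave_y_def[abs_def] by measurable

abbreviation orbit_x :: "real \<Rightarrow> real \<Rightarrow> real \<Rightarrow> real \<Rightarrow> real" where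
  "orbit_x p q t u \<equiv> t powr (1/p) * half_turns (halfwave_x q) u"

abbreviation orbit_y :: "real \<Rightarrow> real \<Rightarrow> real \<Rightarrow> real \<Rightarrow> real" where
  "orbit_y p q t u \<equiv> t powr (1/q) * half_turns (halfwave_y p) u"

text \<open>An orbit of energy \<open>t\<close> is the orbit of energy 1 rescaled by \<open>t\<^sup>1\<^sup>/\<^sup>p\<close> and \<open>t\<^sup>1\<^sup>/\<^sup>q\<close>; the
  pair \<open>(t, \<theta>)\<close> is the action and the angle, and \<open>s\<close> is the elapsed time.\<close>

definition orbit_point :: "real \<Rightarrow> real \<Rightarrow> real \<Rightarrow> real \<times> real \<Rightarrow> real \<times> real" where
  "orbit_point p q s = (\<lambda>(t, \<theta>). (orbit_x p q t (\<theta> + s), orbit_y p q t (\<theta> + s)))"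

lemma borel_measurable_curried:
  fixes h :: "real \<Rightarrow> real \<Rightarrow> ennreal"
  assumes h: "case_prod h \<in> borel_measurable borel" and "a \<in> borel_measurable M" "b \<in> borel_measurable M"
  shows "(\<lambda>x. h (a x) (b x)) \<in> borel_measurable M"
  using measurable_compose[OF measurable_Pair[OF assms(2,3)] h[unfolded borel_prod[symmetric]]] by simp

lemma nn_integral_translate_real:
  fixes f :: "real \<Rightarrow> ennreal"
  assumes "f \<in> borel_measurable borel"
  shows "(\<integral>\<^sup>+x. f (x + a) \<partial>lborel) = (\<integral>\<^sup>+x. f x \<partial>lborel)"
  using nn_integral_real_affine[OF assms, of 1 a] by (simp add: add.commute)

text \<open>The average over a full period does not depend on the elapsed time \<open>s\<close>. This is the invariance of
  the measure under the flow.\<close>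

lemma nn_integral_half_turns:
  fixes h :: "real \<Rightarrow> real \<Rightarrow> ennreal"
  assumes [measurable]: "f \<in> borel_measurable borel" "g \<in> borel_measurable borel"
     "case_prod h \<in> borel_measurable borel" and s: "0 \<le> s" "s \<le> 2"
  shows "(\<integral>\<^sup>+\<theta>. h (half_turns f (\<theta> + s)) (half_turns g (\<theta> + s)) * indicator {0..<4} \<theta> \<partial>lborel)
       = (\<integral>\<^sup>+\<theta>. (h (f \<theta>) (g \<theta>) + h (- f \<theta>) (- g \<theta>)) * indicator {0..<2} \<theta> \<partial>lborel)"
proof -
  note [measurable (raw)] = borel_measurable_curried[OF assms(3)]
  define k0 where "k0 \<theta> = h (f \<theta>) (g \<theta>)" for \<theta>
  define k1 where "k1 \<theta> = h (- f \<theta>) (- g \<theta>)" for \<theta>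
  have [measurable]: "k0 \<in> borel_measurable borel" "k1 \<in> borel_measurable borel"
    unfolding k0_def k1_def by measurable
  have "(\<integral>\<^sup>+\<theta>. h (half_turns f (\<theta> + s)) (half_turns g (\<theta> + s)) * indicator {0..<4} \<theta> \<partial>lborel)
    = (\<integral>\<^sup>+\<theta>. (k0 (\<theta> + s) * indicator {s..<2} (\<theta> + s) + k1 (\<theta> + (s - 2)) * indicator {0..<2} (\<theta> + (s - 2))) + k0 (\<theta> + (s - 4)) * indicator {0..<s} (\<theta> + (s - 4)) \<partial>lborel)"
  proof (intro nn_integral_cong)
    fix \<theta>
    define z where "z = \<theta> + s"
    have z: "\<theta> = z - s" "z - s + s = z" "z - s + (s - 2) = z - 2" "z - s + (s - 4) = z - 4" by (simp_all add: z_def)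
    consider "z < s" | "s \<le> z" "z < 2" | "2 \<le> z" "z < 4" | "4 \<le> z" "z < 4 + s" | "4 + s \<le> z"
      by linarith
    then show "h (half_turns f (\<theta> + s)) (half_turns g (\<theta> + s)) * indicator {0..<4} \<theta> =
      (k0 (\<theta> + s) * indicator {s..<2} (\<theta> + s) + k1 (\<theta> + (s - 2)) * indicator {0..<2} (\<theta> + (s - 2))) + k0 (\<theta> + (s - 4)) * indicator {0..<s} (\<theta> + (s - 4))"
      unfolding z half_turns_def k0_def k1_def indicator_def atLeastLessThan_iff using s by cases simp_all
  qed
  also have "\<dots> = ((\<integral>\<^sup>+\<theta>. k0 (\<theta> + s) * indicator {s..<2} (\<theta> + s) \<partial>lborel) + (\<integral>\<^sup>+\<theta>. k1 (\<theta> + (s - 2)) * indicator {0..<2} (\<theta> + (s - 2)) \<partial>lborel))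
     + (\<integral>\<^sup>+\<theta>. k0 (\<theta> + (s - 4)) * indicator {0..<s} (\<theta> + (s - 4)) \<partial>lborel)"
    by (simp add: nn_integral_add)
  also have "\<dots> = ((\<integral>\<^sup>+\<theta>. k0 \<theta> * indicator {s..<2} \<theta> \<partial>lborel) + (\<integral>\<^sup>+\<theta>. k1 \<theta> * indicator {0..<2} \<theta> \<partial>lborel))
     + (\<integral>\<^sup>+\<theta>. k0 \<theta> * indicator {0..<s} \<theta> \<partial>lborel)"
    using nn_integral_translate_real[of "\<lambda>\<theta>. k0 \<theta> * indicator {s..<2} \<theta>" s]
      nn_integral_translate_real[of "\<lambda>\<theta>. k1 \<theta> * indicator {0..<2} \<theta>" "s - 2"]
      nn_integral_translate_real[of "\<lambda>\<theta>. k0 \<theta> * indicator {0..<s} \<theta>" "s - 4"] by simp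
  also have "\<dots> = (\<integral>\<^sup>+\<theta>. (k0 \<theta> * indicator {s..<2} \<theta> + k1 \<theta> * indicator {0..<2} \<theta>) + k0 \<theta> * indicator {0..<s} \<theta> \<partial>lborel)"
    by (simp add: nn_integral_add)
  also have "\<dots> = (\<integral>\<^sup>+\<theta>. (k0 \<theta> + k1 \<theta>) * indicator {0..<2} \<theta> \<partial>lborel)"
    using s by (intro nn_integral_cong) (simp add: indicator_def)
  finally show ?thesis by (simp add: k0_def k1_def)
qed

text \<open>Substitution on \<open>[1/(k+1), k+1]\<close>, followed by monotone convergence.\<close>

lemma nn_integral_powr_substitution:
  fixes f :: "real \<Rightarrow> ennreal"
  assumes [measurable]: "f \<in> borel_measurable borel" and a: "0 < a"
  shows "(\<integral>\<^sup>+y. f y * indicator {0<..} y \<partial>lborel)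
       = (\<integral>\<^sup>+t. f (t powr a) * ennreal (a * t powr (a - 1)) * indicator {0<..} t \<partial>lborel)"
proof -
  define l where "l k = 1 / (real k + 1)" for k :: nat
  define u where "u k = real k + 1" for k :: nat
  have lu: "0 < l k" "l k \<le> 1" "1 \<le> u k" for k by (auto simp: l_def u_def)
  have l_mono: "l m \<le> l k" if "k \<le> m" for k m using that by (auto simp: l_def field_simps)
  have u_mono: "u k \<le> u m" if "k \<le> m" for k m using that by (auto simp: u_def)
  have ex: "\<exists>k. l k \<le> y \<and> y \<le> u k" if "0 < y" for y
  proof -
    obtain k :: nat where k: "max y (1 / y) \<le> real k" using real_arch_simple by blast
    then have "1 / y \<le> real k + 1" by simp
    then have "l k \<le> y" using that by (simp add: l_def field_simps)
    then show ?thesis using k by (auto simp: u_def intro!: exI[of _ k])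
  qed
  have U1: "(\<Union>k. {l k..u k}) = {0<..}"
  proof (intro set_eqI iffI)
    fix y assume "y \<in> (\<Union>k. {l k..u k})"
    then obtain k where "l k \<le> y" by auto
    then show "y \<in> {0<..}" using lu(1)[of k] by simp
  next
    fix y :: real assume "y \<in> {0<..}"
    then show "y \<in> (\<Union>k. {l k..u k})" using ex[of y] by simp
  qed
  have U2: "(\<Union>k. {l k powr a..u k powr a}) = {0<..}"
  proof (intro set_eqI iffI)
    fix y :: real assume "y \<in> {0<..}"
    then have y: "0 < y" by simp
    obtain k where k: "l k \<le> y powr (1/a)" "y powr (1/a) \<le> u k" using ex[of "y powr (1/a)"] y by auto
    have "(y powr (1/a)) powr a = y" using y a by (simp add: powr_powr)
    then have "l k powr a \<le> y" "y \<le> u k powr a"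
      using powr_mono2[OF _ _ k(1), of a] powr_mono2[OF _ _ k(2), of a] lu[of k] a by auto
    then show "y \<in> (\<Union>k. {l k powr a..u k powr a})" by auto
  next
    fix y assume "y \<in> (\<Union>k. {l k powr a..u k powr a})"
    then obtain k where "l k powr a \<le> y" by auto
    then show "y \<in> {0<..}" using lu(1)[of k] by (auto intro: less_le_trans[of _ "l k powr a"])
  qed
  have "(\<integral>\<^sup>+y. f y * indicator {0<..} y \<partial>lborel) = emeasure (density lborel f) (\<Union>k. {l k powr a..u k powr a})"
    unfolding U2 by (simp add: emeasure_density)
  also have "\<dots> = (SUP k. emeasure (density lborel f) {l k powr a..u k powr a})"
  proof (rule SUP_emeasure_incseq[symmetric])
    show "incseq (\<lambda>k. {l k powr a..u k powr a})"
      unfolding incseq_def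
    proof (intro allI impI)
      fix m k :: nat assume mk: "m \<le> k"
      have "l k powr a \<le> l m powr a" "u m powr a \<le> u k powr a"
        using powr_mono2[of a "l k" "l m"] powr_mono2[of a "u m" "u k"] l_mono[OF mk] u_mono[OF mk] lu[of k] lu[of m] a by auto
      then show "{l m powr a..u m powr a} \<subseteq> {l k powr a..u k powr a}" by auto
    qed
  qed auto
  also have "\<dots> = (SUP k. emeasure (density lborel (\<lambda>t. f (t powr a) * ennreal (a * t powr (a - 1)))) {l k..u k})"
  proof (intro SUP_cong refl)
    fix k
    have luk: "l k < u k \<or> l k = u k" using lu[of k] by linarith
    have "(\<integral>\<^sup>+y. f y * indicator {l k powr a..u k powr a} y \<partial>lborel) =
      (\<integral>\<^sup>+t. f (t powr a) * ennreal (a * t powr (a - 1)) * indicator {l k..u k} t \<partial>lborel)"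
    proof (cases "l k = u k")
      case True
      have n: "(\<integral>\<^sup>+t. g t * indicator {x..x} t \<partial>lborel) = 0" for g and x :: real
      proof -
        have "AE t in lborel. t \<noteq> x" by (rule AE_lborel_singleton)
        then have "AE t in lborel. g t * indicator {x..x} t = (0::ennreal)" by eventually_elim auto
        then have "(\<integral>\<^sup>+t. g t * indicator {x..x} t \<partial>lborel) = (\<integral>\<^sup>+t. 0 \<partial>(lborel :: real measure))" by (rule nn_integral_cong_AE)
        then show ?thesis by simp
      qed
      show ?thesis unfolding True n ..
    next
      case False
      then show ?thesis using luk lu[of k] a
        by (intro nn_integral_substitution_aux)
           (auto intro!: derivative_eq_intros continuous_intros simp: mult.commute)
    qed
    then show "emeasure (density lborel f) {l k powr a..u k powr a} =
      emeasure (density lborel (\<lambda>t. f (t powr a) * ennreal (a * t powr (a - 1)))) {l k..u k}"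
      by (simp add: emeasure_density)
  qed
  also have "\<dots> = emeasure (density lborel (\<lambda>t. f (t powr a) * ennreal (a * t powr (a - 1)))) (\<Union>k. {l k..u k})"
  proof (rule SUP_emeasure_incseq)
    show "incseq (\<lambda>k. {l k..u k})"
      by (auto simp: incseq_def intro: order_trans[OF l_mono] order_trans[OF _ u_mono])
  qed auto
  also have "\<dots> = (\<integral>\<^sup>+t. f (t powr a) * ennreal (a * t powr (a - 1)) * indicator {0<..} t \<partial>lborel)"
    unfolding U1 by (simp add: emeasure_density)
  finally show ?thesis .
qed

text \<open>On the part of the plane swept by the top sides the Jacobian of
  \<open>(t, \<theta>) \<mapsto> (t\<^sup>1\<^sup>/\<^sup>p (q \<theta> - 1), t\<^sup>1\<^sup>/\<^sup>q)\<close> is \<open>q t\<^sup>1\<^sup>/\<^sup>p * (1/q) t\<^sup>1\<^sup>/\<^sup>q\<^sup>-\<^sup>1 = 1\<close>.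
  The other three sides reduce to this one by exchanging the coordinates and by \<open>z \<mapsto> - z\<close>.\<close>

lemma nn_integral_top_piece:
  fixes h :: "real \<Rightarrow> real \<Rightarrow> ennreal"
  assumes pq: "1 < p" "1 < q" "1/p + 1/q = 1" and h[measurable]: "case_prod h \<in> borel_measurable borel"
  shows "(\<integral>\<^sup>+t. (\<integral>\<^sup>+\<theta>. h (t powr (1/p) * (q * \<theta> - 1)) (t powr (1/q)) * indicator {0..2/q} \<theta> \<partial>lborel) * ennreal (exp (- t)) * indicator {0<..} t \<partial>lborel)
    = (\<integral>\<^sup>+y. (\<integral>\<^sup>+x. h x y * ennreal (exp (- (y powr q))) * indicator {x. \<bar>x\<bar> powr p < y powr q \<and> 0 < y} x \<partial>lborel) \<partial>lborel)"
proof -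
  let ?I = "\<lambda>t. \<integral>\<^sup>+\<theta>. h (t powr (1/p) * (q * \<theta> - 1)) (t powr (1/q)) * indicator {0..2/q} \<theta> \<partial>lborel"
  note [measurable (raw)] = borel_measurable_curried[OF h]
  define k where "k y = (\<integral>\<^sup>+x. h x y * indicator {x. \<bar>x\<bar> powr p < y powr q} x \<partial>lborel)" for y
  have [measurable]: "k \<in> borel_measurable borel" unfolding k_def by measurable
  have inner: "?I t
     = k (t powr (1/q)) * ennreal (1/q * t powr (1/q - 1))" if t: "0 < t" for t
  proof -
    define r where "r = t powr (1/p)"
    have r: "0 < r" using t by (simp add: r_def)
    have e: "1/q - 1 = - (1/p)" using pq by (simp add: algebra_simps)
    have c: "1/q * t powr (1/q - 1) = 1 / (q * r)" unfolding e r_def by (simp add: powr_minus field_simps)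
    have "(\<integral>\<^sup>+\<theta>. h (r * (q * \<theta> - 1)) (t powr (1/q)) * indicator {0..2/q} \<theta> \<partial>lborel) =
      ennreal \<bar>1 / (q * r)\<bar> * (\<integral>\<^sup>+x. h (r * (q * (1/q + 1 / (q * r) * x) - 1)) (t powr (1/q)) * indicator {0..2/q} (1/q + 1 / (q * r) * x) \<partial>lborel)"
      using r pq by (intro nn_integral_real_affine) auto
    also have "(\<integral>\<^sup>+x. h (r * (q * (1/q + 1 / (q * r) * x) - 1)) (t powr (1/q)) * indicator {0..2/q} (1/q + 1 / (q * r) * x) \<partial>lborel)
        = k (t powr (1/q))" unfolding k_def
    proof (rule nn_integral_cong_AE)
      have "AE x in lborel. x \<noteq> r" "AE x in lborel. x \<noteq> - r" by (rule AE_lborel_singleton)+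
      then show "AE x in lborel. h (r * (q * (1/q + 1 / (q * r) * x) - 1)) (t powr (1/q)) * indicator {0..2/q} (1/q + 1 / (q * r) * x)
          = h x (t powr (1/q)) * indicator {x. \<bar>x\<bar> powr p < (t powr (1/q)) powr q} x"
      proof eventually_elim
        case x: (elim x)
        have 1: "r * (q * (1/q + 1 / (q * r) * x) - 1) = x" using r pq by (simp add: field_simps)
        have tq: "(t powr (1/q)) powr q = t" "r powr p = t" using t pq by (simp_all add: powr_powr r_def)
        have "1/q + 1 / (q * r) * x \<in> {0..2/q} \<longleftrightarrow> - r \<le> x \<and> x \<le> r"
          using r pq by (auto simp: field_simps)
        also have "\<dots> \<longleftrightarrow> \<bar>x\<bar> < r" using x by auto
        also have "\<dots> \<longleftrightarrow> \<bar>x\<bar> powr p < r powr p"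
          using r pq by (metis abs_ge_zero less_imp_le not_less powr_less_mono2 powr_mono2 zero_less_one less_trans order.strict_trans)
        finally show ?case
          unfolding 1 tq by (simp add: indicator_def)
      qed
    qed
    finally show ?thesis unfolding c r_def[symmetric] using r pq by (simp only: abs_of_pos mult.commute zero_less_divide_1_iff mult_pos_pos zero_less_one less_trans[of 0 1 q])
  qed
  have "(\<integral>\<^sup>+t. ?I t * ennreal (exp (- t)) * indicator {0<..} t \<partial>lborel)
    = (\<integral>\<^sup>+t. (k (t powr (1/q)) * ennreal (exp (- ((t powr (1/q)) powr q)))) * ennreal (1/q * t powr (1/q - 1)) * indicator {0<..} t \<partial>lborel)"
  proof (intro nn_integral_cong)
    fix t :: real
    have e: "(t powr (1/q)) powr q = t" if "0 < t" using that pq by (simp add: powr_powr)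
    show "?I t * ennreal (exp (- t)) * indicator {0<..} t
      = (k (t powr (1/q)) * ennreal (exp (- ((t powr (1/q)) powr q)))) * ennreal (1/q * t powr (1/q - 1)) * indicator {0<..} t"
    proof (cases "0 < t")
      case True
      show ?thesis unfolding inner[OF True] e[OF True] by (simp only: mult_ac)
    qed simp
  qed
  also have "\<dots> = (\<integral>\<^sup>+y. (k y * ennreal (exp (- (y powr q)))) * indicator {0<..} y \<partial>lborel)"
    using pq by (intro nn_integral_powr_substitution[symmetric]) auto
  also have "\<dots> = (\<integral>\<^sup>+y. (\<integral>\<^sup>+x. (h x y * indicator {x. \<bar>x\<bar> powr p < y powr q} x) * (ennreal (exp (- (y powr q))) * indicator {0<..} y) \<partial>lborel) \<partial>lborel)"
    unfolding k_def by (subst nn_integral_multc) (auto simp: mult.assoc)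
  also have "\<dots> = (\<integral>\<^sup>+y. (\<integral>\<^sup>+x. h x y * ennreal (exp (- (y powr q))) * indicator {x. \<bar>x\<bar> powr p < y powr q \<and> 0 < y} x \<partial>lborel) \<partial>lborel)"
    by (intro nn_integral_cong) (auto simp: indicator_def)
  finally show ?thesis .
qed

lemma nn_integral_reflect_real:
  fixes f :: "real \<Rightarrow> ennreal"
  assumes "f \<in> borel_measurable borel"
  shows "(\<integral>\<^sup>+x. f (- x) \<partial>lborel) = (\<integral>\<^sup>+x. f x \<partial>lborel)"
  using nn_integral_real_affine[OF assms, of "-1" 0] by simp

lemma nn_integral_half_orbit:
  fixes h :: "real \<Rightarrow> real \<Rightarrow> ennreal"
  assumes pq: "1 < p" "1 < q" "1/p + 1/q = 1" and h[measurable]: "case_prod h \<in> borel_measurable borel"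
  shows "(\<integral>\<^sup>+\<theta>. h (a * halfwave_x q \<theta>) (b * halfwave_y p \<theta>) * indicator {0..<2} \<theta> \<partial>lborel)
     = (\<integral>\<^sup>+\<theta>. h (a * (q * \<theta> - 1)) b * indicator {0..2/q} \<theta> \<partial>lborel)
      + (\<integral>\<^sup>+\<theta>. h a (b * (p * \<theta> - 1)) * indicator {0..2/p} \<theta> \<partial>lborel)"
proof -
  note [measurable (raw)] = borel_measurable_curried[OF h]
  have pq2: "2/p + 2/q = 2" "2 / p = 2 - 2 / q" using pq(3) by (simp_all add: field_simps)
  define f where "f \<theta> = h a (b * (p * \<theta> - 1)) * indicator {0..2/p} \<theta>" for \<theta>
  have [measurable]: "f \<in> borel_measurable borel" unfolding f_def by measurable
  have "(\<integral>\<^sup>+\<theta>. f \<theta> \<partial>lborel) = (\<integral>\<^sup>+\<theta>. f (- \<theta>) \<partial>lborel)" by (subst nn_integral_reflect_real) auto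
  also have "\<dots> = (\<integral>\<^sup>+\<theta>. f (- (\<theta> + (-2))) \<partial>lborel)" by (rule nn_integral_translate_real[symmetric]) measurable
  finally have f: "(\<integral>\<^sup>+\<theta>. f \<theta> \<partial>lborel) = (\<integral>\<^sup>+\<theta>. f (2 - \<theta>) \<partial>lborel)" by simp
  have "(\<integral>\<^sup>+\<theta>. h (a * halfwave_x q \<theta>) (b * halfwave_y p \<theta>) * indicator {0..<2} \<theta> \<partial>lborel)
     = (\<integral>\<^sup>+\<theta>. h (a * (q * \<theta> - 1)) b * indicator {0..2/q} \<theta> + f (2 - \<theta>) \<partial>lborel)"
  proof (rule nn_integral_cong_AE)
    have "AE \<theta> in lborel. \<theta> \<noteq> 2/q" "AE \<theta> in lborel. \<theta> \<noteq> 2" by (rule AE_lborel_singleton)+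
    then show "AE \<theta> in lborel. h (a * halfwave_x q \<theta>) (b * halfwave_y p \<theta>) * indicator {0..<2} \<theta>
        = h (a * (q * \<theta> - 1)) b * indicator {0..2/q} \<theta> + f (2 - \<theta>)"
    proof eventually_elim
      case ne: (elim \<theta>)
      have lt: "2 / q < 2" "0 < 2 / q" using pq by (simp_all add: field_simps)
      consider "\<theta> < 0" | "0 \<le> \<theta>" "\<theta> < 2/q" | "2/q < \<theta>" "\<theta> < 2" | "2 < \<theta>" using ne by linarith
      then show ?case
      proof cases
        case 1
        then have "2 / p < 2 - \<theta>" using lt pq2 by linarith
        then show ?thesis using 1 lt by (simp add: f_def)
      next
        case 2
        have "2 / p < 2 - \<theta>" using 2 pq2 by linarith
        then have "2 < p * (2 - \<theta>)" using pq by (simp add: field_simps)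
        moreover have "q * \<theta> < 2" using 2 pq by (simp add: field_simps)
        ultimately show ?thesis using 2 lt \<open>2 / p < 2 - \<theta>\<close>
          by (simp add: halfwave_x_def halfwave_y_def f_def indicator_def)
      next
        case 3
        have "2 - \<theta> < 2 / p" using 3 pq2 by linarith
        then have "p * (2 - \<theta>) < 2" using pq by (simp add: field_simps)
        moreover have "2 < q * \<theta>" using 3 pq by (simp add: field_simps)
        ultimately have w: "halfwave_x q \<theta> = 1" "halfwave_y p \<theta> = p * (2 - \<theta>) - 1"
          by (simp_all add: halfwave_x_def halfwave_y_def)
        have "0 \<le> \<theta>" using 3 lt by linarith
        then show ?thesis unfolding w using 3 \<open>2 - \<theta> < 2 / p\<close>
          by (simp add: f_def)
      qed (use lt pq2 in \<open>simp_all add: f_def indicator_def\<close>)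
    qed
  qed
  also have "\<dots> = (\<integral>\<^sup>+\<theta>. h (a * (q * \<theta> - 1)) b * indicator {0..2/q} \<theta> \<partial>lborel) + (\<integral>\<^sup>+\<theta>. f \<theta> \<partial>lborel)"
    unfolding f by (intro nn_integral_add) measurable
  finally show ?thesis by (simp add: f_def)
qed

text \<open>The four sides sweep out the four sectors in which the plane is
  divided by the curves \<open>\<bar>x\<bar>\<^sup>p = \<bar>y\<bar>\<^sup>q\<close>, up to these curves themselves, which are null sets.\<close>

lemma nn_integral_orbits:
  fixes h :: "real \<Rightarrow> real \<Rightarrow> ennreal"
  assumes pq: "1 < p" "1 < q" "1/p + 1/q = 1" and h[measurable]: "case_prod h \<in> borel_measurable borel"
    and s: "0 \<le> s" "s \<le> 2"
  shows "(\<integral>\<^sup>+t. (\<integral>\<^sup>+\<theta>. h (orbit_x p q t (\<theta> + s)) (orbit_y p q t (\<theta> + s))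
            * indicator {0..<4} \<theta> \<partial>lborel) * ennreal (exp (- t)) * indicator {0<..} t \<partial>lborel)
      = (\<integral>\<^sup>+y. (\<integral>\<^sup>+x. h x y * ennreal (exp (- max (\<bar>x\<bar> powr p) (\<bar>y\<bar> powr q))) \<partial>lborel) \<partial>lborel)"
    (is "?L = ?R")
proof -
  note [measurable (raw)] = borel_measurable_curried[OF h]
  define k where "k x y = h x y + h (- x) (- y)" for x y
  let ?I = "\<lambda>t. \<integral>\<^sup>+\<theta>. k (t powr (1/p) * (q * \<theta> - 1)) (t powr (1/q)) * indicator {0..2/q} \<theta> \<partial>lborel"
  let ?J = "\<lambda>t. \<integral>\<^sup>+\<theta>. k (t powr (1/p)) (t powr (1/q) * (p * \<theta> - 1)) * indicator {0..2/p} \<theta> \<partial>lborel"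
  have k[measurable]: "case_prod k \<in> borel_measurable borel"
    unfolding k_def[abs_def] borel_prod[symmetric] by measurable
  note [measurable (raw)] = borel_measurable_curried[OF k]
  have ks[measurable]: "case_prod (\<lambda>x y. k y x) \<in> borel_measurable borel"
    unfolding borel_prod[symmetric] by measurable
  define A where "A x y = h x y * ennreal (exp (- max (\<bar>x\<bar> powr p) (\<bar>y\<bar> powr q)))" for x y
  have A[measurable (raw)]: "(\<lambda>x. A (a x) (b x)) \<in> borel_measurable M"
    if [measurable]: "a \<in> borel_measurable M" "b \<in> borel_measurable M" for a b and M :: "'x measure"
    unfolding A_def by measurable
  \<comment> \<open>\<open>X\<close> and \<open>Y\<close> select the right and the upper sector, their reflections the left and the lower one.\<close>
  define X where "X = (\<lambda>y x. indicator {x. \<bar>y\<bar> powr q < \<bar>x\<bar> powr p \<and> 0 < x} x :: ennreal)"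
  define Y where "Y = (\<lambda>y x. indicator {x. \<bar>x\<bar> powr p < \<bar>y\<bar> powr q \<and> 0 < y} x :: ennreal)"
  have X[measurable (raw)]: "(\<lambda>x. X (a x) (b x)) \<in> borel_measurable M"
    if [measurable]: "a \<in> borel_measurable M" "b \<in> borel_measurable M" for a b and M :: "'x measure"
    unfolding X_def indicator_def mem_Collect_eq by measurable
  have Y[measurable (raw)]: "(\<lambda>x. Y (a x) (b x)) \<in> borel_measurable M"
    if [measurable]: "a \<in> borel_measurable M" "b \<in> borel_measurable M" for a b and M :: "'x measure"
    unfolding Y_def indicator_def mem_Collect_eq by measurable
  have inner: "(\<integral>\<^sup>+\<theta>. h (orbit_x p q t (\<theta> + s)) (orbit_y p q t (\<theta> + s))
            * indicator {0..<4} \<theta> \<partial>lborel)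
     = ?I t
      + ?J t" for t
  proof -
    let ?a = "t powr (1/p)" and ?b = "t powr (1/q)"
    have m: "case_prod (\<lambda>x y. h (?a * x) (?b * y)) \<in> borel_measurable borel"
      unfolding borel_prod[symmetric] by measurable
    show ?thesis
      using nn_integral_half_turns[OF halfwave_measurable(1) halfwave_measurable(2) m s, of q p]
        nn_integral_half_orbit[OF pq k, of ?a ?b]
      by (simp add: k_def)
  qed
  have "?L = (\<integral>\<^sup>+t. ?I t * ennreal (exp (- t)) * indicator {0<..} t
      + ?J t * ennreal (exp (- t)) * indicator {0<..} t \<partial>lborel)"
    unfolding inner by (simp only: distrib_right)
  also have "\<dots> = (\<integral>\<^sup>+t. ?I t * ennreal (exp (- t)) * indicator {0<..} t \<partial>lborel)
      + (\<integral>\<^sup>+t. ?J t * ennreal (exp (- t)) * indicator {0<..} t \<partial>lborel)"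
    by (intro nn_integral_add) measurable
  also have "(\<integral>\<^sup>+t. ?I t * ennreal (exp (- t)) * indicator {0<..} t \<partial>lborel)
     = (\<integral>\<^sup>+y. (\<integral>\<^sup>+x. k x y * ennreal (exp (- (y powr q))) * indicator {x. \<bar>x\<bar> powr p < y powr q \<and> 0 < y} x \<partial>lborel) \<partial>lborel)"
    by (rule nn_integral_top_piece[OF pq k])
  also have "\<dots> = (\<integral>\<^sup>+y. (\<integral>\<^sup>+x. A x y * Y y x + A (-x) (-y) * Y y x \<partial>lborel) \<partial>lborel)"
    by (intro nn_integral_cong) (auto simp: k_def A_def Y_def indicator_def distrib_right max_def)
  also have "\<dots> = (\<integral>\<^sup>+y. (\<integral>\<^sup>+x. A x y * Y y x \<partial>lborel) \<partial>lborel) + (\<integral>\<^sup>+y. (\<integral>\<^sup>+x. A (-x) (-y) * Y y x \<partial>lborel) \<partial>lborel)"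
    by (simp add: nn_integral_add)
  also have "(\<integral>\<^sup>+y. (\<integral>\<^sup>+x. A (-x) (-y) * Y y x \<partial>lborel) \<partial>lborel) = (\<integral>\<^sup>+y. (\<integral>\<^sup>+x. A (-(-x)) (-y) * Y y (-x) \<partial>lborel) \<partial>lborel)"
    by (intro nn_integral_cong nn_integral_reflect_real[symmetric]) measurable
  also have "\<dots> = (\<integral>\<^sup>+y. (\<integral>\<^sup>+x. A (-(-x)) (-(-y)) * Y (-y) (-x) \<partial>lborel) \<partial>lborel)"
    by (intro nn_integral_reflect_real[symmetric]) measurable
  also have "(\<integral>\<^sup>+t. ?J t * ennreal (exp (- t)) * indicator {0<..} t \<partial>lborel)
     = (\<integral>\<^sup>+x. (\<integral>\<^sup>+y. k x y * ennreal (exp (- (x powr p))) * indicator {y. \<bar>y\<bar> powr q < x powr p \<and> 0 < x} y \<partial>lborel) \<partial>lborel)"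
    using nn_integral_top_piece[OF pq(2,1) _ ks] pq(3) by (simp add: add.commute)
  also have "\<dots> = (\<integral>\<^sup>+x. (\<integral>\<^sup>+y. A x y * X y x + A (-x) (-y) * X y x \<partial>lborel) \<partial>lborel)"
    by (intro nn_integral_cong) (auto simp: k_def A_def X_def indicator_def distrib_right max_def)
  also have "\<dots> = (\<integral>\<^sup>+y. (\<integral>\<^sup>+x. A x y * X y x + A (-x) (-y) * X y x \<partial>lborel) \<partial>lborel)"
    by (rule lborel_pair.Fubini') measurable
  also have "\<dots> = (\<integral>\<^sup>+y. (\<integral>\<^sup>+x. A x y * X y x \<partial>lborel) \<partial>lborel) + (\<integral>\<^sup>+y. (\<integral>\<^sup>+x. A (-x) (-y) * X y x \<partial>lborel) \<partial>lborel)"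
    by (simp add: nn_integral_add)
  also have "(\<integral>\<^sup>+y. (\<integral>\<^sup>+x. A (-x) (-y) * X y x \<partial>lborel) \<partial>lborel) = (\<integral>\<^sup>+y. (\<integral>\<^sup>+x. A (-(-x)) (-y) * X y (-x) \<partial>lborel) \<partial>lborel)"
    by (intro nn_integral_cong nn_integral_reflect_real[symmetric]) measurable
  also have "\<dots> = (\<integral>\<^sup>+y. (\<integral>\<^sup>+x. A (-(-x)) (-(-y)) * X (-y) (-x) \<partial>lborel) \<partial>lborel)"
    by (intro nn_integral_reflect_real[symmetric]) measurable
  finally have "?L = (\<integral>\<^sup>+y. (\<integral>\<^sup>+x. A x y * Y y x + A x y * Y (-y) (-x) + (A x y * X y x + A x y * X (-y) (-x)) \<partial>lborel) \<partial>lborel)"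
    by (simp add: nn_integral_add)
  also have "\<dots> = (\<integral>\<^sup>+y. (\<integral>\<^sup>+x. A x y \<partial>lborel) \<partial>lborel)"
  proof (rule nn_integral_cong, rule nn_integral_cong_AE)
    fix y :: real
    define r where "r = (\<bar>y\<bar> powr q) powr (1/p)"
    have "AE x in lborel. x \<noteq> r" "AE x in lborel. x \<noteq> - r" by (rule AE_lborel_singleton)+
    then show "AE x in lborel. A x y * Y y x + A x y * Y (-y) (-x) + (A x y * X y x + A x y * X (-y) (-x)) = A x y"
    proof eventually_elim
      case (elim x)
      then have "\<bar>x\<bar> \<noteq> r" by (auto simp: abs_if split: if_splits)
      moreover have "(\<bar>x\<bar> powr p) powr (1/p) = \<bar>x\<bar>" using pq by (simp add: powr_powr)
      ultimately have ne: "\<bar>x\<bar> powr p \<noteq> \<bar>y\<bar> powr q" by (auto simp: r_def)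
      consider "\<bar>x\<bar> powr p < \<bar>y\<bar> powr q" "0 < y" | "\<bar>x\<bar> powr p < \<bar>y\<bar> powr q" "y < 0"
        | "\<bar>y\<bar> powr q < \<bar>x\<bar> powr p" "0 < x" | "\<bar>y\<bar> powr q < \<bar>x\<bar> powr p" "x < 0"
        using ne powr_ge_zero[of "\<bar>x\<bar>" p] powr_ge_zero[of "\<bar>y\<bar>" q]
        by (metis abs_zero less_le_not_le linorder_neqE_linordered_idom powr_eq_0_iff)
      then show ?case
        by cases (simp_all add: X_def Y_def)
    qed
  qed
  finally show ?thesis by (simp add: A_def)
qed

definition planar_gibbs :: "real \<Rightarrow> real \<Rightarrow> real \<times> real \<Rightarrow> ennreal" where
  "planar_gibbs p q = (\<lambda>(x, y). ennreal (exp (- max (\<bar>x\<bar> powr p) (\<bar>y\<bar> powr q))))"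

lemma planar_gibbs_measurable[measurable]: "planar_gibbs p q \<in> borel_measurable borel"
  unfolding planar_gibbs_def borel_prod[symmetric] by measurable

definition action_angle_density :: "real \<times> real \<Rightarrow> ennreal" where
  "action_angle_density = (\<lambda>(t, \<theta>). ennreal (exp (- t)) * indicator {0<..} t * indicator {0..<4} \<theta>)"

lemma action_angle_density_measurable[measurable]: "action_angle_density \<in> borel_measurable borel"
  unfolding action_angle_density_def borel_prod[symmetric] by measurable

definition action_angle_measure :: "(real \<times> real) measure" where
  "action_angle_measure = density lborel action_angle_density"

lemma sets_action_angle_measure[simp, measurable_cong]: "sets action_angle_measure = sets borel"
  by (simp add: action_angle_measure_def)

lemma orbit_point_measurable[measurable]: "orbit_point p q s \<in> borel_measurable borel"
  unfolding orbit_point_def borel_prod[symmetric] by measurable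

lemma distr_orbit_point:
  assumes pq: "1 < p" "1 < q" "1/p + 1/q = 1" and s: "0 \<le> s" "s \<le> 2"
  shows "distr action_angle_measure borel (orbit_point p q s)
     = density lborel (planar_gibbs p q)"
proof (rule measure_eqI)
  fix S assume "S \<in> sets (distr action_angle_measure borel (orbit_point p q s))"
  then have S[measurable]: "S \<in> sets borel" by simp
  define h where "h x y = (indicator S (x, y) :: ennreal)" for x y
  have h: "case_prod h \<in> borel_measurable borel" unfolding h_def by simp
  note [measurable (raw)] = borel_measurable_curried[OF h]
  have P: "lborel = (lborel \<Otimes>\<^sub>M lborel :: (real \<times> real) measure)" by (simp add: lborel_prod)
  have "emeasure (distr action_angle_measure borel (orbit_point p q s)) S
     = (\<integral>\<^sup>+z. indicator S (orbit_point p q s z) \<partial>action_angle_measure)"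
    by (subst nn_integral_indicator[symmetric], simp, subst nn_integral_distr) auto
  also have "\<dots> = (\<integral>\<^sup>+z. action_angle_density z * indicator S (orbit_point p q s z) \<partial>lborel)"
    unfolding action_angle_measure_def
    by (rule nn_integral_density) (simp, measurable)
  also have "\<dots> = (\<integral>\<^sup>+t. (\<integral>\<^sup>+\<theta>. (h (orbit_x p q t (\<theta> + s)) (orbit_y p q t (\<theta> + s))
            * indicator {0..<4} \<theta>) * (ennreal (exp (- t)) * indicator {0<..} t) \<partial>lborel) \<partial>lborel)"
    unfolding P orbit_point_def action_angle_density_def
    by (subst lborel.nn_integral_fst[symmetric]) (auto simp: h_def mult_ac borel_prod[symmetric])
  also have "\<dots> = (\<integral>\<^sup>+t. (\<integral>\<^sup>+\<theta>. h (orbit_x p q t (\<theta> + s)) (orbit_y p q t (\<theta> + s))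
            * indicator {0..<4} \<theta> \<partial>lborel) * ennreal (exp (- t)) * indicator {0<..} t \<partial>lborel)"
    by (subst nn_integral_multc) (auto simp: mult.assoc)
  also have "\<dots> = (\<integral>\<^sup>+y. (\<integral>\<^sup>+x. h x y * ennreal (exp (- max (\<bar>x\<bar> powr p) (\<bar>y\<bar> powr q))) \<partial>lborel) \<partial>lborel)"
    by (rule nn_integral_orbits[OF pq h s])
  also have "\<dots> = (\<integral>\<^sup>+z. (case z of (x, y) \<Rightarrow> h x y * ennreal (exp (- max (\<bar>x\<bar> powr p) (\<bar>y\<bar> powr q)))) \<partial>lborel)"
    unfolding P by (subst lborel_pair.nn_integral_snd[symmetric]) auto
  also have "\<dots> = emeasure (density lborel (planar_gibbs p q)) S"
    using planar_gibbs_measurable[of p q]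
    by (subst emeasure_density) (auto simp: h_def planar_gibbs_def mult.commute intro!: nn_integral_cong)
  finally show "emeasure (distr action_angle_measure borel (orbit_point p q s)) S
     = emeasure (density lborel (planar_gibbs p q)) S" .
qed simp

section \<open>Products of planar measures\<close>

lemma box_prod_eq: "box l u = box (fst l) (fst u) \<times> box (snd l) (snd u)"
  by (cases l; cases u) (auto simp: mem_box Basis_prod_def ball_Un)

lemma emeasure_lborel_box_prod:
  fixes l u :: "'a::euclidean_space \<times> 'b::euclidean_space"
  shows "emeasure lborel (box l u) = emeasure lborel (box (fst l) (fst u)) * emeasure lborel (box (snd l) (snd u))"
  unfolding box_prod_eq[of l u]
  by (simp add: lborel_prod[symmetric] lborel.emeasure_pair_measure_Times)

lemma emeasure_lborel_box_real:
  "emeasure lborel (box l (u::real)) = ennreal (u - l)"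
  by (cases "l \<le> u") (simp_all add: box_real ennreal_neg)

lemma emeasure_lborel_box_vec:
  fixes l u :: "real ^ 'n"
  shows "emeasure lborel (box l u) = (\<Prod>i\<in>UNIV. emeasure lborel (box (l $ i) (u $ i)))"
proof (cases "\<forall>i. l $ i \<le> u $ i")
  case True
  have le: "l \<bullet> b \<le> u \<bullet> b" if "b \<in> Basis" for b
    using that True by (auto simp: Basis_vec_def inner_axis)
  have B: "(Basis :: (real ^ 'n) set) = (\<lambda>i. axis i 1) ` UNIV"
    by (auto simp: Basis_vec_def)
  have inj: "inj (\<lambda>i. axis i (1::real) :: real ^ 'n)" by (auto intro!: injI simp: axis_eq_axis)
  have "emeasure lborel (box l u) = ennreal (\<Prod>b\<in>Basis. (u - l) \<bullet> b)"
    using le by (rule emeasure_lborel_box)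
  also have "(\<Prod>b\<in>Basis. (u - l) \<bullet> b) = (\<Prod>i\<in>UNIV. u $ i - l $ i)"
    unfolding B by (subst prod.reindex[OF inj]) (simp add: inner_axis)
  also have "ennreal \<dots> = (\<Prod>i\<in>UNIV. ennreal (u $ i - l $ i))"
    using True by (subst prod_ennreal) simp_all
  finally show ?thesis by (simp only: emeasure_lborel_box_real)
next
  case False
  then obtain i where i: "u $ i < l $ i" by (auto simp: not_le)
  then have "box l u = {}" using interval_eq_empty_cart(1)[of l u] by (auto intro: less_imp_le)
  moreover have "(\<Prod>i\<in>UNIV. emeasure lborel (box (l $ i) (u $ i))) = 0"
    using i by (intro prod_zero bexI[of _ i]) (auto simp: emeasure_lborel_box_real ennreal_neg)
  ultimately show ?thesis by simp
qed

definition pair_of_vecs :: "('n::finite \<Rightarrow> real \<times> real) \<Rightarrow> (real ^ 'n) \<times> (real ^ 'n)" where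
  "pair_of_vecs \<omega> = (\<chi> i. fst (\<omega> i), \<chi> i. snd (\<omega> i))"

lemma borel_measurable_vec_lambda:
  fixes f :: "'a \<Rightarrow> 'n::finite \<Rightarrow> real"
  assumes "\<And>i. (\<lambda>x. f x i) \<in> borel_measurable M"
  shows "(\<lambda>x. (\<chi> i. f x i) :: real ^ 'n) \<in> borel_measurable M"
proof (subst borel_measurable_euclidean_space, intro ballI)
  fix b :: "real ^ 'n" assume "b \<in> Basis"
  then obtain i where "b = axis i 1" by (auto simp: Basis_vec_def)
  then show "(\<lambda>x. (\<chi> i. f x i) \<bullet> b) \<in> borel_measurable M"
    using assms[of i] by (simp add: inner_axis)
qed

lemma borel_measurable_vec_nth[measurable (raw)]:
  fixes f :: "'a \<Rightarrow> real ^ 'n"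
  assumes [measurable]: "f \<in> borel_measurable M"
  shows "(\<lambda>x. f x $ i) \<in> borel_measurable M"
proof -
  have "(\<lambda>x. f x \<bullet> axis i 1) \<in> borel_measurable M" by measurable
  then show ?thesis by (simp add: inner_axis)
qed

lemma pair_of_vecs_measurable[measurable]:
  assumes "\<And>i. sets (M i) = sets borel"
  shows "pair_of_vecs \<in> borel_measurable (\<Pi>\<^sub>M i\<in>UNIV. M i)"
proof -
  have c: "(\<lambda>\<omega>. \<omega> i) \<in> borel_measurable (\<Pi>\<^sub>M i\<in>UNIV. M i)" for i
    using measurable_component_singleton[of i UNIV M] measurable_cong_sets[OF refl assms[of i], of "\<Pi>\<^sub>M i\<in>UNIV. M i"] by simp
  have "(\<lambda>\<omega>. fst (\<omega> i)) \<in> borel_measurable (\<Pi>\<^sub>M i\<in>UNIV. M i)"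
    "(\<lambda>\<omega>. snd (\<omega> i)) \<in> borel_measurable (\<Pi>\<^sub>M i\<in>UNIV. M i)" for i
    using measurable_compose[OF c[of i], of fst borel] measurable_compose[OF c[of i], of snd borel]
    by (simp_all add: borel_prod[symmetric])
  then show ?thesis unfolding pair_of_vecs_def borel_prod[symmetric]
    by (intro measurable_Pair borel_measurable_vec_lambda)
qed

text \<open>Regrouping the coordinates of \<open>N\<close> points in the plane into two vectors preserves Lebesgue measure.\<close>

lemma distr_pair_of_vecs_lborel:
  "distr (\<Pi>\<^sub>M i\<in>(UNIV :: 'n::finite set). lborel) borel pair_of_vecs = lborel"
proof (rule lborel_eqI[symmetric])
  let ?L = "\<Pi>\<^sub>M i\<in>(UNIV :: 'n set). lborel :: (real \<times> real) measure"
  interpret product_sigma_finite "\<lambda>i::'n. lborel :: (real \<times> real) measure" ..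
  fix l u :: "(real ^ 'n) \<times> (real ^ 'n)"
  assume le: "\<And>b. b \<in> Basis \<Longrightarrow> l \<bullet> b \<le> u \<bullet> b"
  let ?b = "\<lambda>i. box (fst l $ i, snd l $ i) (fst u $ i, snd u $ i)"
  have bx: "box l u = box (fst l) (fst u) \<times> box (snd l) (snd u)"
    by (rule box_prod_eq)
  have "pair_of_vecs -` box l u \<inter> space ?L = Pi\<^sub>E UNIV ?b"
    by (auto simp: space_PiM pair_of_vecs_def bx mem_box_cart box_prod_eq[of "(_, _)"] mem_Times_iff PiE_UNIV_domain Pi_iff)
  then have "emeasure (distr ?L borel pair_of_vecs) (box l u)
    = emeasure ?L (Pi\<^sub>E UNIV ?b)"
    by (subst emeasure_distr) (auto intro!: pair_of_vecs_measurable)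
  also have "\<dots> = (\<Prod>i\<in>UNIV. emeasure lborel (?b i))"
    by (subst emeasure_PiM) auto
  also have "\<dots> = emeasure lborel (box l u)"
    by (simp add: emeasure_lborel_box_prod emeasure_lborel_box_vec prod.distrib)
  also have "\<dots> = (\<Prod>b\<in>Basis. (u - l) \<bullet> b)" using le by (rule emeasure_lborel_box)
  finally show "emeasure (distr ?L borel pair_of_vecs) (box l u) = (\<Prod>b\<in>Basis. (u - l) \<bullet> b)" .
qed simp

lemma distr_PiM_componentwise:
  fixes Q :: "(real \<times> real) measure" and w :: "real \<times> real \<Rightarrow> ennreal"
  assumes Q: "sigma_finite_measure Q" and [measurable_cong]: "sets Q = sets borel"
    and [measurable]: "f \<in> borel_measurable borel" "w \<in> borel_measurable borel"
    and fin: "\<And>z. w z \<noteq> \<infinity>"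
    and d: "distr Q borel f = density lborel w"
  shows "distr (\<Pi>\<^sub>M i\<in>(UNIV :: 'n::finite set). Q) borel (\<lambda>\<omega>. pair_of_vecs (\<lambda>i. f (\<omega> i)))
     = density lborel (\<lambda>z. \<Prod>i\<in>UNIV. w (fst z $ i, snd z $ i))"
proof -
  let ?Q = "\<Pi>\<^sub>M i\<in>(UNIV :: 'n set). Q"
  let ?L = "\<Pi>\<^sub>M i\<in>(UNIV :: 'n set). lborel :: (real \<times> real) measure"
  let ?W = "\<lambda>\<omega> :: 'n \<Rightarrow> real \<times> real. \<Prod>i\<in>UNIV. w (\<omega> i)"
  let ?V = "\<lambda>z :: (real ^ 'n) \<times> (real ^ 'n). \<Prod>i\<in>UNIV. w (fst z $ i, snd z $ i)"
  let ?F = "\<lambda>(\<omega> :: 'n \<Rightarrow> real \<times> real) i. f (\<omega> i)"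
  define N where "N = density lborel w"
  let ?N = "\<Pi>\<^sub>M i\<in>(UNIV :: 'n set). N"
  have sN[measurable_cong, simp]: "sets N = sets borel" by (simp add: N_def)
  have "sigma_finite_measure N"
    unfolding N_def using fin
    by (subst sigma_finite_measure.sigma_finite_iff_density_finite[OF sigma_finite_lborel]) auto
  then interpret N: product_sigma_finite "\<lambda>i::'n. N" by (simp add: product_sigma_finite_def)
  interpret Q: product_sigma_finite "\<lambda>i::'n. Q" using Q by (simp add: product_sigma_finite_def)
  interpret L: product_sigma_finite "\<lambda>i::'n. lborel :: (real \<times> real) measure" ..
  have spQ: "space Q = UNIV" using sets_eq_imp_space_eq[OF assms(2)] by simp
  have fm[measurable]: "?F \<in> ?Q \<rightarrow>\<^sub>M ?N"
    by (rule measurable_PiM_single') (auto simp: space_PiM N_def, measurable)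
  have pm[measurable]: "pair_of_vecs \<in> borel_measurable ?N"
    "pair_of_vecs \<in> borel_measurable (\<Pi>\<^sub>M i\<in>(UNIV :: 'n set). (lborel :: (real \<times> real) measure))"
    by (rule pair_of_vecs_measurable, simp)+
  have 1: "distr ?Q ?N ?F = ?N"
  proof (rule N.PiM_eqI)
    fix A :: "'n \<Rightarrow> (real \<times> real) set" assume A: "\<And>i. i \<in> UNIV \<Longrightarrow> A i \<in> sets N"
    then have A': "A i \<in> sets borel" for i by simp
    have fA: "f -` A i \<in> sets borel" for i using measurable_sets[of f borel borel "A i"] A' by simp
    have "?F -` Pi\<^sub>E UNIV A \<inter> space ?Q = Pi\<^sub>E UNIV (\<lambda>i. f -` A i)"
      by (auto simp: space_PiM spQ)
    then have "emeasure (distr ?Q ?N ?F) (Pi\<^sub>E UNIV A)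
      = emeasure ?Q (Pi\<^sub>E UNIV (\<lambda>i. f -` A i))"
      using A by (subst emeasure_distr) (auto intro!: sets_PiM_I_finite)
    also have "\<dots> = (\<Prod>i\<in>UNIV. emeasure Q (f -` A i))"
      using fA by (subst Q.emeasure_PiM) (auto simp: assms(2))
    also have "\<dots> = (\<Prod>i\<in>UNIV. emeasure N (A i))"
      unfolding N_def d[symmetric] using A' by (intro prod.cong) (auto simp: emeasure_distr spQ assms(2))
    finally show "emeasure (distr ?Q ?N ?F) (Pi\<^sub>E UNIV A)
      = (\<Prod>i\<in>UNIV. emeasure N (A i))" .
  qed simp_all
  have 2: "density ?L ?W = ?N"
  proof (rule N.PiM_eqI)
    show "sets (density ?L ?W) = sets ?N"
      unfolding sets_density by (rule sets_PiM_cong) simp_all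
    fix A :: "'n \<Rightarrow> (real \<times> real) set" assume "\<And>i. i \<in> UNIV \<Longrightarrow> A i \<in> sets N"
    then have A[measurable]: "A i \<in> sets borel" for i by simp
    have "emeasure (density ?L ?W) (Pi\<^sub>E UNIV A)
       = (\<integral>\<^sup>+\<omega>. (\<Prod>i\<in>UNIV. w (\<omega> i)) * indicator (Pi\<^sub>E UNIV A) \<omega> \<partial>?L)"
      by (subst emeasure_density) (auto intro!: sets_PiM_I_finite)
    also have "\<dots> = (\<integral>\<^sup>+\<omega>. (\<Prod>i\<in>UNIV. w (\<omega> i) * indicator (A i) (\<omega> i)) \<partial>?L)"
    proof (rule nn_integral_cong)
      fix \<omega> :: "'n \<Rightarrow> real \<times> real"
      have "(indicator (Pi\<^sub>E UNIV A) \<omega> :: ennreal) = (\<Prod>i\<in>UNIV. indicator (A i) (\<omega> i))"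
      proof (cases "\<omega> \<in> Pi\<^sub>E UNIV A")
        case False
        then obtain i where "\<omega> i \<notin> A i" by auto
        then have "(\<Prod>i\<in>UNIV. indicator (A i) (\<omega> i) :: ennreal) = 0" by (intro prod_zero bexI[of _ i]) auto
        then show ?thesis using False by simp
      qed (auto simp: PiE_iff)
      then show "(\<Prod>i\<in>UNIV. w (\<omega> i)) * indicator (Pi\<^sub>E UNIV A) \<omega> = (\<Prod>i\<in>UNIV. w (\<omega> i) * indicator (A i) (\<omega> i))"
        by (simp add: prod.distrib)
    qed
    also have "\<dots> = (\<Prod>i\<in>UNIV. (\<integral>\<^sup>+z. w z * indicator (A i) z \<partial>lborel))"
      by (rule L.product_nn_integral_prod) auto
    also have "\<dots> = (\<Prod>i\<in>UNIV. emeasure N (A i))"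
      by (simp add: N_def emeasure_density)
    finally show "emeasure (density ?L ?W) (Pi\<^sub>E UNIV A)
      = (\<Prod>i\<in>UNIV. emeasure N (A i))" .
  qed simp
  have "distr ?Q borel (\<lambda>\<omega>. pair_of_vecs (\<lambda>i. f (\<omega> i)))
     = distr (distr ?Q ?N ?F) borel pair_of_vecs"
    by (subst distr_distr) (auto simp: comp_def)
  also have "\<dots> = distr (density ?L ?W) borel pair_of_vecs"
    unfolding 1 2 ..
  also have "\<dots> = distr (density ?L (\<lambda>\<omega>. ?V (pair_of_vecs \<omega>))) borel pair_of_vecs"
    by (simp add: pair_of_vecs_def)
  also have "\<dots> = density (distr ?L borel pair_of_vecs) ?V"
  proof (rule density_distr[symmetric])
    have "(\<lambda>z::(real^'n) \<times> (real^'n). (fst z $ i, snd z $ i)) \<in> borel_measurable borel" for i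
      unfolding borel_prod[symmetric] by measurable
    then show "(\<lambda>z::(real^'n) \<times> (real^'n). \<Prod>i\<in>UNIV. w (fst z $ i, snd z $ i)) \<in> borel_measurable borel"
      by (intro borel_measurable_prod_ennreal) (auto intro: measurable_compose[OF _ assms(4)])
  qed measurable
  finally show ?thesis by (simp add: distr_pair_of_vecs_lborel)
qed

section \<open>Motion along the orbits\<close>

text \<open>The partial derivative of \<open>max (\<bar>x\<bar>\<^sup>p) (\<bar>y\<bar>\<^sup>q)\<close> with respect to \<open>y\<close>, away from the
  curves \<open>\<bar>x\<bar>\<^sup>p = \<bar>y\<bar>\<^sup>q\<close>. By Hamilton's
  equations it is also the velocity of the coordinate \<open>x\<close> under the flow, see \<open>velocity_orbit\<close>.\<close>

definition velocity :: "real \<Rightarrow> real \<Rightarrow> real \<Rightarrow> real \<Rightarrow> real" where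
  "velocity p q x y = (if \<bar>x\<bar> powr p < \<bar>y\<bar> powr q then q * sgn y * \<bar>y\<bar> powr (q - 1) else 0)"

lemma velocity_minus: "velocity p q (- x) (- y) = - velocity p q x y"
  by (simp add: velocity_def sgn_minus)

text \<open>On the top side \<open>x\<close> moves with speed \<open>q t\<^sup>1\<^sup>/\<^sup>p\<close>, and \<open>\<bar>y\<bar>\<^sup>q\<^sup>-\<^sup>1 = t\<^sup>1\<^sup>/\<^sup>p\<close>
  because \<open>(q - 1) / q = 1 / p\<close>. On the right side \<open>x\<close> is at rest.\<close>

lemma velocity_half_orbit:
  assumes pq: "1 < p" "1 < q" "1/p + 1/q = 1" and t: "0 < t" and \<theta>: "0 < \<theta>" "\<theta> < 2" "\<theta> \<noteq> 2/q"
  shows "((\<lambda>\<theta>. t powr (1/p) * halfwave_x q \<theta>) has_real_derivative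
      velocity p q (t powr (1/p) * halfwave_x q \<theta>) (t powr (1/q) * halfwave_y p \<theta>)) (at \<theta>)"
proof -
  let ?a = "t powr (1/p)" and ?b = "t powr (1/q)"
  have pos: "0 < ?a" "0 < ?b" using t by simp_all
  have ab: "?a powr p = t" "?b powr q = t" using t pq by (simp_all add: powr_powr)
  have e: "(q - 1) / q = 1 / p" using pq by (simp add: field_simps)
  have bq: "?b powr (q - 1) = ?a" using t e by (simp add: powr_powr)
  have pq2: "2 / p = 2 - 2 / q" using pq(3) by (simp add: field_simps)
  have small: "\<bar>r * v\<bar> powr m < r powr m" if "\<bar>v\<bar> < 1" "0 < r" "1 < m" for r v m :: real
    using that by (intro powr_less_mono2) (auto simp: abs_mult mult_less_cancel_left1)
  consider "\<theta> < 2/q" | "2/q < \<theta>" using \<theta> by linarith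
  then show ?thesis
  proof cases
    case 1
    have "2 / p < 2 - \<theta>" using 1 pq2 by linarith
    then have hy: "halfwave_y p \<theta> = 1" using pq by (simp add: halfwave_y_def field_simps)
    have "\<bar>q * \<theta> - 1\<bar> < 1" using 1 pq \<theta> by (auto simp: abs_less_iff field_simps)
    moreover have hx: "halfwave_x q \<theta> = q * \<theta> - 1" using 1 pq by (simp add: halfwave_x_def field_simps)
    ultimately have "\<bar>?a * halfwave_x q \<theta>\<bar> powr p < \<bar>?b * halfwave_y p \<theta>\<bar> powr q"
      using small[of "q * \<theta> - 1" ?a p] pq pos by (simp add: hy ab)
    then have v: "velocity p q (?a * halfwave_x q \<theta>) (?b * halfwave_y p \<theta>) = ?a * q"
      using pos t by (simp add: velocity_def hy bq)
    have "((\<lambda>\<theta>. ?a * (q * \<theta> - 1)) has_real_derivative ?a * q) (at \<theta>)"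
      by (auto intro!: derivative_eq_intros)
    then show ?thesis unfolding v
    proof (rule has_field_derivative_transform_within_open)
      show "open {0<..<2/q}" "\<theta> \<in> {0<..<2/q}" using 1 \<theta> by auto
    qed (use pq in \<open>simp add: halfwave_x_def field_simps\<close>)
  next
    case 2
    have "2 - \<theta> < 2 / p" using 2 pq2 by linarith
    then have "p * (2 - \<theta>) < 2" using pq by (simp add: field_simps)
    then have hy: "halfwave_y p \<theta> = p * (2 - \<theta>) - 1" "\<bar>p * (2 - \<theta>) - 1\<bar> < 1"
      using pq \<theta> by (auto simp: halfwave_y_def abs_less_iff)
    moreover have hx: "halfwave_x q \<theta> = 1" using 2 pq by (simp add: halfwave_x_def field_simps)
    ultimately have "\<bar>?b * halfwave_y p \<theta>\<bar> powr q < \<bar>?a * halfwave_x q \<theta>\<bar> powr p"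
      using small[of "p * (2 - \<theta>) - 1" ?b q] pq pos by (simp add: hy ab)
    then have v: "velocity p q (?a * halfwave_x q \<theta>) (?b * halfwave_y p \<theta>) = 0"
      by (simp add: velocity_def)
    have "((\<lambda>\<theta>. ?a) has_real_derivative 0) (at \<theta>)" by simp
    then show ?thesis unfolding v
    proof (rule has_field_derivative_transform_within_open)
      show "open {2/q<..<2}" "\<theta> \<in> {2/q<..<2}" using 2 \<theta> by auto
    qed (use pq in \<open>simp add: halfwave_x_def field_simps\<close>)
  qed
qed

lemma velocity_orbit:
  assumes pq: "1 < p" "1 < q" "1/p + 1/q = 1" and t: "0 < t" and u: "0 < u" "u < 6"
    and ne: "u \<notin> {2/q, 2, 2 + 2/q, 4, 4 + 2/q}"
  shows "((\<lambda>u. orbit_x p q t u) has_real_derivative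
      velocity p q (orbit_x p q t u) (orbit_y p q t u)) (at u)"
proof -
  consider "u < 2" | "2 < u" "u < 4" | "4 < u" using ne by force
  then show ?thesis
  proof cases
    case 1
    have h: "half_turns (halfwave_x q) u = halfwave_x q u" "half_turns (halfwave_y p) u = halfwave_y p u"
      using 1 by (simp_all add: half_turns_def)
    show ?thesis unfolding h
      by (rule has_field_derivative_transform_within_open[OF velocity_half_orbit[OF pq t], of u "{0<..<2}"])
         (use 1 u ne in \<open>auto simp: half_turns_def\<close>)
  next
    case 2
    have h: "half_turns (halfwave_x q) u = - halfwave_x q (u - 2)" "half_turns (halfwave_y p) u = - halfwave_y p (u - 2)"
      using 2 by (simp_all add: half_turns_def)
    have "((\<lambda>\<theta>. t powr (1/p) * halfwave_x q \<theta>) has_real_derivative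
        velocity p q (t powr (1/p) * halfwave_x q (u - 2)) (t powr (1/q) * halfwave_y p (u - 2))) (at (u - 2))"
      by (rule velocity_half_orbit[OF pq t]) (use 2 ne in auto)
    then have "((\<lambda>u. t powr (1/p) * halfwave_x q (u + (-2))) has_real_derivative
        velocity p q (t powr (1/p) * halfwave_x q (u - 2)) (t powr (1/q) * halfwave_y p (u - 2))) (at u)"
      using DERIV_shift[of "\<lambda>\<theta>. t powr (1/p) * halfwave_x q \<theta>" _ u "-2"] by simp
    from DERIV_minus[OF this]
    have "((\<lambda>u. - (t powr (1/p) * halfwave_x q (u - 2))) has_real_derivative
        velocity p q (t powr (1/p) * - halfwave_x q (u - 2)) (t powr (1/q) * - halfwave_y p (u - 2))) (at u)"
      by (simp add: velocity_minus)
    then show ?thesis unfolding h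
      by (rule has_field_derivative_transform_within_open[of _ _ _ "{2<..<4}"])
         (use 2 in \<open>auto simp: half_turns_def\<close>)
  next
    case 3
    have h: "half_turns (halfwave_x q) u = halfwave_x q (u - 4)" "half_turns (halfwave_y p) u = halfwave_y p (u - 4)"
      using 3 by (simp_all add: half_turns_def)
    have "((\<lambda>\<theta>. t powr (1/p) * halfwave_x q \<theta>) has_real_derivative
        velocity p q (t powr (1/p) * halfwave_x q (u - 4)) (t powr (1/q) * halfwave_y p (u - 4))) (at (u - 4))"
      by (rule velocity_half_orbit[OF pq t]) (use 3 u ne in auto)
    then have "((\<lambda>u. t powr (1/p) * halfwave_x q (u + (-4))) has_real_derivative
        velocity p q (t powr (1/p) * halfwave_x q (u - 4)) (t powr (1/q) * halfwave_y p (u - 4))) (at u)"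
      using DERIV_shift[of "\<lambda>\<theta>. t powr (1/p) * halfwave_x q \<theta>" _ u "-4"] by simp
    then show ?thesis unfolding h
      by (rule has_field_derivative_transform_within_open[of _ _ _ "{4<..<6}"])
         (use 3 u in \<open>auto simp: half_turns_def\<close>)
  qed
qed

lemma continuous_on_half_turns:
  assumes f: "continuous_on {0..2} f" and anti: "f 2 = - f 0"
  shows "continuous_on {0..6} (half_turns f)"
proof -
  have "continuous_on {2..4} (\<lambda>u. - f (u - 2))" "continuous_on {4..6} (\<lambda>u. f (u - 4))"
    by (intro continuous_intros continuous_on_compose2[OF f]; auto)+
  moreover have "half_turns f u = f u" if "u \<in> {0..2}" for u
    using that anti by (cases "u = 2") (auto simp: half_turns_def)
  moreover have "half_turns f u = - f (u - 2)" if "u \<in> {2..4}" for u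
    using that anti by (cases "u = 4") (auto simp: half_turns_def)
  moreover have "half_turns f u = f (u - 4)" if "u \<in> {4..6}" for u
    using that by (auto simp: half_turns_def)
  ultimately have "continuous_on {0..2} (half_turns f)" "continuous_on {2..4} (half_turns f)"
     "continuous_on {4..6} (half_turns f)"
    using f by (metis (no_types, lifting) continuous_on_eq)+
  then have "continuous_on (({0..2} \<union> {2..4}) \<union> {4..6}) (half_turns f)"
    by (intro continuous_on_closed_Un) auto
  moreover have "({0..2} \<union> {2..4}) \<union> {4..6} = {0..6::real}" by auto
  ultimately show ?thesis by simp
qed

lemma halfwave_antiperiodic:
  assumes "1 < q"
  shows "halfwave_x q 2 = - halfwave_x q 0"
  using assms by (simp add: halfwave_x_def)

text \<open>If the right-hand side is finite, then the majorant is integrable and dominates \<open>f'\<close>, whose integral is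
  given by the fundamental theorem of calculus.\<close>

lemma nn_integral_ge_increment:
  fixes f f' F :: "real \<Rightarrow> real"
  assumes ab: "a \<le> b" and cont: "continuous_on {a..b} f" and fin: "finite E"
    and der: "\<And>x. a < x \<Longrightarrow> x < b \<Longrightarrow> x \<notin> E \<Longrightarrow> (f has_real_derivative f' x) (at x)"
    and [measurable]: "F \<in> borel_measurable borel" and F: "\<And>x. 0 \<le> F x" "\<And>x. f' x \<le> F x"
  shows "ennreal (f b - f a) \<le> (\<integral>\<^sup>+x. ennreal (F x) * indicator {a..b} x \<partial>lborel)" (is "_ \<le> ?I")
proof (cases "?I = \<infinity>")
  case False
  have f': "(f' has_integral (f b - f a)) {a..b}"
    by (rule fundamental_theorem_of_calculus_interior_strong[OF fin ab _ cont])
       (auto intro!: der simp: has_real_derivative_iff_has_vector_derivative[symmetric])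
  define r where "r = enn2real ?I"
  have I: "?I = ennreal r" using False by (simp add: r_def less_top)
  have e: "?I = (\<integral>\<^sup>+x. ennreal (F x * indicator {a..b} x) \<partial>lborel)"
    using F by (intro nn_integral_cong) (auto simp: indicator_def)
  have "((\<lambda>x. F x * indicator {a..b} x) has_integral r) UNIV"
    by (rule nn_integral_has_integral) (use F I e in \<open>auto simp: r_def simp del: ennreal_enn2real\<close>)
  moreover have "(\<lambda>x. F x * indicator {a..b} x) = (\<lambda>x. if x \<in> {a..b} then F x else 0)"
    by (auto simp: indicator_def)
  ultimately have "((\<lambda>x. if x \<in> {a..b} then F x else 0) has_integral r) UNIV" by simp
  then have FI: "(F has_integral r) {a..b}" by (rule has_integral_restrict_UNIV[THEN iffD1])
  have "f b - f a \<le> r" by (rule has_integral_le[OF f' FI]) (rule F(2))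
  then show ?thesis unfolding I by (rule ennreal_leI)
qed simp

section \<open>The derivative of the energy along a line\<close>

lemma nn_integral_exp_greaterThan:
  "(\<integral>\<^sup>+t. ennreal (exp (- t)) * indicator {c<..} t \<partial>lborel) = ennreal (exp (- c))"
proof -
  have "(\<integral>\<^sup>+t. ennreal (exp (- t)) * indicator {c<..} t \<partial>lborel) = (\<integral>\<^sup>+t. ennreal (exp (- t)) * indicator {c..} t \<partial>lborel)"
  proof (rule nn_integral_cong_AE)
    have "AE t in lborel. t \<noteq> c" by (rule AE_lborel_singleton)
    then show "AE t in lborel. ennreal (exp (- t)) * indicator {c<..} t = ennreal (exp (- t)) * indicator {c..} t"
      by eventually_elim (auto simp: indicator_def)
  qed
  also have "\<dots> = ennreal (0 - (- exp (- c)))"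
  proof (rule nn_integral_FTC_atLeast)
    show "((\<lambda>t. - exp (- t)) \<longlongrightarrow> 0) (at_top :: real filter)"
      using tendsto_minus[OF filterlim_compose[OF exp_at_bot filterlim_uminus_at_bot_at_top]] by simp
  qed (auto intro!: derivative_eq_intros)
  finally show ?thesis by simp
qed

text \<open>The derivative \<open>D\<close> is monotone, so on the interval it is nonpositive up to some point \<open>c\<close>
  and positive after it. The integrand is the derivative of \<open>- exp (- \<phi>)\<close> to the right of \<open>c\<close>.\<close>

lemma nn_integral_ascent_interval:
  fixes \<phi> D :: "real \<Rightarrow> real"
  assumes cont: "continuous_on {a..b} \<phi>" and fin: "finite E" and mono: "mono D"
    and der: "\<And>s. s \<notin> E \<Longrightarrow> (\<phi> has_real_derivative D s) (at s)"
    and m: "\<And>s. m \<le> \<phi> s"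
  shows "(\<integral>\<^sup>+s. ennreal (max 0 (D s) * exp (- \<phi> s)) * indicator {a..b} s \<partial>lborel) \<le> ennreal (exp (- m))"
proof (cases "a \<le> b \<and> 0 < D b")
  case False
  then have "max 0 (D s) = 0" if "s \<in> {a..b}" for s
    using monoD[OF mono, of s b] that by auto
  then have "ennreal (max 0 (D s) * exp (- \<phi> s)) * indicator {a..b} s = 0" for s
    by (cases "s \<in> {a..b}") auto
  then have "(\<integral>\<^sup>+s. ennreal (max 0 (D s) * exp (- \<phi> s)) * indicator {a..b} s \<partial>lborel) = (\<integral>\<^sup>+s. 0 \<partial>(lborel :: real measure))"
    by (intro nn_integral_cong) simp
  then show ?thesis by simp
next
  case True
  define U where "U = {s \<in> {a..b}. 0 < D s}"
  define c where "c = Inf U"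
  have bU: "b \<in> U" using True by (simp add: U_def)
  have bdd: "bdd_below U" unfolding U_def by (rule bdd_belowI[of _ a]) auto
  have cb: "a \<le> c" "c \<le> b"
    using bU bdd unfolding c_def by (auto intro: cInf_lower cInf_greatest simp: U_def)
  have below: "D s \<le> 0" if "a \<le> s" "s < c" for s
    using that cb cInf_lower[OF _ bdd, of s] unfolding c_def[symmetric] by (force simp: U_def)
  have above: "0 < D s" if "c < s" for s
  proof -
    have "\<exists>u\<in>U. u < s" by (rule cInf_lessD) (use bU that in \<open>auto simp: c_def\<close>)
    then obtain u where "u \<in> U" "u < s" by blast
    then show ?thesis using monoD[OF mono, of u s] by (auto simp: U_def)
  qed
  let ?h = "\<lambda>s. D s * exp (- \<phi> s)"
  have HI: "(?h has_integral ((- exp (- \<phi> b)) - (- exp (- \<phi> c)))) {c..b}"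
  proof (rule fundamental_theorem_of_calculus_interior_strong[OF fin cb(2)])
    show "continuous_on {c..b} (\<lambda>s. - exp (- \<phi> s))"
      using continuous_on_subset[OF cont, of "{c..b}"] cb by (intro continuous_intros) auto
    fix s assume "s \<in> {c<..<b} - E"
    then have "(\<phi> has_real_derivative D s) (at s)" using der by auto
    then have "((\<lambda>s. - exp (- \<phi> s)) has_real_derivative D s * exp (- \<phi> s)) (at s)"
      by (auto intro!: derivative_eq_intros)
    then show "((\<lambda>s. - exp (- \<phi> s)) has_vector_derivative D s * exp (- \<phi> s)) (at s)"
      by (simp add: has_real_derivative_iff_has_vector_derivative)
  qed
  have "((\<lambda>s. max 0 (D s) * exp (- \<phi> s)) has_integral ((- exp (- \<phi> b)) - (- exp (- \<phi> c)))) {c..b}"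
  proof (rule has_integral_spike_finite[OF _ _ HI, of "{c}"])
    fix s assume "s \<in> {c..b} - {c}"
    then have "0 < D s" by (intro above) auto
    then show "max 0 (D s) * exp (- \<phi> s) = D s * exp (- \<phi> s)" by simp
  qed simp
  then have HI2: "((\<lambda>s. max 0 (D s) * exp (- \<phi> s)) has_integral (exp (- \<phi> c) - exp (- \<phi> b))) {c..b}"
    by simp
  have "(\<integral>\<^sup>+s. ennreal (max 0 (D s) * exp (- \<phi> s)) * indicator {a..b} s \<partial>lborel)
     = (\<integral>\<^sup>+s. ennreal (max 0 (D s) * exp (- \<phi> s)) * indicator {c..b} s \<partial>lborel)"
  proof (rule nn_integral_cong)
    fix s
    show "ennreal (max 0 (D s) * exp (- \<phi> s)) * indicator {a..b} s = ennreal (max 0 (D s) * exp (- \<phi> s)) * indicator {c..b} s"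
      using below[of s] cb by (cases "a \<le> s \<and> s < c") (auto simp: indicator_def)
  qed
  also have "\<dots> = ennreal (exp (- \<phi> c) - exp (- \<phi> b))"
    by (rule nn_integral_has_integral_lebesgue'[OF _ HI2]) auto
  also have "\<dots> \<le> ennreal (exp (- m))"
    using m[of c] exp_ge_zero[of "- \<phi> b"] by (intro ennreal_leI) (smt (verit) exp_le_cancel_iff)
  finally show ?thesis .
qed

text \<open>The right-hand side is \<open>exp (- inf \<phi>)\<close>, written as an integral over the levels \<open>t\<close> so that
  Fubini's theorem can be applied to it.\<close>

lemma nn_integral_ascent:
  fixes \<phi> D :: "real \<Rightarrow> real"
  assumes cont: "continuous_on UNIV \<phi>" and fin: "finite E" and mono: "mono D"
    and der: "\<And>s. s \<notin> E \<Longrightarrow> (\<phi> has_real_derivative D s) (at s)"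
    and bdd: "\<And>s. 0 \<le> \<phi> s"
  shows "(\<integral>\<^sup>+s. ennreal (max 0 (D s) * exp (- \<phi> s)) \<partial>lborel)
     \<le> (\<integral>\<^sup>+t. ennreal (exp (- t)) * indicator {t. \<exists>s. \<phi> s < t} t \<partial>lborel)"
proof -
  have [measurable]: "\<phi> \<in> borel_measurable borel" using cont by (rule borel_measurable_continuous_onI)
  have [measurable]: "D \<in> borel_measurable borel" using mono by (rule borel_measurable_mono)
  define m where "m = Inf (range \<phi>)"
  have bb: "bdd_below (range \<phi>)" using bdd by (intro bdd_belowI[of _ 0]) auto
  have m: "m \<le> \<phi> s" for s unfolding m_def using bb by (intro cInf_lower) auto
  have set: "{t. \<exists>s. \<phi> s < t} = {m<..}"
    using cInf_less_iff[OF _ bb] unfolding m_def[symmetric] by auto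
  let ?f = "\<lambda>s. ennreal (max 0 (D s) * exp (- \<phi> s))"
  have "(\<integral>\<^sup>+s. ?f s \<partial>lborel) = emeasure (density lborel ?f) (\<Union>k. {- real k..real k})"
  proof -
    have "(\<Union>k. {- real k..real k}) = (UNIV :: real set)"
    proof (intro set_eqI iffI)
      fix x :: real
      obtain k where "\<bar>x\<bar> \<le> real k" using real_arch_simple by blast
      then show "x \<in> (\<Union>k. {- real k..real k})" by (auto intro!: exI[of _ k])
    qed simp
    then show ?thesis by (simp add: emeasure_density)
  qed
  also have "\<dots> = (SUP k. emeasure (density lborel ?f) {- real k..real k})"
    by (rule SUP_emeasure_incseq[symmetric]) (auto simp: incseq_def)
  also have "\<dots> \<le> ennreal (exp (- m))"
  proof (rule SUP_least)
    fix k :: nat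
    have "emeasure (density lborel ?f) {- real k..real k} = (\<integral>\<^sup>+s. ?f s * indicator {- real k..real k} s \<partial>lborel)"
      by (simp add: emeasure_density)
    also have "\<dots> \<le> ennreal (exp (- m))"
      by (rule nn_integral_ascent_interval[OF _ fin mono der m]) (auto intro: continuous_on_subset[OF cont])
    finally show "emeasure (density lborel ?f) {- real k..real k} \<le> ennreal (exp (- m))" .
  qed
  also have "\<dots> = (\<integral>\<^sup>+t. ennreal (exp (- t)) * indicator {t. \<exists>s. \<phi> s < t} t \<partial>lborel)"
    unfolding set by (rule nn_integral_exp_greaterThan[symmetric])
  finally show ?thesis .
qed

lemma mono_velocity:
  assumes q: "1 < q"
  shows "mono (velocity p q x)"
proof (rule monoI)
  fix y z :: real assume yz: "y \<le> z"
  show "velocity p q x y \<le> velocity p q x z"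
  proof (cases "0 \<le> y")
    case True
    have "\<bar>y\<bar> powr q \<le> \<bar>z\<bar> powr q" "\<bar>y\<bar> powr (q - 1) \<le> \<bar>z\<bar> powr (q - 1)"
      using True yz q by (simp_all add: powr_mono2)
    then show ?thesis using True yz q
      by (auto simp: velocity_def sgn_if mult_left_mono)
  next
    case False
    show ?thesis
    proof (cases "z \<le> 0")
      case True
      have "\<bar>z\<bar> powr q \<le> \<bar>y\<bar> powr q" "\<bar>z\<bar> powr (q - 1) \<le> \<bar>y\<bar> powr (q - 1)"
        using True yz q by (simp_all add: powr_mono2)
      then show ?thesis using True False yz q
        by (auto simp: velocity_def sgn_if mult_left_mono)
    next
      case 2: False
      have "velocity p q x y \<le> 0" using False q by (simp add: velocity_def sgn_if)
      also have "0 \<le> velocity p q x z" using 2 q by (simp add: velocity_def sgn_if)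
      finally show ?thesis .
    qed
  qed
qed

lemma has_real_derivative_max_powr:
  assumes q: "1 < q" and c: "0 \<le> c" and ne: "\<bar>y\<bar> powr q \<noteq> c"
    and c': "c = \<bar>x\<bar> powr p"
  shows "((\<lambda>y. max c (\<bar>y\<bar> powr q)) has_real_derivative velocity p q x y) (at y)"
proof -
  have "isCont (\<lambda>y. \<bar>y\<bar> powr q) y" using q by (intro continuous_intros) auto
  then have ct: "((\<lambda>y. \<bar>y\<bar> powr q) \<longlongrightarrow> \<bar>y\<bar> powr q) (nhds y)"
    unfolding isCont_def by (subst tendsto_at_iff_tendsto_nhds[symmetric])
  consider "\<bar>y\<bar> powr q < c" | "c < \<bar>y\<bar> powr q" using ne by linarith
  then show ?thesis
  proof cases
    case 1
    then have ev: "eventually (\<lambda>y. \<bar>y\<bar> powr q < c) (nhds y)"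
      using ct by (intro order_tendstoD) auto
    have "((\<lambda>y. c) has_real_derivative 0) (at y)" by simp
    then have "((\<lambda>y. max c (\<bar>y\<bar> powr q)) has_real_derivative 0) (at y)"
      by (rule has_field_derivative_cong_eventually[THEN iffD1, rotated 2])
         (use 1 ev in \<open>auto simp: eventually_nhds_conv_at elim!: eventually_mono\<close>)
    then show ?thesis using 1 by (simp add: velocity_def c')
  next
    case 2
    then have ev: "eventually (\<lambda>y. c < \<bar>y\<bar> powr q) (nhds y)"
      using ct by (intro order_tendstoD) auto
    have y0: "y \<noteq> 0" using 2 c by auto
    have "((\<lambda>y. \<bar>y\<bar>) has_real_derivative sgn y) (at y)"
    proof (cases "0 < y")
      case True
      show ?thesis
        by (rule has_field_derivative_transform_within_open[of "\<lambda>y. y" _ _ "{0<..}"]) (use True in auto)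
    next
      case False
      show ?thesis
        by (rule has_field_derivative_transform_within_open[of "\<lambda>y. - y" _ _ "{..<0}"])
           (use False y0 in \<open>auto intro!: derivative_eq_intros\<close>)
    qed
    then have "((\<lambda>y. \<bar>y\<bar> powr q) has_real_derivative q * \<bar>y\<bar> powr (q - 1) * sgn y) (at y)"
      using y0 by (intro DERIV_chain2[where f="\<lambda>z. z powr q" and g=abs] has_real_derivative_powr) auto
    then have "((\<lambda>y. max c (\<bar>y\<bar> powr q)) has_real_derivative q * \<bar>y\<bar> powr (q - 1) * sgn y) (at y)"
      by (rule has_field_derivative_cong_eventually[THEN iffD1, rotated 2])
         (use 2 ev in \<open>auto simp: eventually_nhds_conv_at elim!: eventually_mono\<close>)
    then show ?thesis using 2 by (simp add: velocity_def c' mult_ac)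
  qed
qed

section \<open>Crossings of a hyperplane\<close>

definition energy :: "real \<Rightarrow> real \<Rightarrow> real ^ 'n \<Rightarrow> real ^ 'n \<Rightarrow> real" where
  "energy p q x y = (\<Sum>i\<in>UNIV. max (\<bar>x $ i\<bar> powr p) (\<bar>y $ i\<bar> powr q))"

text \<open>The derivative of the energy in the direction \<open>(0, n)\<close>, which is the
  rate of change of \<open>n \<bullet> x\<close> along the flow.\<close>

definition ascent :: "real \<Rightarrow> real \<Rightarrow> real ^ 'n \<Rightarrow> real ^ 'n \<Rightarrow> real ^ 'n \<Rightarrow> real" where
  "ascent p q n x y = (\<Sum>i\<in>UNIV. n $ i * velocity p q (x $ i) (y $ i))"

lemma energy_nonneg: "0 \<le> energy p q x y"
  unfolding energy_def by (intro sum_nonneg) (auto simp: le_max_iff_disj)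

lemma nn_integral_fiber_ascent:
  fixes n x y :: "real ^ 'n"
  assumes pq: "1 < p" "1 < q"
  shows "(\<integral>\<^sup>+s. ennreal (max 0 (ascent p q n x (y + s *\<^sub>R n)) * exp (- energy p q x (y + s *\<^sub>R n))) \<partial>lborel)
     \<le> (\<integral>\<^sup>+t. ennreal (exp (- t)) * indicator {t. \<exists>s. energy p q x (y + s *\<^sub>R n) < t} t \<partial>lborel)"
proof (rule nn_integral_ascent)
  define r where "r i = (\<bar>x $ i\<bar> powr p) powr (1/q)" for i
  \<comment> \<open>The parameters at which some term of the energy switches between its two branches.\<close>
  define E where "E = (\<Union>i. {(r i - y $ i) / n $ i, (- r i - y $ i) / n $ i})"
  show "finite E" unfolding E_def by simp
  show "continuous_on UNIV (\<lambda>s. energy p q x (y + s *\<^sub>R n))"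
    unfolding energy_def using pq
    by (intro continuous_on_sum continuous_on_max continuous_on_powr' continuous_intros) auto
  show "mono (\<lambda>s. ascent p q n x (y + s *\<^sub>R n))"
  proof (rule monoI)
    fix s s' :: real assume le: "s \<le> s'"
    have "n $ i * velocity p q (x $ i) ((y + s *\<^sub>R n) $ i) \<le> n $ i * velocity p q (x $ i) ((y + s' *\<^sub>R n) $ i)" for i
    proof (cases "0 \<le> n $ i")
      case True
      then show ?thesis using le
        by (intro mult_left_mono monoD[OF mono_velocity[OF pq(2)]]) (auto intro: mult_right_mono)
    next
      case False
      then show ?thesis using le
        by (intro mult_left_mono_neg monoD[OF mono_velocity[OF pq(2)]]) (auto intro: mult_right_mono_neg)
    qed
    then show "ascent p q n x (y + s *\<^sub>R n) \<le> ascent p q n x (y + s' *\<^sub>R n)"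
      unfolding ascent_def by (intro sum_mono)
  qed
  show "0 \<le> energy p q x (y + s *\<^sub>R n)" for s by (rule energy_nonneg)
  fix s assume s: "s \<notin> E"
  have "((\<lambda>s. max (\<bar>x $ i\<bar> powr p) (\<bar>(y + s *\<^sub>R n) $ i\<bar> powr q)) has_real_derivative
      n $ i * velocity p q (x $ i) ((y + s *\<^sub>R n) $ i)) (at s)" for i
  proof (cases "n $ i = 0")
    case False
    have "\<bar>y $ i + s * n $ i\<bar> powr q \<noteq> \<bar>x $ i\<bar> powr p"
    proof
      assume eq: "\<bar>y $ i + s * n $ i\<bar> powr q = \<bar>x $ i\<bar> powr p"
      have "(\<bar>y $ i + s * n $ i\<bar> powr q) powr (1/q) = \<bar>y $ i + s * n $ i\<bar>"
        using pq by (simp add: powr_powr)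
      then have "\<bar>y $ i + s * n $ i\<bar> = r i" unfolding r_def eq by simp
      then have "s = (r i - y $ i) / n $ i \<or> s = (- r i - y $ i) / n $ i"
        using False by (auto simp: field_simps abs_if split: if_splits)
      then show False using s by (auto simp: E_def)
    qed
    then have "((\<lambda>v. max (\<bar>x $ i\<bar> powr p) (\<bar>v\<bar> powr q)) has_real_derivative
      velocity p q (x $ i) (y $ i + s * n $ i)) (at (y $ i + s * n $ i))"
      by (intro has_real_derivative_max_powr[OF pq(2)]) auto
    moreover have "((\<lambda>s. y $ i + s * n $ i) has_real_derivative n $ i) (at s)"
      by (auto intro!: derivative_eq_intros)
    ultimately have "((\<lambda>s. max (\<bar>x $ i\<bar> powr p) (\<bar>y $ i + s * n $ i\<bar> powr q)) has_real_derivative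
      velocity p q (x $ i) (y $ i + s * n $ i) * n $ i) (at s)"
      by (rule DERIV_chain2[where g="\<lambda>s. y $ i + s * n $ i"])
    then show ?thesis by (simp add: mult.commute)
  qed simp
  then show "((\<lambda>s. energy p q x (y + s *\<^sub>R n)) has_real_derivative ascent p q n x (y + s *\<^sub>R n)) (at s)"
    unfolding energy_def ascent_def by (intro DERIV_sum)
qed

lemma velocity_measurable[measurable (raw)]:
  assumes [measurable]: "a \<in> borel_measurable M" "b \<in> borel_measurable M"
  shows "(\<lambda>x. velocity p q (a x) (b x)) \<in> borel_measurable M"
  unfolding velocity_def sgn_if by measurable

lemma ascent_measurable[measurable (raw)]:
  fixes a b :: "'a \<Rightarrow> real ^ 'n"
  assumes [measurable]: "a \<in> borel_measurable M" "b \<in> borel_measurable M"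
  shows "(\<lambda>x. ascent p q n (a x) (b x)) \<in> borel_measurable M"
  unfolding ascent_def by measurable

lemma energy_measurable[measurable (raw)]:
  fixes a b :: "'a \<Rightarrow> real ^ 'n"
  assumes [measurable]: "a \<in> borel_measurable M" "b \<in> borel_measurable M"
  shows "(\<lambda>x. energy p q (a x) (b x)) \<in> borel_measurable M"
  unfolding energy_def by measurable

lemma fst_snd_borel[measurable]:
  "(fst :: 'a::second_countable_topology \<times> 'b::second_countable_topology \<Rightarrow> 'a) \<in> borel_measurable borel"
  "(snd :: 'a::second_countable_topology \<times> 'b::second_countable_topology \<Rightarrow> 'b) \<in> borel_measurable borel"
  by (simp_all add: borel_prod[symmetric])

text \<open>After half a period the orbit is at the antipode, so the left-hand side is the increment of
  \<open>G\<close> along half of the orbit.\<close>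

lemma orbit_crossing:
  fixes n :: "real ^ 'n" and \<omega> :: "'n \<Rightarrow> real \<times> real" and G g :: "real \<Rightarrow> real"
  assumes pq: "1 < p" "1 < q" "1/p + 1/q = 1"
    and G: "\<And>u. (G has_real_derivative g u) (at u)" and [measurable]: "g \<in> borel_measurable borel" and g0: "\<And>u. 0 \<le> g u"
    and \<omega>: "\<And>i. 0 < fst (\<omega> i) \<and> 0 \<le> snd (\<omega> i) \<and> snd (\<omega> i) < 4"
  defines "X \<equiv> (\<lambda>s. fst (pair_of_vecs (\<lambda>i. orbit_point p q s (\<omega> i))))"
  defines "Y \<equiv> (\<lambda>s. snd (pair_of_vecs (\<lambda>i. orbit_point p q s (\<omega> i))))"
  shows "ennreal (G (- (n \<bullet> X 0)) - G (n \<bullet> X 0)) \<le>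
     (\<integral>\<^sup>+s. ennreal (g (n \<bullet> X s) * max 0 (ascent p q n (X s) (Y s))) * indicator {0..2} s \<partial>lborel)"
proof -
  have Xi: "X s $ i = orbit_x p q (fst (\<omega> i)) (snd (\<omega> i) + s)" for s i
    by (simp add: X_def pair_of_vecs_def orbit_point_def split_beta)
  have Yi: "Y s $ i = orbit_y p q (fst (\<omega> i)) (snd (\<omega> i) + s)" for s i
    by (simp add: Y_def pair_of_vecs_def orbit_point_def split_beta)
  have [measurable]: "X \<in> borel_measurable borel" "Y \<in> borel_measurable borel"
    unfolding X_def Y_def pair_of_vecs_def orbit_point_def split_beta
    by (auto intro!: borel_measurable_vec_lambda)
  \<comment> \<open>The half period is the antipodal map.\<close>
  have ac: "half_turns (halfwave_x q) (u + 2) = - half_turns (halfwave_x q) u" if "0 \<le> u" "u < 4" for u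
    using that by (auto simp: half_turns_def)
  have X2: "X 2 = - X 0"
    using ac \<omega> by (simp add: vec_eq_iff Xi)
  have l: "n \<bullet> X s = (\<Sum>i\<in>UNIV. n $ i * X s $ i)" for s by (simp add: inner_vec_def)
  \<comment> \<open>The times at which some coordinate pair passes a corner of its rectangle.\<close>
  define E where "E = (\<Union>i. (\<lambda>v. v - snd (\<omega> i)) ` {2/q, 2, 2 + 2/q, 4, 4 + 2/q})"
  have cont: "continuous_on {0..2} (\<lambda>s. n \<bullet> X s)"
    unfolding l Xi
  proof (intro continuous_intros)
    fix i
    have "continuous_on {0..2} (halfwave_x q)" unfolding halfwave_x_def by (intro continuous_intros)
    then have c: "continuous_on {0..6} (half_turns (halfwave_x q))"
      by (rule continuous_on_half_turns[OF _ halfwave_antiperiodic[OF pq(2)]])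
    show "continuous_on {0..2} (\<lambda>s. half_turns (halfwave_x q) (snd (\<omega> i) + s))"
      by (rule continuous_on_compose2[OF c]) (use \<omega>[of i] in \<open>auto intro!: continuous_intros\<close>)
  qed
  have "ennreal (G (n \<bullet> X 2) - G (n \<bullet> X 0)) \<le>
     (\<integral>\<^sup>+s. ennreal (g (n \<bullet> X s) * max 0 (ascent p q n (X s) (Y s))) * indicator {0..2} s \<partial>lborel)"
  proof (rule nn_integral_ge_increment[where f="\<lambda>s. G (n \<bullet> X s)" and f'="\<lambda>s. g (n \<bullet> X s) * ascent p q n (X s) (Y s)" and E=E])
    have "isCont G u" for u using G DERIV_isCont by blast
    then show "continuous_on {0..2} (\<lambda>s. G (n \<bullet> X s))"
      using continuous_on_compose2[OF _ cont, of UNIV G] by (simp add: continuous_at_imp_continuous_on)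
    show "finite E" unfolding E_def by simp
    show "0 \<le> g (n \<bullet> X s) * max 0 (ascent p q n (X s) (Y s))" for s using g0 by simp
    show "g (n \<bullet> X s) * ascent p q n (X s) (Y s) \<le> g (n \<bullet> X s) * max 0 (ascent p q n (X s) (Y s))" for s
      using g0 by (intro mult_left_mono) auto
    fix s :: real assume s: "0 < s" "s < 2" "s \<notin> E"
    have "((\<lambda>s. X s $ i) has_real_derivative velocity p q (X s $ i) (Y s $ i)) (at s)" for i
    proof -
      have ne: "snd (\<omega> i) + s \<notin> {2/q, 2, 2 + 2/q, 4, 4 + 2/q}"
      proof
        assume "snd (\<omega> i) + s \<in> {2/q, 2, 2 + 2/q, 4, 4 + 2/q}"
        then have "s \<in> (\<lambda>v. v - snd (\<omega> i)) ` {2/q, 2, 2 + 2/q, 4, 4 + 2/q}"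
          by (rule rev_image_eqI) simp
        then show False using s unfolding E_def by blast
      qed
      have "((\<lambda>u. orbit_x p q (fst (\<omega> i)) u) has_real_derivative velocity p q (X s $ i) (Y s $ i)) (at (s + snd (\<omega> i)))"
        using velocity_orbit[OF pq _ _ _ ne, of "fst (\<omega> i)"] \<omega>[of i] s by (simp add: Xi Yi add.commute)
      then have "((\<lambda>s. orbit_x p q (fst (\<omega> i)) (s + snd (\<omega> i))) has_real_derivative velocity p q (X s $ i) (Y s $ i)) (at s)"
        using DERIV_shift[of "\<lambda>u. orbit_x p q (fst (\<omega> i)) u" _ s "snd (\<omega> i)"] by simp
      then show ?thesis by (simp add: Xi add.commute)
    qed
    then have "((\<lambda>s. n \<bullet> X s) has_real_derivative ascent p q n (X s) (Y s)) (at s)"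
      unfolding l ascent_def by (intro DERIV_sum DERIV_cmult)
    then show "((\<lambda>s. G (n \<bullet> X s)) has_real_derivative g (n \<bullet> X s) * ascent p q n (X s) (Y s)) (at s)"
      by (rule DERIV_chain2[OF G])
  qed (simp_all, measurable)
  then show ?thesis by (simp add: X2)
qed

definition gibbs_measure :: "real \<Rightarrow> real \<Rightarrow> ((real ^ 'n) \<times> (real ^ 'n)) measure" where
  "gibbs_measure p q = density lborel (\<lambda>z. ennreal (exp (- energy p q (fst z) (snd z))))"

lemma sigma_finite_action_angle: "sigma_finite_measure action_angle_measure"
proof -
  show ?thesis unfolding action_angle_measure_def
    by (subst sigma_finite_measure.sigma_finite_iff_density_finite[OF sigma_finite_lborel])
      (auto simp: action_angle_density_def indicator_def of_bool_def ennreal_mult_eq_top_iff intro!: AE_I2 split: if_splits)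
qed

lemma distr_orbits_gibbs:
  assumes pq: "1 < p" "1 < q" "1/p + 1/q = 1" and s: "0 \<le> s" "s \<le> 2"
  shows "distr (\<Pi>\<^sub>M i\<in>(UNIV :: 'n::finite set). action_angle_measure) borel (\<lambda>\<omega>. pair_of_vecs (\<lambda>i. orbit_point p q s (\<omega> i)))
     = gibbs_measure p q"
proof -
  have "distr (\<Pi>\<^sub>M i\<in>(UNIV :: 'n::finite set). action_angle_measure) borel (\<lambda>\<omega>. pair_of_vecs (\<lambda>i. orbit_point p q s (\<omega> i)))
     = density lborel (\<lambda>z. \<Prod>i\<in>UNIV. (planar_gibbs p q) (fst z $ i, snd z $ i))"
    by (rule distr_PiM_componentwise[OF sigma_finite_action_angle _ orbit_point_measurable planar_gibbs_measurable _ distr_orbit_point[OF pq s]])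
       (auto simp: planar_gibbs_def split: prod.split)
  also have "\<dots> = gibbs_measure p q"
    unfolding gibbs_measure_def energy_def planar_gibbs_def
    by (simp add: prod_ennreal exp_sum sum_negf[symmetric])
  finally show ?thesis .
qed

lemma AE_PiM_action_angle:
  "AE \<omega> in (\<Pi>\<^sub>M i\<in>(UNIV :: 'n::finite set). action_angle_measure). \<forall>i. 0 < fst (\<omega> i) \<and> 0 \<le> snd (\<omega> i) \<and> snd (\<omega> i) < 4"
proof -
  define Q where "Q = action_angle_measure"
  let ?Q = "\<Pi>\<^sub>M i\<in>(UNIV :: 'n set). Q"
  interpret product_sigma_finite "\<lambda>i::'n. Q"
    using sigma_finite_action_angle by (simp add: product_sigma_finite_def Q_def)
  define bad where "bad = {z::real \<times> real. \<not> (0 < fst z \<and> 0 \<le> snd z \<and> snd z < 4)}"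
  have [measurable]: "bad \<in> sets borel" unfolding bad_def by measurable
  have sQ: "sets Q = sets borel" "space Q = UNIV" by (simp_all add: Q_def action_angle_measure_def)
  have "emeasure Q bad = (\<integral>\<^sup>+z. action_angle_density z * indicator bad z \<partial>lborel)"
    unfolding Q_def action_angle_measure_def by (subst emeasure_density) auto
  also have "\<dots> = (\<integral>\<^sup>+z. 0 \<partial>(lborel :: (real \<times> real) measure))"
    by (intro nn_integral_cong) (auto simp: action_angle_density_def bad_def indicator_def)
  finally have 0: "emeasure Q bad = 0" by simp
  \<comment> \<open>The bad event of coordinate \<open>i\<close> is a product set with one factor of measure 0.\<close>
  have "AE \<omega> in ?Q. \<omega> i \<notin> bad" for i
  proof (rule AE_I')
    define A where "A j = (if j = i then bad else UNIV)" for j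
    have A: "A j \<in> sets Q" for j by (simp add: A_def sQ)
    have "emeasure ?Q (Pi\<^sub>E UNIV A) = (\<Prod>j\<in>UNIV. emeasure Q (A j))"
      using A by (intro emeasure_PiM) auto
    also have "\<dots> = 0" using 0 by (intro prod_zero bexI[of _ i]) (auto simp: A_def)
    finally show "Pi\<^sub>E UNIV A \<in> null_sets ?Q"
      using A by (intro null_setsI sets_PiM_I_finite) auto
    show "{\<omega> \<in> space ?Q. \<not> \<omega> i \<notin> bad} \<subseteq> Pi\<^sub>E UNIV A"
      by (auto simp: A_def)
  qed
  then have "AE \<omega> in ?Q. \<forall>i. \<omega> i \<notin> bad"
    by (simp add: AE_all_countable)
  then show ?thesis unfolding Q_def bad_def by eventually_elim auto
qed

abbreviation crossing_rate :: "real \<Rightarrow> real \<Rightarrow> real ^ 'n \<Rightarrow> (real \<Rightarrow> real) \<Rightarrow> (real ^ 'n) \<times> (real ^ 'n) \<Rightarrow> ennreal" where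
  "crossing_rate p q n g z \<equiv> ennreal (g (n \<bullet> fst z) * max 0 (ascent p q n (fst z) (snd z)))"

text \<open>The lower bound for the flux: average \<open>orbit_crossing\<close> over all orbits. By invariance of the measure each of
  the elapsed times in \<open>[0,2]\<close> contributes the same amount, which produces the factor 2.\<close>

lemma gibbs_crossing:
  fixes n :: "real ^ 'n" and G g :: "real \<Rightarrow> real"
  assumes pq: "1 < p" "1 < q" "1/p + 1/q = 1"
    and G: "\<And>u. (G has_real_derivative g u) (at u)" and g[measurable]: "g \<in> borel_measurable borel" and g0: "\<And>u. 0 \<le> g u"
    and Gd: "\<And>u. u \<le> - \<delta> \<Longrightarrow> 1 \<le> G (- u) - G u"
  shows "emeasure (gibbs_measure p q) {z. n \<bullet> fst z \<le> - \<delta>}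
      \<le> 2 * (\<integral>\<^sup>+z. crossing_rate p q n g z \<partial>gibbs_measure p q)"
proof -
  define \<Omega> where "\<Omega> = (\<Pi>\<^sub>M i\<in>(UNIV :: 'n set). action_angle_measure)"
  define \<Phi> where "\<Phi> s \<omega> = pair_of_vecs (\<lambda>i. orbit_point p q s (\<omega> i))" for s and \<omega> :: "'n \<Rightarrow> real \<times> real"
  define h where "h z = ennreal (g (n \<bullet> fst z) * max 0 (ascent p q n (fst z) (snd z)))" for z
  let ?I = "\<lambda>\<omega>. \<integral>\<^sup>+s. h (\<Phi> s \<omega>) * indicator {0..2} s \<partial>lborel"
  have h[measurable]: "h \<in> borel_measurable borel" unfolding h_def by measurable
  interpret product_sigma_finite "\<lambda>i::'n. action_angle_measure"
    using sigma_finite_action_angle by (simp add: product_sigma_finite_def)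
  interpret O: sigma_finite_measure \<Omega> unfolding \<Omega>_def by (rule sigma_finite) simp
  interpret P: pair_sigma_finite "lborel :: real measure" \<Omega> ..
  have c: "(\<lambda>\<omega>. \<omega> i) \<in> borel_measurable \<Omega>" for i
    unfolding \<Omega>_def using measurable_component_singleton[of i UNIV "\<lambda>i::'n. action_angle_measure"]
      measurable_cong_sets[OF refl sets_action_angle_measure, of "\<Pi>\<^sub>M i\<in>(UNIV :: 'n set). action_angle_measure"] by simp
  have c2[measurable]: "(\<lambda>\<omega>. fst (\<omega> i)) \<in> borel_measurable \<Omega>" "(\<lambda>\<omega>. snd (\<omega> i)) \<in> borel_measurable \<Omega>" for i
    using measurable_compose[OF c[of i] fst_snd_borel(1)] measurable_compose[OF c[of i] fst_snd_borel(2)] by simp_all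
  have \<Phi>2[measurable]: "(\<lambda>(s, \<omega>). \<Phi> s \<omega>) \<in> borel_measurable (lborel \<Otimes>\<^sub>M \<Omega>)"
    unfolding \<Phi>_def pair_of_vecs_def orbit_point_def split_beta borel_prod[symmetric] fst_conv snd_conv
    by (intro measurable_Pair borel_measurable_vec_lambda) measurable
  have \<Phi>1[measurable]: "\<Phi> s \<in> borel_measurable \<Omega>" for s
    using measurable_Pair2[OF \<Phi>2, of s] by simp
  have d: "distr \<Omega> borel (\<Phi> s) = gibbs_measure p q" if "s \<in> {0..2}" for s
    using distr_orbits_gibbs[OF pq, of s] that by (simp add: \<Omega>_def \<Phi>_def[abs_def])
  define B where "B = {z :: (real ^ 'n) \<times> (real ^ 'n). n \<bullet> fst z \<le> - \<delta>}"
  have [measurable]: "B \<in> sets borel" unfolding B_def by measurable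
  have sg[simp]: "sets (gibbs_measure p q) = sets borel" by (simp add: gibbs_measure_def)
  have hg[measurable]: "h \<in> borel_measurable (gibbs_measure p q)"
    using h by (simp add: measurable_cong_sets[OF sg refl])
  have "emeasure (gibbs_measure p q) B = (\<integral>\<^sup>+z. indicator B z \<partial>distr \<Omega> borel (\<Phi> 0))"
    by (simp add: d)
  also have "\<dots> = (\<integral>\<^sup>+\<omega>. indicator B (\<Phi> 0 \<omega>) \<partial>\<Omega>)" by (rule nn_integral_distr) auto
  also have "\<dots> \<le> (\<integral>\<^sup>+\<omega>. ?I \<omega> \<partial>\<Omega>)"
  proof (rule nn_integral_mono_AE)
    show "AE \<omega> in \<Omega>. indicator B (\<Phi> 0 \<omega>) \<le> ?I \<omega>"
      using AE_PiM_action_angle[where 'n='n] unfolding \<Omega>_def[symmetric]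
    proof eventually_elim
      case \<omega>: (elim \<omega>)
      let ?l = "n \<bullet> fst (\<Phi> 0 \<omega>)"
      have "indicator B (\<Phi> 0 \<omega>) \<le> ennreal (G (- ?l) - G ?l)"
      proof (cases "\<Phi> 0 \<omega> \<in> B")
        case True
        then have "1 \<le> G (- ?l) - G ?l" by (intro Gd) (simp add: B_def)
        then have "ennreal 1 \<le> ennreal (G (- ?l) - G ?l)" by (rule ennreal_leI)
        then show ?thesis using True by simp
      qed simp
      also have "\<dots> \<le> ?I \<omega>"
        unfolding h_def \<Phi>_def by (rule orbit_crossing[OF pq G g g0]) (use \<omega> in auto)
      finally show ?case .
    qed
  qed
  also have "\<dots> = (\<integral>\<^sup>+s. (\<integral>\<^sup>+\<omega>. h (\<Phi> s \<omega>) * indicator {0..2} s \<partial>\<Omega>) \<partial>lborel)"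
    by (rule P.Fubini') measurable
  also have "\<dots> = (\<integral>\<^sup>+s. (\<integral>\<^sup>+z. h z \<partial>gibbs_measure p q) * indicator {0..2::real} s \<partial>lborel)"
  proof (rule nn_integral_cong)
    fix s :: real
    have "(\<integral>\<^sup>+\<omega>. h (\<Phi> s \<omega>) \<partial>\<Omega>) = (\<integral>\<^sup>+z. h z \<partial>gibbs_measure p q)" if "s \<in> {0..2}"
      using d[OF that] by (subst d[OF that, symmetric], subst nn_integral_distr) auto
    then show "(\<integral>\<^sup>+\<omega>. h (\<Phi> s \<omega>) * indicator {0..2} s \<partial>\<Omega>) = (\<integral>\<^sup>+z. h z \<partial>gibbs_measure p q) * indicator {0..2} s"
      by (cases "s \<in> {0..2}") auto
  qed
  also have "\<dots> = 2 * (\<integral>\<^sup>+z. h z \<partial>gibbs_measure p q)"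
    by (simp add: nn_integral_cmult_indicator mult.commute)
  finally show ?thesis by (simp add: B_def h_def)
qed

section \<open>Sections and projections of the unit balls\<close>

definition power_sum :: "real \<Rightarrow> real ^ 'n \<Rightarrow> real" where
  "power_sum p x = (\<Sum>i\<in>UNIV. \<bar>x $ i\<bar> powr p)"

lemma lp_ball_power_sum: "lp_ball p = {x. power_sum p x \<le> 1}"
  by (simp add: lp_ball_def power_sum_def)

lemma continuous_on_power_sum: "0 < p \<Longrightarrow> continuous_on S (power_sum p)"
  unfolding power_sum_def by (intro continuous_on_sum continuous_on_powr' continuous_intros) auto

lemma power_sum_scaleR: "power_sum p (r *\<^sub>R x) = \<bar>r\<bar> powr p * power_sum p x"
  by (simp add: power_sum_def abs_mult powr_mult sum_distrib_left)

lemma power_sum_nonneg: "0 \<le> power_sum p x"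
  unfolding power_sum_def by (intro sum_nonneg) simp

lemma lp_ball_scaleR_iff:
  assumes "0 < r" "0 < p"
  shows "(1/r) *\<^sub>R x \<in> lp_ball p \<longleftrightarrow> power_sum p x \<le> r powr p"
  using assms by (simp add: lp_ball_power_sum power_sum_scaleR powr_divide field_simps)

lemma lp_ball_coordinate:
  assumes "0 < p" "x \<in> lp_ball p"
  shows "\<bar>x $ i\<bar> \<le> 1"
proof -
  have "\<bar>x $ i\<bar> powr p \<le> power_sum p x" unfolding power_sum_def by (rule member_le_sum) auto
  then have "\<bar>x $ i\<bar> powr p \<le> 1 powr p" using assms by (simp add: lp_ball_power_sum)
  then show ?thesis using assms(1) by (metis abs_ge_zero less_le_not_le linorder_linear powr_less_mono2 zero_le_one)
qed

lemma compact_lp_ball: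
  assumes "0 < p"
  shows "compact (lp_ball p :: (real ^ 'n) set)"
proof -
  have "closed (lp_ball p :: (real ^ 'n) set)" unfolding lp_ball_power_sum
    using continuous_on_power_sum[OF assms] by (intro closed_Collect_le continuous_intros) auto
  moreover have "bounded (lp_ball p :: (real ^ 'n) set)"
  proof (rule bounded_subset[OF bounded_cbox])
    show "lp_ball p \<subseteq> cbox (\<chi> i. -1) ((\<chi> i. 1) :: real ^ 'n)"
      using lp_ball_coordinate[OF assms] by (force simp: mem_box_cart abs_le_iff)
  qed
  ultimately show ?thesis by (simp add: compact_eq_bounded_closed)
qed

lemma abs_powr_convex:
  fixes a b u v p :: real
  assumes p: "1 \<le> p" and uv: "0 \<le> u" "0 \<le> v" "u + v = 1"
  shows "\<bar>u * a + v * b\<bar> powr p \<le> u * \<bar>a\<bar> powr p + v * \<bar>b\<bar> powr p"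
proof -
  have small: "(w * c) powr p \<le> w * c powr p" if "0 \<le> w" "w \<le> 1" "0 \<le> c" for w c :: real
  proof -
    have "w powr p \<le> w" using that p
      by (cases "w = 0") (auto intro: order_trans[OF powr_mono'[of 1 p w]])
    then have "w powr p * c powr p \<le> w * c powr p" by (intro mult_right_mono) auto
    then show ?thesis using that by (simp add: powr_mult)
  qed
  have "\<bar>u * a + v * b\<bar> powr p \<le> (u * \<bar>a\<bar> + v * \<bar>b\<bar>) powr p"
    using uv p by (intro powr_mono2) (auto intro: order_trans[OF abs_triangle_ineq] simp: abs_mult)
  also have "\<dots> \<le> u * \<bar>a\<bar> powr p + v * \<bar>b\<bar> powr p"
  proof (cases "a = 0 \<or> b = 0")
    case True
    then show ?thesis using small[of u "\<bar>a\<bar>"] small[of v "\<bar>b\<bar>"] uv by auto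
  next
    case False
    have u: "u = 1 - v" "v \<le> 1" using uv by auto
    show ?thesis using convex_onD[OF powr_convex[OF p], of v "\<bar>a\<bar>" "\<bar>b\<bar>"] False uv(2) u(2)
      unfolding u(1) by simp
  qed
  finally show ?thesis .
qed

lemma convex_lp_ball:
  assumes p: "1 \<le> p"
  shows "convex (lp_ball p :: (real ^ 'n) set)"
proof (rule convexI)
  fix x y :: "real ^ 'n" and u v :: real
  assume x: "x \<in> lp_ball p" "y \<in> lp_ball p" and uv: "0 \<le> u" "0 \<le> v" "u + v = 1"
  have "power_sum p (u *\<^sub>R x + v *\<^sub>R y) \<le> (\<Sum>i\<in>UNIV. u * \<bar>x $ i\<bar> powr p + v * \<bar>y $ i\<bar> powr p)"
    unfolding power_sum_def using abs_powr_convex[OF p uv] by (intro sum_mono) simp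
  also have "\<dots> = u * power_sum p x + v * power_sum p y" by (simp add: power_sum_def sum.distrib sum_distrib_left)
  also have "\<dots> \<le> u * 1 + v * 1" using x uv by (intro add_mono mult_left_mono) (auto simp: lp_ball_power_sum)
  finally show "u *\<^sub>R x + v *\<^sub>R y \<in> lp_ball p" using uv by (simp add: lp_ball_power_sum)
qed

text \<open>If \<open>x\<close> lies in \<open>r B\<close> close to the hyperplane, then its projection lies in a slightly larger multiple of \<open>B\<close>: by
  convexity \<open>r B + \<epsilon> B\<close> is contained in \<open>(r + \<epsilon>) B\<close>, and \<open>u n\<close> lies in \<open>N \<delta> B\<close> because the coordinates of \<open>n\<close> are bounded by 1.\<close>

lemma lp_ball_fat_projection:
  fixes n x :: "real ^ 'n" and \<delta> :: real
  assumes p: "1 \<le> p" and n: "norm n = 1" and r: "0 < r" and \<delta>: "0 < \<delta>"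
    and x: "power_sum p x \<le> r powr p" and u: "\<bar>u\<bar> \<le> \<delta>"
  shows "(1 / (r + real CARD('n) * \<delta>)) *\<^sub>R (x - u *\<^sub>R n) \<in> lp_ball p"
proof -
  define N where "N = real CARD('n)"
  have N: "1 \<le> N" unfolding N_def by (simp add: Suc_leI)
  define e where "e = N * \<delta>"
  have e: "0 < e" using N \<delta> by (simp add: e_def)
  have "\<bar>((- u / e) *\<^sub>R n) $ i\<bar> powr p \<le> 1 / N" for i
  proof -
    have "\<bar>u\<bar> * \<bar>n $ i\<bar> \<le> \<delta> * 1"
      using u component_le_norm_cart[of n i] n \<delta> by (intro mult_mono) auto
    then have "\<bar>((- u / e) *\<^sub>R n) $ i\<bar> \<le> \<delta> / e" using e by (simp add: abs_mult divide_right_mono)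
    also have "\<delta> / e = 1 / N" using \<delta> by (simp add: e_def)
    finally have "\<bar>((- u / e) *\<^sub>R n) $ i\<bar> powr p \<le> (1 / N) powr p" using p by (intro powr_mono2) auto
    also have "\<dots> \<le> (1 / N) powr 1" using N p by (intro powr_mono') auto
    finally show ?thesis using N by simp
  qed
  then have "power_sum p ((- u / e) *\<^sub>R n) \<le> (\<Sum>i\<in>(UNIV::'n set). 1 / N)"
    unfolding power_sum_def by (intro sum_mono)
  also have "\<dots> = 1" using N by (simp add: N_def)
  finally have 1: "(- u / e) *\<^sub>R n \<in> lp_ball p" by (simp add: lp_ball_power_sum)
  have 2: "(1 / r) *\<^sub>R x \<in> lp_ball p" using lp_ball_scaleR_iff[OF r, of p x] p x by simp
  have "(r / (r + e)) *\<^sub>R ((1 / r) *\<^sub>R x) + (e / (r + e)) *\<^sub>R ((- u / e) *\<^sub>R n) \<in> lp_ball p"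
    using r e by (intro convexD[OF convex_lp_ball[OF p] 2 1]) (auto simp: add_divide_distrib[symmetric])
  also have "(r / (r + e)) *\<^sub>R ((1 / r) *\<^sub>R x) + (e / (r + e)) *\<^sub>R ((- u / e) *\<^sub>R n) = (1 / (r + e)) *\<^sub>R (x - u *\<^sub>R n)"
    using r e by (simp add: scaleR_diff_right)
  finally show ?thesis by (simp add: e_def N_def)
qed

lemma power_sum_le_energy: "power_sum p x \<le> energy p q x y" "power_sum q y \<le> energy p q x y"
  unfolding power_sum_def energy_def by (intro sum_mono; simp)+

lemma borel_section:
  fixes n :: "real ^ 'n"
  assumes "0 < p"
  shows "lp_ball p \<inter> hyperplane n \<in> sets borel"
    "flatten n ` lp_ball p \<in> sets borel"
proof -
  have c: "compact (lp_ball p :: (real ^ 'n) set)" by (rule compact_lp_ball[OF assms])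
  have "closed (hyperplane n)" by (rule closed_hyperplane)
  then have "compact (lp_ball p \<inter> hyperplane n)" using c by (rule compact_Int_closed[rotated])
  then show "lp_ball p \<inter> hyperplane n \<in> sets borel" by (rule borel_compact)
  have "compact (flatten n ` lp_ball p)"
    by (rule compact_continuous_image[OF _ c]) (intro continuous_intros)
  then show "flatten n ` lp_ball p \<in> sets borel" by (rule borel_compact)
qed

text \<open>The function \<open>g\<close> is a smeared Dirac mass, so the left-hand side is an average of the volumes of the sections of
  \<open>t\<^sup>1\<^sup>/\<^sup>p B\<close> by parallel hyperplanes at height at most \<open>\<delta>\<close>.\<close>

lemma nn_integral_fat_section:
  fixes n :: "real ^ 'n"
  assumes p: "1 \<le> p" and n: "norm n = 1" and t: "0 < t" and \<delta>: "0 < \<delta>"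
    and [measurable]: "g \<in> borel_measurable borel" and supp: "\<And>u. \<delta> < \<bar>u\<bar> \<Longrightarrow> g u = 0"
    and g1: "(\<integral>\<^sup>+u. ennreal (g u) \<partial>lborel) = 1"
  shows "(\<integral>\<^sup>+x. ennreal (g (n \<bullet> x)) * indicator {x. power_sum p x < t} x \<partial>lborel)
    \<le> ennreal ((t powr (1/p) + real CARD('n) * \<delta>) ^ (CARD('n) - 1)) *
       emeasure (hyperplane_lborel n) (lp_ball p \<inter> hyperplane n)"
proof -
  let ?K = "lp_ball p \<inter> hyperplane n"
  define R where "R = t powr (1/p) + real CARD('n) * \<delta>"
  have R: "0 < R" using t \<delta> by (auto simp: R_def intro: add_pos_nonneg)
  have K[measurable]: "?K \<in> sets borel" using p by (intro borel_section) auto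
  have nn: "n \<bullet> n = 1" using n by (simp add: norm_eq_1)
  have "(\<lambda>x. R *\<^sub>R x) ` ?K = (\<lambda>x. (1/R) *\<^sub>R x) -` ?K"
    using R by (auto simp: image_iff intro!: bexI[where x="(1/R) *\<^sub>R _"])
  then have im[measurable]: "(\<lambda>x. R *\<^sub>R x) ` ?K \<in> sets borel"
    using measurable_sets[of "\<lambda>x::real^'n. (1/R) *\<^sub>R x" borel borel ?K] by simp
  have "(\<integral>\<^sup>+x. ennreal (g (n \<bullet> x)) * indicator {x. power_sum p x < t} x \<partial>lborel)
    \<le> (\<integral>\<^sup>+x. ennreal (g (n \<bullet> x)) * indicator ((\<lambda>x. R *\<^sub>R x) ` ?K) (x - (n \<bullet> x) *\<^sub>R n) \<partial>lborel)"
  proof (rule nn_integral_mono)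
    fix x
    show "ennreal (g (n \<bullet> x)) * indicator {x. power_sum p x < t} x \<le> ennreal (g (n \<bullet> x)) * indicator ((\<lambda>x. R *\<^sub>R x) ` ?K) (x - (n \<bullet> x) *\<^sub>R n)"
    proof (cases "\<bar>n \<bullet> x\<bar> \<le> \<delta> \<and> power_sum p x < t")
      case True
      have "(t powr (1/p)) powr p = t" using t p by (simp add: powr_powr)
      then have "(1 / R) *\<^sub>R (x - (n \<bullet> x) *\<^sub>R n) \<in> lp_ball p" unfolding R_def
        using True t by (intro lp_ball_fat_projection[OF p n _ \<delta>]) auto
      moreover have "n \<bullet> ((1 / R) *\<^sub>R (x - (n \<bullet> x) *\<^sub>R n)) = 0" by (simp add: inner_diff_right nn)
      ultimately have "R *\<^sub>R ((1 / R) *\<^sub>R (x - (n \<bullet> x) *\<^sub>R n)) \<in> (\<lambda>x. R *\<^sub>R x) ` ?K" by blast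
      then have "x - (n \<bullet> x) *\<^sub>R n \<in> (\<lambda>x. R *\<^sub>R x) ` ?K" using R by simp
      then show ?thesis by (simp add: indicator_def)
    next
      case False
      then have "g (n \<bullet> x) = 0 \<or> \<not> power_sum p x < t" using supp[of "n \<bullet> x"] by auto
      then show ?thesis by auto
    qed
  qed
  also have "\<dots> = emeasure (hyperplane_lborel n) ((\<lambda>x. R *\<^sub>R x) ` ?K)"
    by (subst nn_integral_hyperplane_cylinder[OF n]) (auto simp: g1)
  also have "\<dots> = ennreal (R ^ (CARD('n) - 1)) * emeasure (hyperplane_lborel n) ?K"
    using emeasure_subspace_scaleR[OF n K R] by simp
  finally show ?thesis by (simp add: R_def)
qed

lemma emeasure_scaled_projection:
  fixes n :: "real ^ 'n"
  assumes q: "1 \<le> q" and n: "norm n = 1" and t: "0 < t"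
  shows "emeasure (hyperplane_lborel n) {w. \<exists>s. power_sum q (w + s *\<^sub>R n) < t}
     \<le> ennreal ((t powr (1/q)) ^ (CARD('n) - 1)) *
       emeasure (hyperplane_lborel n) (flatten n ` lp_ball q)"
proof -
  let ?M = "hyperplane_lborel n"
  let ?L = "flatten n ` lp_ball q"
  define R where "R = t powr (1/q)"
  have R: "0 < R" "R powr q = t" using t q by (auto simp: R_def powr_powr)
  have nn: "n \<bullet> n = 1" using n by (simp add: norm_eq_1)
  have L[measurable]: "?L \<in> sets borel" using q by (intro borel_section) auto
  have "(\<lambda>x. R *\<^sub>R x) ` ?L = (\<lambda>x. (1/R) *\<^sub>R x) -` ?L"
  proof (intro set_eqI iffI)
    fix x assume "x \<in> (\<lambda>x. (1/R) *\<^sub>R x) -` ?L"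
    then have "R *\<^sub>R ((1/R) *\<^sub>R x) \<in> (\<lambda>x. R *\<^sub>R x) ` ?L" by blast
    then show "x \<in> (\<lambda>x. R *\<^sub>R x) ` ?L" using R by simp
  qed (use R in auto)
  then have im[measurable]: "(\<lambda>x. R *\<^sub>R x) ` ?L \<in> sets borel"
    using measurable_sets[of "\<lambda>x::real^'n. (1/R) *\<^sub>R x" borel borel ?L] by simp
  have "emeasure ?M {w. \<exists>s. power_sum q (w + s *\<^sub>R n) < t} \<le> emeasure ?M ((\<lambda>x. R *\<^sub>R x) ` ?L)"
  proof (rule emeasure_mono_AE)
    show "AE w in ?M. w \<in> {w. \<exists>s. power_sum q (w + s *\<^sub>R n) < t} \<longrightarrow> w \<in> (\<lambda>x. R *\<^sub>R x) ` ?L"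
      using AE_subspace_lborel_hyperplane[OF n]
    proof eventually_elim
      case w: (elim w)
      show ?case
      proof
        assume "w \<in> {w. \<exists>s. power_sum q (w + s *\<^sub>R n) < t}"
        then obtain s where "power_sum q (w + s *\<^sub>R n) < t" by auto
        then have "power_sum q (w + s *\<^sub>R n) \<le> t" by simp
        then have b: "(1/R) *\<^sub>R (w + s *\<^sub>R n) \<in> lp_ball q"
          by (intro lp_ball_scaleR_iff[THEN iffD2]) (use R q in auto)
        have "w = R *\<^sub>R ((1/R) *\<^sub>R (w + s *\<^sub>R n) - (n \<bullet> ((1/R) *\<^sub>R (w + s *\<^sub>R n))) *\<^sub>R n)"
          using R by (simp add: inner_add_right w nn scaleR_diff_right scaleR_add_right)
        then show "w \<in> (\<lambda>x. R *\<^sub>R x) ` ?L" using b by blast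
      qed
    qed
  qed simp
  also have "\<dots> = ennreal (R ^ (CARD('n) - 1)) * emeasure ?M ?L"
    using emeasure_subspace_scaleR[OF n L R(1)] by simp
  finally show ?thesis by (simp add: R_def)
qed

section \<open>The upper bound for the flux\<close>

text \<open>The upper bound for the flux. Integrate over the lines parallel to \<open>n\<close> first, apply \<open>nn_integral_fiber_ascent\<close> on
  each of them, and note that energy below \<open>t\<close> forces both \<open>\<Sum>i. \<bar>x\<^sub>i\<bar>\<^sup>p < t\<close> and \<open>\<Sum>i. \<bar>y\<^sub>i\<bar>\<^sup>q < t\<close>.
  For fixed \<open>t\<close> the two conditions separate the variables.\<close>

lemma gibbs_ascent_le:
  fixes n :: "real ^ 'n" and g :: "real \<Rightarrow> real"
  assumes pq: "1 < p" "1 < q" and n: "norm n = 1" and [measurable]: "g \<in> borel_measurable borel" and g0: "\<And>u. 0 \<le> g u"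
  shows "(\<integral>\<^sup>+z. crossing_rate p q n g z \<partial>gibbs_measure p q)
    \<le> (\<integral>\<^sup>+t. ennreal (exp (- t)) * (\<integral>\<^sup>+x. ennreal (g (n \<bullet> x)) * indicator {x. power_sum p x < t} x \<partial>lborel)
         * emeasure (hyperplane_lborel n) {w. \<exists>s. power_sum q (w + s *\<^sub>R n) < t} \<partial>lborel)"
proof -
  let ?A = "\<lambda>x. \<integral>\<^sup>+y. ennreal (max 0 (ascent p q n x y) * exp (- energy p q x y)) \<partial>lborel"
  define M where "M = hyperplane_lborel n"
  interpret M: sigma_finite_measure M unfolding M_def by (rule sigma_finite_subspace_lborel[OF n])
  interpret P: pair_sigma_finite M "lborel :: real measure" ..
  have sM[simp, measurable_cong]: "sets M = sets borel" by (simp add: M_def)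
  define L where "L t = {w. \<exists>s. power_sum q (w + s *\<^sub>R n) < t}" for t
  define A where "A = {z::(real^'n) \<times> real. fst z \<in> L (snd z)}"
  have "open {z::(real^'n) \<times> real. power_sum q (fst z + s *\<^sub>R n) < snd z}" for s
    using pq by (intro open_Collect_less continuous_on_compose2[OF continuous_on_power_sum[of q UNIV]] continuous_intros) auto
  then have "open (\<Union>s. {z::(real^'n) \<times> real. power_sum q (fst z + s *\<^sub>R n) < snd z})" by blast
  also have "(\<Union>s. {z::(real^'n) \<times> real. power_sum q (fst z + s *\<^sub>R n) < snd z}) = A"
    by (auto simp: A_def L_def)
  finally have Ab: "A \<in> sets borel" by simp
  have Lm[measurable (raw)]: "(\<lambda>x. indicator (L (b x)) (a x) :: ennreal) \<in> borel_measurable N"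
    if "a \<in> borel_measurable N" "b \<in> borel_measurable N" for a b and N :: "'x measure"
  proof -
    have "(\<lambda>x. (a x, b x)) \<in> borel_measurable N"
      unfolding borel_prod[symmetric] using that by (rule measurable_Pair)
    then have "(\<lambda>x. indicator A (a x, b x) :: ennreal) \<in> borel_measurable N"
      using Ab by (rule measurable_compose[OF _ borel_measurable_indicator])
    then show ?thesis by (simp add: A_def indicator_def)
  qed
  have Ls[measurable]: "L t \<in> sets borel" for t
  proof -
    have "open {w. power_sum q (w + s *\<^sub>R n) < t}" for s
      using pq by (intro open_Collect_less continuous_on_compose2[OF continuous_on_power_sum[of q UNIV]] continuous_intros) auto
    then have "open (\<Union>s. {w. power_sum q (w + s *\<^sub>R n) < t})" by blast
    also have "(\<Union>s. {w. power_sum q (w + s *\<^sub>R n) < t}) = L t" by (auto simp: L_def)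
    finally show ?thesis by simp
  qed
  have ps[measurable (raw)]: "(\<lambda>x. power_sum p (a x)) \<in> borel_measurable N"
    if [measurable]: "a \<in> borel_measurable N" for a :: "'x \<Rightarrow> real^'n" and N
    unfolding power_sum_def by measurable
  have mL[measurable]: "(\<lambda>t. emeasure M (L t)) \<in> borel_measurable borel"
  proof -
    have "(\<lambda>t. \<integral>\<^sup>+w. indicator (L t) w \<partial>M) \<in> borel_measurable borel" by measurable
    then show ?thesis by simp
  qed
  have inner: "?A x
     \<le> (\<integral>\<^sup>+t. ennreal (exp (- t)) * indicator {x. power_sum p x < t} x * emeasure M (L t) \<partial>lborel)" for x
  proof -
    have "?A x
      = (\<integral>\<^sup>+w. (\<integral>\<^sup>+s. ennreal (max 0 (ascent p q n x (w + s *\<^sub>R n)) * exp (- energy p q x (w + s *\<^sub>R n))) \<partial>lborel) \<partial>M)"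
      unfolding M_def by (rule nn_integral_hyperplane(1)[OF n]) measurable
    also have "\<dots> \<le> (\<integral>\<^sup>+w. (\<integral>\<^sup>+t. ennreal (exp (- t)) * indicator {t. \<exists>s. energy p q x (w + s *\<^sub>R n) < t} t \<partial>lborel) \<partial>M)"
      by (intro nn_integral_mono nn_integral_fiber_ascent pq)
    also have "\<dots> \<le> (\<integral>\<^sup>+w. (\<integral>\<^sup>+t. ennreal (exp (- t)) * indicator {x. power_sum p x < t} x * indicator (L t) w \<partial>lborel) \<partial>M)"
    proof (intro nn_integral_mono)
      fix w t
      have "power_sum p x < t \<and> w \<in> L t" if "energy p q x (w + s *\<^sub>R n) < t" for s
        using that order.strict_trans1[OF power_sum_le_energy(1) that] order.strict_trans1[OF power_sum_le_energy(2) that]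
        by (auto simp: L_def)
      then show "ennreal (exp (- t)) * indicator {t. \<exists>s. energy p q x (w + s *\<^sub>R n) < t} t
        \<le> ennreal (exp (- t)) * indicator {x. power_sum p x < t} x * indicator (L t) w"
        by (auto simp: indicator_def)
    qed
    also have "\<dots> = (\<integral>\<^sup>+t. (\<integral>\<^sup>+w. ennreal (exp (- t)) * indicator {x. power_sum p x < t} x * indicator (L t) w \<partial>M) \<partial>lborel)"
      unfolding indicator_def[of "{x. power_sum p x < _}"] mem_Collect_eq
      by (rule P.Fubini'[symmetric]) measurable
    also have "\<dots> = (\<integral>\<^sup>+t. ennreal (exp (- t)) * indicator {x. power_sum p x < t} x * emeasure M (L t) \<partial>lborel)"
      by (intro nn_integral_cong) (simp add: nn_integral_cmult_indicator)
    finally show ?thesis .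
  qed
  define h where "h z = crossing_rate p q n g z * ennreal (exp (- energy p q (fst z) (snd z)))" for z
  have "(\<integral>\<^sup>+z. crossing_rate p q n g z \<partial>gibbs_measure p q) = (\<integral>\<^sup>+z. h z \<partial>lborel)"
    unfolding gibbs_measure_def h_def by (subst nn_integral_density) (auto simp: mult.commute)
  also have "\<dots> = (\<integral>\<^sup>+z. h z \<partial>(lborel \<Otimes>\<^sub>M lborel))" by (simp add: lborel_prod)
  also have "\<dots> = (\<integral>\<^sup>+x. (\<integral>\<^sup>+y. h (x, y) \<partial>lborel) \<partial>lborel)"
    by (rule lborel.nn_integral_fst[symmetric]) (simp add: h_def, measurable)
  also have "\<dots> = (\<integral>\<^sup>+x. ennreal (g (n \<bullet> x)) * ?A x \<partial>lborel)"
    using g0 by (subst nn_integral_cmult[symmetric], measurable)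
      (auto simp: h_def ennreal_mult mult.assoc intro!: nn_integral_cong)
  also have "\<dots> \<le> (\<integral>\<^sup>+x. ennreal (g (n \<bullet> x)) * (\<integral>\<^sup>+t. ennreal (exp (- t)) * indicator {x. power_sum p x < t} x * emeasure M (L t) \<partial>lborel) \<partial>lborel)"
    by (intro nn_integral_mono mult_left_mono inner) auto
  also have "\<dots> = (\<integral>\<^sup>+x. (\<integral>\<^sup>+t. ennreal (g (n \<bullet> x)) * (ennreal (exp (- t)) * indicator {x. power_sum p x < t} x * emeasure M (L t)) \<partial>lborel) \<partial>lborel)"
    unfolding indicator_def[of "{x. power_sum p x < _}"] mem_Collect_eq
    by (subst nn_integral_cmult) measurable
  also have "\<dots> = (\<integral>\<^sup>+t. (\<integral>\<^sup>+x. ennreal (g (n \<bullet> x)) * (ennreal (exp (- t)) * indicator {x. power_sum p x < t} x * emeasure M (L t)) \<partial>lborel) \<partial>lborel)"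
    unfolding indicator_def[of "{x. power_sum p x < _}"] mem_Collect_eq
    by (rule lborel_pair.Fubini'[symmetric]) measurable
  also have "\<dots> = (\<integral>\<^sup>+t. (\<integral>\<^sup>+x. (ennreal (g (n \<bullet> x)) * indicator {x. power_sum p x < t} x) * (ennreal (exp (- t)) * emeasure M (L t)) \<partial>lborel) \<partial>lborel)"
    by (simp only: mult_ac)
  also have "\<dots> = (\<integral>\<^sup>+t. (\<integral>\<^sup>+x. ennreal (g (n \<bullet> x)) * indicator {x. power_sum p x < t} x \<partial>lborel) * (ennreal (exp (- t)) * emeasure M (L t)) \<partial>lborel)"
    by (subst nn_integral_multc) measurable
  finally show ?thesis by (simp only: M_def L_def mult_ac)
qed

lemma nn_integral_exp_power:
  "(\<integral>\<^sup>+t. ennreal (exp (- t) * t ^ m) * indicator {0..} t \<partial>lborel) = ennreal (fact m)"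
proof -
  have "((\<lambda>t. t powr (real (Suc m) - 1) / exp t) has_integral Gamma (real (Suc m))) {0..}"
    by (rule Gamma_integral_real) simp
  then have I: "((\<lambda>t. t powr real m / exp t) has_integral fact m) {0..}"
    using Gamma_fact[of m, where 'a=real] by (simp add: add.commute)
  have "(\<integral>\<^sup>+t. ennreal (exp (- t) * t ^ m) * indicator {0..} t \<partial>lborel) = (\<integral>\<^sup>+t. ennreal (t powr real m / exp t) * indicator {0..} t \<partial>lborel)"
  proof (rule nn_integral_cong_AE)
    have "AE t in lborel. t \<noteq> (0::real)" by (rule AE_lborel_singleton)
    then show "AE t in lborel. ennreal (exp (- t) * t ^ m) * indicator {0..} t = ennreal (t powr real m / exp t) * indicator {0..} t"
      by eventually_elim (auto simp: indicator_def powr_realpow exp_minus field_simps)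
  qed
  also have "\<dots> = ennreal (fact m)" by (rule nn_integral_has_integral_lebesgue'[OF _ I]) auto
  finally show ?thesis by simp
qed

text \<open>From \<open>t\<^sup>1\<^sup>/\<^sup>q \<le> 1 + t\<close> one gets
  \<open>(t\<^sup>1\<^sup>/\<^sup>p + \<eta>) t\<^sup>1\<^sup>/\<^sup>q \<le> (1 + \<eta>) (t + \<eta>)\<close>, and then a shift by \<open>\<eta>\<close> leads to the Gamma integral.
  The bound is explicit in \<open>\<eta>\<close>, so its limit as \<open>\<eta>\<close> tends to 0 is immediate.\<close>

lemma nn_integral_perturbed_gamma:
  fixes \<eta> :: real
  assumes pq: "1 < p" "1 < q" "1/p + 1/q = 1" and \<eta>: "0 \<le> \<eta>"
  shows "(\<integral>\<^sup>+t. ennreal (exp (- t) * (t powr (1/p) + \<eta>) ^ m * (t powr (1/q)) ^ m) * indicator {0<..} t \<partial>lborel)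
     \<le> ennreal ((1 + \<eta>) ^ m * exp \<eta> * fact m)"
proof -
  have "(\<integral>\<^sup>+t. ennreal (exp (- t) * (t powr (1/p) + \<eta>) ^ m * (t powr (1/q)) ^ m) * indicator {0<..} t \<partial>lborel)
     \<le> (\<integral>\<^sup>+t. ennreal ((1 + \<eta>) ^ m * exp \<eta>) * (ennreal (exp (- (t + \<eta>)) * (t + \<eta>) ^ m) * indicator {0..} (t + \<eta>)) \<partial>lborel)"
  proof (rule nn_integral_mono)
    fix t :: real
    show "ennreal (exp (- t) * (t powr (1/p) + \<eta>) ^ m * (t powr (1/q)) ^ m) * indicator {0<..} t
      \<le> ennreal ((1 + \<eta>) ^ m * exp \<eta>) * (ennreal (exp (- (t + \<eta>)) * (t + \<eta>) ^ m) * indicator {0..} (t + \<eta>))"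
    proof (cases "0 < t")
      case True
      have "t powr (1/q) \<le> 1 + t"
      proof (cases "t \<le> 1")
        case True
        then have "t powr (1/q) \<le> 1 powr (1/q)" using \<open>0 < t\<close> pq by (intro powr_mono2) auto
        then show ?thesis using \<open>0 < t\<close> by simp
      next
        case False
        then have "t powr (1/q) \<le> t powr 1" using pq by (intro powr_mono) auto
        then show ?thesis using \<open>0 < t\<close> by simp
      qed
      moreover have "t powr (1/p) * t powr (1/q) = t" using True pq(3) by (simp add: powr_add[symmetric])
      ultimately have "(t powr (1/p) + \<eta>) * t powr (1/q) \<le> t + \<eta> * (1 + t)"
        using \<eta> by (simp add: distrib_right mult_left_mono)
      also have "\<dots> \<le> (1 + \<eta>) * (t + \<eta>)" using \<eta> True by (simp add: algebra_simps)
      finally have "((t powr (1/p) + \<eta>) * t powr (1/q)) ^ m \<le> ((1 + \<eta>) * (t + \<eta>)) ^ m"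
        using \<eta> by (intro power_mono) auto
      then have "exp (- t) * ((t powr (1/p) + \<eta>) ^ m * (t powr (1/q)) ^ m) \<le> exp (- t) * ((1 + \<eta>) ^ m * (t + \<eta>) ^ m)"
        by (intro mult_left_mono) (auto simp: power_mult_distrib)
      also have "\<dots> = ((1 + \<eta>) ^ m * exp \<eta>) * (exp (- (t + \<eta>)) * (t + \<eta>) ^ m)"
      proof -
        have e: "exp (- t) = exp \<eta> * exp (- (t + \<eta>))" by (simp add: exp_add[symmetric])
        show ?thesis unfolding e by (simp only: mult_ac)
      qed
      finally have "ennreal (exp (- t) * (t powr (1/p) + \<eta>) ^ m * (t powr (1/q)) ^ m) \<le> ennreal (((1 + \<eta>) ^ m * exp \<eta>) * (exp (- (t + \<eta>)) * (t + \<eta>) ^ m))"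
        by (intro ennreal_leI) (simp only: mult.assoc)
      also have "\<dots> = ennreal ((1 + \<eta>) ^ m * exp \<eta>) * ennreal (exp (- (t + \<eta>)) * (t + \<eta>) ^ m)"
        using \<eta> True by (intro ennreal_mult) auto
      finally show ?thesis using True \<eta> by (simp add: indicator_def)
    qed simp
  qed
  also have "\<dots> = ennreal ((1 + \<eta>) ^ m * exp \<eta>) * (\<integral>\<^sup>+t. ennreal (exp (- (t + \<eta>)) * (t + \<eta>) ^ m) * indicator {0..} (t + \<eta>) \<partial>lborel)"
    by (rule nn_integral_cmult) measurable
  also have "(\<integral>\<^sup>+t. ennreal (exp (- (t + \<eta>)) * (t + \<eta>) ^ m) * indicator {0..} (t + \<eta>) \<partial>lborel) = (\<integral>\<^sup>+t. ennreal (exp (- t) * t ^ m) * indicator {0..} t \<partial>lborel)"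
    using nn_integral_translate_real[of "\<lambda>t. ennreal (exp (- t) * t ^ m) * indicator {0..} t" \<eta>] by simp
  also have "\<dots> = ennreal (fact m)" by (rule nn_integral_exp_power)
  also have "ennreal ((1 + \<eta>) ^ m * exp \<eta>) * ennreal (fact m) = ennreal ((1 + \<eta>) ^ m * exp \<eta> * fact m)"
    using \<eta> by (subst ennreal_mult) auto
  finally show ?thesis .
qed

definition bump :: "real \<Rightarrow> real" where
  "bump v = max 0 (1 - \<bar>v\<bar>)"

text \<open>A continuously differentiable antiderivative of the triangular bump, written with
  squares of positive parts so that it has one formula on the whole line.\<close>

definition bump_integral :: "real \<Rightarrow> real" where
  "bump_integral v = (max 0 (v + 1))\<^sup>2 / 2 - (max 0 v)\<^sup>2 + (max 0 (v - 1))\<^sup>2 / 2"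

lemma has_real_derivative_pos_square:
  "((\<lambda>u. (max 0 u)\<^sup>2) has_real_derivative 2 * max 0 u) (at (u::real))"
proof -
  consider "u < 0" | "0 < u" | "u = 0" by linarith
  then show ?thesis
  proof cases
    case 1
    show ?thesis
      by (rule has_field_derivative_transform_within_open[of "\<lambda>u. 0" _ _ "{..<0}"]) (use 1 in auto)
  next
    case 2
    show ?thesis
      by (rule has_field_derivative_transform_within_open[of "\<lambda>u. u\<^sup>2" _ _ "{0<..}"])
         (use 2 in \<open>auto intro!: derivative_eq_intros\<close>)
  next
    case 3
    have "((\<lambda>h::real. (max 0 h)\<^sup>2 / h) \<longlongrightarrow> 0) (at 0)"
    proof (rule Lim_null_comparison)
      show "\<forall>\<^sub>F h in at 0. norm ((max 0 h)\<^sup>2 / h) \<le> \<bar>h::real\<bar>"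
        by (rule eventually_at_filter[THEN iffD2], rule always_eventually) (auto simp: max_def power2_eq_square)
      show "((\<lambda>h::real. \<bar>h\<bar>) \<longlongrightarrow> 0) (at 0)" by (rule tendsto_rabs_zero) (rule tendsto_ident_at)
    qed
    then show ?thesis using 3 by (simp add: DERIV_def)
  qed
qed

lemma bump_integral_deriv: "(bump_integral has_real_derivative bump v) (at v)"
proof -
  have s: "((\<lambda>v. (max 0 (v + a))\<^sup>2) has_real_derivative 2 * max 0 (v + a)) (at v)" for a :: real
    using DERIV_shift[of "\<lambda>u. (max 0 u)\<^sup>2" _ v a] has_real_derivative_pos_square[of "v + a"] by simp
  have "((\<lambda>v. (max 0 (v + 1))\<^sup>2 / 2 - (max 0 (v + 0))\<^sup>2 + (max 0 (v + (-1)))\<^sup>2 / 2) has_real_derivative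
      2 * max 0 (v + 1) / 2 - 2 * max 0 (v + 0) + 2 * max 0 (v + (-1)) / 2) (at v)"
    by (intro DERIV_add DERIV_diff DERIV_cdivide s)
  moreover have "2 * max 0 (v + 1) / 2 - 2 * max 0 (v + 0) + 2 * max 0 (v + (-1)) / 2 = bump v"
    by (auto simp: bump_def max_def)
  ultimately show ?thesis by (simp add: bump_integral_def[abs_def])
qed

lemma bump_integral_left: "v \<le> -1 \<Longrightarrow> bump_integral v = 0"
  by (simp add: bump_integral_def)

lemma bump_integral_right: "1 \<le> v \<Longrightarrow> bump_integral v = 1"
  by (simp add: bump_integral_def power2_eq_square field_simps)

lemma bump_measurable[measurable]: "bump \<in> borel_measurable borel"
  unfolding bump_def by measurable

lemma scaled_bump:
  assumes \<delta>: "0 < \<delta>"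
  defines "g \<equiv> \<lambda>u. bump (u / \<delta>) / \<delta>"
  shows "((\<lambda>u. bump_integral (u / \<delta>)) has_real_derivative g u) (at u)" "0 \<le> g u" "\<delta> < \<bar>u\<bar> \<Longrightarrow> g u = 0"
    "(\<integral>\<^sup>+u. ennreal (g u) \<partial>lborel) = 1"
proof -
  show d: "((\<lambda>u. bump_integral (u / \<delta>)) has_real_derivative g u) (at u)" for u
  proof -
    have "((\<lambda>u. u / \<delta>) has_real_derivative 1 / \<delta>) (at u)"
      by (rule DERIV_cdivide) (rule DERIV_ident)
    from DERIV_chain2[OF bump_integral_deriv this] show ?thesis by (simp add: g_def)
  qed
  show g0: "0 \<le> g u" for u using \<delta> by (simp add: g_def bump_def)
  show z: "\<delta> < \<bar>u\<bar> \<Longrightarrow> g u = 0" for u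
  proof -
    assume "\<delta> < \<bar>u\<bar>"
    then have "1 < \<bar>u / \<delta>\<bar>" using \<delta> by (simp add: field_simps)
    then show "g u = 0" by (simp add: g_def bump_def)
  qed
  have "(\<integral>\<^sup>+u. ennreal (g u) \<partial>lborel) = (\<integral>\<^sup>+u. ennreal (g u) * indicator {-\<delta>..\<delta>} u \<partial>lborel)"
    using z by (intro nn_integral_cong) (auto simp: indicator_def)
  also have "\<dots> = ennreal (bump_integral (\<delta> / \<delta>) - bump_integral (- \<delta> / \<delta>))"
    by (rule nn_integral_FTC_Icc) (use d g0 \<delta> in \<open>auto simp: g_def\<close>)
  finally show "(\<integral>\<^sup>+u. ennreal (g u) \<partial>lborel) = 1"
    using \<delta> by (simp add: bump_integral_left bump_integral_right)
qed

section \<open>The volume inequality for a section and a projection\<close>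

lemma emeasure_action_angle: "emeasure action_angle_measure UNIV = 4"
proof -
  have "emeasure action_angle_measure UNIV
     = (\<integral>\<^sup>+z. action_angle_density z \<partial>(lborel \<Otimes>\<^sub>M lborel :: (real \<times> real) measure))"
    unfolding action_angle_measure_def by (subst emeasure_density) (auto simp: lborel_prod)
  also have "\<dots> = (\<integral>\<^sup>+t. (\<integral>\<^sup>+\<theta>. ennreal (exp (- t)) * indicator {0<..} t * indicator {0..<4} \<theta> \<partial>(lborel :: real measure)) \<partial>(lborel :: real measure))"
    using action_angle_density_measurable
    by (subst lborel.nn_integral_fst[symmetric]) (auto simp: lborel_prod action_angle_density_def)
  also have "\<dots> = (\<integral>\<^sup>+t. (ennreal (exp (- t)) * indicator {0<..} t) * 4 \<partial>(lborel :: real measure))"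
    by (intro nn_integral_cong) (simp add: nn_integral_cmult_indicator)
  also have "\<dots> = 4" using nn_integral_exp_greaterThan[of 0] by (simp add: nn_integral_multc)
  finally show ?thesis .
qed

lemma emeasure_gibbs_UNIV:
  assumes pq: "1 < p" "1 < q" "1/p + 1/q = 1"
  shows "emeasure (gibbs_measure p q :: ((real ^ 'n) \<times> (real ^ 'n)) measure) UNIV = 4 ^ CARD('n)"
proof -
  let ?Q = "\<Pi>\<^sub>M i\<in>(UNIV :: 'n set). action_angle_measure"
  interpret product_sigma_finite "\<lambda>i::'n. action_angle_measure"
    using sigma_finite_action_angle by (simp add: product_sigma_finite_def)
  have sp: "space action_angle_measure = UNIV" by (simp add: action_angle_measure_def)
  have m: "(\<lambda>\<omega>. pair_of_vecs (\<lambda>i. orbit_point p q 0 (\<omega> i))) \<in> borel_measurable ?Q"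
  proof -
    have "(\<lambda>\<omega> i. orbit_point p q 0 (\<omega> i)) \<in> ?Q \<rightarrow>\<^sub>M (\<Pi>\<^sub>M i\<in>(UNIV :: 'n set). borel)"
      by (rule measurable_PiM_single') (auto simp: space_PiM, measurable)
    then show ?thesis by (rule measurable_compose) (rule pair_of_vecs_measurable, simp)
  qed
  have "emeasure (gibbs_measure p q :: ((real ^ 'n) \<times> (real ^ 'n)) measure) UNIV
    = emeasure ?Q (space ?Q)"
    using distr_orbits_gibbs[OF pq, of 0, where 'n='n, symmetric] m by (simp add: emeasure_distr)
  also have "\<dots> = emeasure ?Q (Pi\<^sub>E UNIV (\<lambda>_. UNIV))"
    by (simp add: space_PiM sp)
  also have "\<dots> = (\<Prod>i\<in>(UNIV :: 'n set). emeasure action_angle_measure UNIV)"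
    by (rule emeasure_PiM) auto
  finally show ?thesis by (simp add: emeasure_action_angle)
qed

lemma energy_minus: "energy p q (- x) (- y) = energy p q x y"
  by (simp add: energy_def)

text \<open>Symmetry under \<open>z \<mapsto> - z\<close>.\<close>

lemma emeasure_gibbs_halfspace:
  fixes n :: "real ^ 'n"
  assumes pq: "1 < p" "1 < q" "1/p + 1/q = 1" and n: "n \<noteq> 0"
  shows "2 * emeasure (gibbs_measure p q) {z. n \<bullet> fst z < 0} = 4 ^ CARD('n)"
proof -
  let ?M = "gibbs_measure p q"
  have sg[simp]: "sets ?M = sets borel" by (simp add: gibbs_measure_def)
  have ms[measurable]: "{z :: (real ^ 'n) \<times> (real ^ 'n). n \<bullet> fst z < 0} \<in> sets borel"
    "{z :: (real ^ 'n) \<times> (real ^ 'n). 0 < n \<bullet> fst z} \<in> sets borel"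
    "{z :: (real ^ 'n) \<times> (real ^ 'n). n \<bullet> fst z = 0} \<in> sets borel" by measurable
  have dm: "(\<lambda>z::(real ^ 'n) \<times> (real ^ 'n). ennreal (exp (- energy p q (fst z) (snd z)))) \<in> borel_measurable borel"
    by measurable
  have "orthogonal_transformation (uminus :: (real ^ 'n) \<times> (real ^ 'n) \<Rightarrow> _)"
    by (simp add: orthogonal_transformation_def linear_uminus)
  then have um: "distr lborel borel uminus = (lborel :: ((real ^ 'n) \<times> (real ^ 'n)) measure)"
    by (rule distr_lborel_orthogonal)
  have "emeasure ?M {z. 0 < n \<bullet> fst z} = (\<integral>\<^sup>+z. ennreal (exp (- energy p q (fst z) (snd z))) * indicator {z. 0 < n \<bullet> fst z} z \<partial>lborel)"
    unfolding gibbs_measure_def using dm by (subst emeasure_density) auto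
  also have "\<dots> = (\<integral>\<^sup>+z. ennreal (exp (- energy p q (fst z) (snd z))) * indicator {z. 0 < n \<bullet> fst z} z \<partial>distr lborel borel uminus)"
    by (simp only: um)
  also have "\<dots> = (\<integral>\<^sup>+z. ennreal (exp (- energy p q (fst (- z)) (snd (- z)))) * indicator {z. 0 < n \<bullet> fst z} (- z) \<partial>lborel)"
    by (rule nn_integral_distr) measurable
  also have "\<dots> = (\<integral>\<^sup>+z. ennreal (exp (- energy p q (fst z) (snd z))) * indicator {z. n \<bullet> fst z < 0} z \<partial>lborel)"
    by (intro nn_integral_cong) (simp add: energy_minus indicator_def)
  also have "\<dots> = emeasure ?M {z. n \<bullet> fst z < 0}"
    unfolding gibbs_measure_def using dm by (subst emeasure_density) auto
  finally have sym: "emeasure ?M {z. 0 < n \<bullet> fst z} = emeasure ?M {z. n \<bullet> fst z < 0}" .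
  have "{z :: (real ^ 'n) \<times> (real ^ 'n). n \<bullet> fst z = 0} = {z. (n, 0) \<bullet> z = 0}" by (auto simp: inner_prod_def)
  then have "negligible {z :: (real ^ 'n) \<times> (real ^ 'n). n \<bullet> fst z = 0}"
    using negligible_hyperplane[of "(n, 0 :: real ^ 'n)" 0] n by (simp add: zero_prod_def)
  then have null: "{z :: (real ^ 'n) \<times> (real ^ 'n). n \<bullet> fst z = 0} \<in> null_sets lborel"
    using ms(3) by (simp add: negligible_iff_null_sets null_sets_completion_iff)
  have zero: "emeasure ?M {z. n \<bullet> fst z = 0} = 0"
  proof -
    have "(\<integral>\<^sup>+z. ennreal (exp (- energy p q (fst z) (snd z))) * indicator {z. n \<bullet> fst z = 0} z \<partial>lborel) = (\<integral>\<^sup>+z. 0 \<partial>(lborel :: ((real ^ 'n) \<times> (real ^ 'n)) measure))"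
      using AE_not_in[OF null] by (intro nn_integral_cong_AE) (auto simp: indicator_def)
    then show ?thesis unfolding gibbs_measure_def using dm by (subst emeasure_density) auto
  qed
  have split: "(UNIV :: ((real ^ 'n) \<times> (real ^ 'n)) set) = ({z. n \<bullet> fst z < 0} \<union> {z. 0 < n \<bullet> fst z}) \<union> {z. n \<bullet> fst z = 0}"
    by (auto simp: not_less)
  have "4 ^ CARD('n) = emeasure ?M (({z. n \<bullet> fst z < 0} \<union> {z. 0 < n \<bullet> fst z}) \<union> {z. n \<bullet> fst z = 0})"
    unfolding split[symmetric] by (rule emeasure_gibbs_UNIV[OF pq, symmetric])
  also have "\<dots> = emeasure ?M ({z. n \<bullet> fst z < 0} \<union> {z. 0 < n \<bullet> fst z}) + emeasure ?M {z. n \<bullet> fst z = 0}"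
    by (rule plus_emeasure[symmetric]) auto
  also have "emeasure ?M ({z. n \<bullet> fst z < 0} \<union> {z. 0 < n \<bullet> fst z}) = emeasure ?M {z. n \<bullet> fst z < 0} + emeasure ?M {z. 0 < n \<bullet> fst z}"
    by (rule plus_emeasure[symmetric]) auto
  finally show ?thesis by (simp add: sym zero mult_2)
qed

lemma gibbs_halfspace_le:
  fixes n :: "real ^ 'n"
  assumes pq: "1 < p" "1 < q" "1/p + 1/q = 1" and n: "norm n = 1" and \<delta>: "0 < \<delta>"
  defines "M \<equiv> hyperplane_lborel n" and "m \<equiv> CARD('n) - 1"
  shows "emeasure (gibbs_measure p q) {z. n \<bullet> fst z \<le> - \<delta>} \<le>
     2 * (emeasure M (lp_ball p \<inter> hyperplane n) * emeasure M (flatten n ` lp_ball q))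
       * ennreal ((1 + real CARD('n) * \<delta>) ^ m * exp (real CARD('n) * \<delta>) * fact m)"
proof -
  define g where "g u = bump (u / \<delta>) / \<delta>" for u
  define \<eta> where "\<eta> = real CARD('n) * \<delta>"
  define VK where "VK = emeasure M (lp_ball p \<inter> hyperplane n)"
  define VL where "VL = emeasure M (flatten n ` lp_ball q)"
  note b = scaled_bump[OF \<delta>, folded g_def]
  have gm[measurable]: "g \<in> borel_measurable borel" unfolding g_def by measurable
  have \<eta>: "0 \<le> \<eta>" using \<delta> by (simp add: \<eta>_def)
  have "emeasure (gibbs_measure p q) {z. n \<bullet> fst z \<le> - \<delta>}
      \<le> 2 * (\<integral>\<^sup>+z. crossing_rate p q n g z \<partial>gibbs_measure p q)"
  proof (rule gibbs_crossing[OF pq b(1) gm b(2)])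
    fix u assume "u \<le> - \<delta>"
    then have "u / \<delta> \<le> -1" "1 \<le> - u / \<delta>" using \<delta> by (simp_all add: field_simps)
    then show "1 \<le> bump_integral (- u / \<delta>) - bump_integral (u / \<delta>)"
      by (simp add: bump_integral_left bump_integral_right)
  qed
  also have "\<dots> \<le> 2 * (\<integral>\<^sup>+t. ennreal (exp (- t)) * (\<integral>\<^sup>+x. ennreal (g (n \<bullet> x)) * indicator {x. power_sum p x < t} x \<partial>lborel)
         * emeasure M {w. \<exists>s. power_sum q (w + s *\<^sub>R n) < t} \<partial>lborel)"
    unfolding M_def by (intro mult_left_mono gibbs_ascent_le[OF pq(1,2) n gm b(2)]) simp
  also have "\<dots> \<le> 2 * (\<integral>\<^sup>+t. (VK * VL) * (ennreal (exp (- t) * (t powr (1/p) + \<eta>) ^ m * (t powr (1/q)) ^ m) * indicator {0<..} t) \<partial>lborel)"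
  proof (intro mult_left_mono nn_integral_mono)
    fix t :: real
    show "ennreal (exp (- t)) * (\<integral>\<^sup>+x. ennreal (g (n \<bullet> x)) * indicator {x. power_sum p x < t} x \<partial>lborel)
         * emeasure M {w. \<exists>s. power_sum q (w + s *\<^sub>R n) < t}
      \<le> (VK * VL) * (ennreal (exp (- t) * (t powr (1/p) + \<eta>) ^ m * (t powr (1/q)) ^ m) * indicator {0<..} t)"
    proof (cases "0 < t")
      case True
      have 1: "(\<integral>\<^sup>+x. ennreal (g (n \<bullet> x)) * indicator {x. power_sum p x < t} x \<partial>lborel) \<le> ennreal ((t powr (1/p) + \<eta>) ^ m) * VK"
        unfolding VK_def M_def m_def \<eta>_def
        by (rule nn_integral_fat_section[OF _ n True \<delta> gm b(3) b(4)]) (use pq in auto)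
      have 2: "emeasure M {w. \<exists>s. power_sum q (w + s *\<^sub>R n) < t} \<le> ennreal ((t powr (1/q)) ^ m) * VL"
        unfolding VL_def M_def m_def
        by (rule emeasure_scaled_projection[OF _ n True]) (use pq in auto)
      have "ennreal (exp (- t)) * (\<integral>\<^sup>+x. ennreal (g (n \<bullet> x)) * indicator {x. power_sum p x < t} x \<partial>lborel)
         * emeasure M {w. \<exists>s. power_sum q (w + s *\<^sub>R n) < t}
        \<le> ennreal (exp (- t)) * (ennreal ((t powr (1/p) + \<eta>) ^ m) * VK) * (ennreal ((t powr (1/q)) ^ m) * VL)"
        by (intro mult_mono 1 2) auto
      also have "\<dots> = (VK * VL) * (ennreal (exp (- t)) * ennreal ((t powr (1/p) + \<eta>) ^ m) * ennreal ((t powr (1/q)) ^ m))"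
        by (simp only: mult_ac)
      also have "ennreal (exp (- t)) * ennreal ((t powr (1/p) + \<eta>) ^ m) * ennreal ((t powr (1/q)) ^ m)
         = ennreal (exp (- t) * (t powr (1/p) + \<eta>) ^ m * (t powr (1/q)) ^ m)"
        using \<eta> by (simp add: ennreal_mult)
      finally show ?thesis using True by simp
    next
      case False
      have "\<not> power_sum p x < t" for x :: "real ^ 'n" using power_sum_nonneg[of p x] False by linarith
      then show ?thesis by simp
    qed
  qed simp
  also have "\<dots> = 2 * ((VK * VL) * (\<integral>\<^sup>+t. ennreal (exp (- t) * (t powr (1/p) + \<eta>) ^ m * (t powr (1/q)) ^ m) * indicator {0<..} t \<partial>lborel))"
    by (subst nn_integral_cmult) measurable
  also have "\<dots> \<le> 2 * ((VK * VL) * ennreal ((1 + \<eta>) ^ m * exp \<eta> * fact m))"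
    by (intro mult_left_mono nn_integral_perturbed_gamma[OF pq \<eta>]) auto
  finally show ?thesis by (simp only: VK_def VL_def \<eta>_def mult.assoc)
qed

text \<open>In the limit \<open>\<delta> \<rightarrow> 0\<close> the left-hand side of \<open>gibbs_halfspace_le\<close>
  becomes half of the total mass \<open>4\<^sup>N\<close>.\<close>

lemma section_projection_volume:
  fixes n :: "real ^ 'n"
  assumes pq: "1 < p" "1 < q" "1/p + 1/q = 1" and n: "norm n = 1"
  defines "M \<equiv> hyperplane_lborel n"
  shows "ennreal (4 ^ (CARD('n) - 1) / fact (CARD('n) - 1)) \<le>
     emeasure M (lp_ball p \<inter> hyperplane n) * emeasure M (flatten n ` lp_ball q)"
proof -
  define m where "m = CARD('n) - 1"
  define V where "V = emeasure M (lp_ball p \<inter> hyperplane n) * emeasure M (flatten n ` lp_ball q)"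
  define \<eta> where "\<eta> k = real CARD('n) * (1 / real (Suc k))" for k :: nat
  define A where "A k = {z :: (real ^ 'n) \<times> (real ^ 'n). n \<bullet> fst z \<le> - (1 / real (Suc k))}" for k
  show ?thesis
  proof (cases "V = top")
    case False
  have "emeasure (gibbs_measure p q) (\<Union>k. A k) \<le> 2 * V * ennreal (fact m)"
  proof (rule LIMSEQ_le)
    show "(\<lambda>k. emeasure (gibbs_measure p q) (A k)) \<longlonglongrightarrow> emeasure (gibbs_measure p q) (\<Union>k. A k)"
    proof (rule Lim_emeasure_incseq)
      show "range A \<subseteq> sets (gibbs_measure p q)"
        unfolding gibbs_measure_def A_def by (auto, measurable)
      show "incseq A"
        unfolding incseq_def A_def
      proof (intro allI impI subsetI CollectI)
        fix k l :: nat and z :: "(real ^ 'n) \<times> (real ^ 'n)"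
        assume "k \<le> l" and z: "z \<in> {z. n \<bullet> fst z \<le> - (1 / real (Suc k))}"
        then have "1 / real (Suc l) \<le> 1 / real (Suc k)" by (intro divide_left_mono) auto
        then show "n \<bullet> fst z \<le> - (1 / real (Suc l))" using z by simp
      qed
    qed
    have "\<eta> \<longlonglongrightarrow> real CARD('n) * 0"
      unfolding \<eta>_def by (intro tendsto_mult tendsto_const LIMSEQ_Suc lim_1_over_n)
    then have "(\<lambda>k. (1 + \<eta> k) ^ m * exp (\<eta> k) * fact m) \<longlonglongrightarrow> (1 + 0) ^ m * exp 0 * fact m"
      by (intro tendsto_intros) simp_all
    then have "(\<lambda>k. ennreal ((1 + \<eta> k) ^ m * exp (\<eta> k) * fact m)) \<longlonglongrightarrow> ennreal (fact m)"
      by (intro tendsto_ennrealI) simp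
    then show "(\<lambda>k. 2 * V * ennreal ((1 + \<eta> k) ^ m * exp (\<eta> k) * fact m)) \<longlonglongrightarrow> 2 * V * ennreal (fact m)"
      using False by (intro ennreal_tendsto_cmult) (auto simp: ennreal_mult_less_top less_top)
    show "\<exists>N. \<forall>k\<ge>N. emeasure (gibbs_measure p q) (A k) \<le> 2 * V * ennreal ((1 + \<eta> k) ^ m * exp (\<eta> k) * fact m)"
      unfolding A_def V_def M_def m_def \<eta>_def
      by (intro exI allI impI gibbs_halfspace_le[OF pq n]) simp
  qed
  also have "(\<Union>k. A k) = {z. n \<bullet> fst z < 0}"
  proof (intro set_eqI iffI)
    fix z :: "(real ^ 'n) \<times> (real ^ 'n)" assume "z \<in> {z. n \<bullet> fst z < 0}"
    then obtain k where "inverse (real (Suc k)) < - (n \<bullet> fst z)" using reals_Archimedean[of "- (n \<bullet> fst z)"] by auto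
    then show "z \<in> (\<Union>k. A k)" by (auto simp: A_def inverse_eq_divide intro!: exI[of _ k])
  next
    fix z :: "(real ^ 'n) \<times> (real ^ 'n)" assume "z \<in> (\<Union>k. A k)"
    then obtain k where "n \<bullet> fst z \<le> - (1 / real (Suc k))" by (auto simp: A_def)
    also have "- (1 / real (Suc k)) < 0" by simp
    finally show "z \<in> {z. n \<bullet> fst z < 0}" by simp
  qed
  finally have le: "emeasure (gibbs_measure p q) {z. n \<bullet> fst z < 0} \<le> 2 * V * ennreal (fact m)" .
  have "n \<noteq> 0" using n by auto
  then have "4 ^ CARD('n) = 2 * emeasure (gibbs_measure p q) {z. n \<bullet> fst z < 0}"
    by (rule emeasure_gibbs_halfspace[OF pq, symmetric])
  also have "\<dots> \<le> 2 * (2 * V * ennreal (fact m))" using le by (rule mult_left_mono) simp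
  also have "\<dots> = 4 * (V * ennreal (fact m))" by (simp add: mult.assoc[symmetric])
  also have "(4 :: ennreal) ^ CARD('n) = 4 * 4 ^ m" by (simp add: m_def power_eq_if)
  finally have "ennreal 4 * ennreal (4 ^ m) \<le> ennreal 4 * (V * ennreal (fact m))"
    by (simp add: ennreal_power[symmetric])
  then have 4: "ennreal (4 ^ m) \<le> V * ennreal (fact m)"
    by (subst (asm) ennreal_mult_le_mult_iff) auto
    obtain v where v: "V = ennreal v" "0 \<le> v" using False by (cases V) auto
    have "ennreal (4 ^ m) \<le> ennreal (v * fact m)" using 4 v by (simp add: ennreal_mult)
    then have "4 ^ m \<le> v * fact m" using v by (subst (asm) ennreal_le_iff) auto
    then have "ennreal (4 ^ m / fact m) \<le> V" unfolding v(1) by (intro ennreal_leI) (simp add: field_simps)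
    then show ?thesis by (simp add: V_def m_def)
  qed (simp add: V_def)
qed

section \<open>Polars of sections and projections\<close>

lemma lp_ball_inner_le:
  fixes x y :: "real ^ 'n"
  assumes pq: "1 < p" "1 < q" "1/p + 1/q = 1" and x: "x \<in> lp_ball p" and y: "y \<in> lp_ball q"
  shows "x \<bullet> y \<le> 1"
proof -
  have "x \<bullet> y \<le> (\<Sum>i\<in>UNIV. \<bar>x $ i\<bar> powr p / p + \<bar>y $ i\<bar> powr q / q)"
    unfolding inner_vec_def
  proof (rule sum_mono)
    fix i
    have "x $ i \<bullet> y $ i \<le> \<bar>x $ i\<bar> * \<bar>y $ i\<bar>" by (simp add: abs_mult[symmetric])
    also have "\<dots> \<le> \<bar>x $ i\<bar> powr p / p + \<bar>y $ i\<bar> powr q / q" by (rule Youngs_inequality[OF pq]) auto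
    finally show "x $ i \<bullet> y $ i \<le> \<bar>x $ i\<bar> powr p / p + \<bar>y $ i\<bar> powr q / q" .
  qed
  also have "\<dots> = power_sum p x / p + power_sum q y / q" by (simp add: power_sum_def sum.distrib sum_divide_distrib)
  also have "\<dots> \<le> 1 / p + 1 / q" using x y pq by (intro add_mono divide_right_mono) (auto simp: lp_ball_power_sum)
  finally show ?thesis using pq by simp
qed

lemma closed_polar_in:
  fixes H :: "'a::euclidean_space set"
  assumes "closed H"
  shows "closed (polar_in H K)"
proof -
  have "polar_in H K = H \<inter> (\<Inter>x\<in>K. {y. x \<bullet> y \<le> 1})" by (auto simp: polar_in_def)
  then show ?thesis using assms by (auto intro!: closed_Int closed_INT simp: closed_halfspace_le)
qed

lemma bounded_polar_in:
  fixes H :: "'a::euclidean_space set"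
  assumes H: "subspace H" and r: "0 < r" and K: "\<And>x. x \<in> H \<Longrightarrow> norm x \<le> r \<Longrightarrow> x \<in> K"
  shows "bounded (polar_in H K)"
proof -
  have "norm y \<le> 1 / r" if y: "y \<in> polar_in H K" for y
  proof (cases "y = 0")
    case False
    have "(r / norm y) *\<^sub>R y \<in> K"
      using y r False by (intro K subspace_scale[OF H]) (auto simp: polar_in_def)
    then have "((r / norm y) *\<^sub>R y) \<bullet> y \<le> 1" using y by (auto simp: polar_in_def)
    then have "r * norm y \<le> 1" using False by (simp add: power2_norm_eq_inner[symmetric] power2_eq_square)
    then show ?thesis using r by (simp add: field_simps)
  qed (use r in simp)
  then show ?thesis by (auto simp: bounded_iff)
qed

lemma lp_ball_contains_ball:
  fixes x :: "real ^ 'n"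
  assumes p: "1 \<le> p" and x: "norm x \<le> 1 / CARD('n)"
  shows "x \<in> lp_ball p"
proof -
  define N where "N = real CARD('n)"
  have N: "1 \<le> N" unfolding N_def by (simp add: Suc_leI)
  have "\<bar>x $ i\<bar> powr p \<le> 1 / N" for i
  proof -
    have "\<bar>x $ i\<bar> powr p \<le> (1 / N) powr p"
      using component_le_norm_cart[of x i] x p by (intro powr_mono2) (auto simp: N_def)
    also have "\<dots> \<le> (1 / N) powr 1" using N p by (intro powr_mono') auto
    finally show ?thesis using N by simp
  qed
  then have "power_sum p x \<le> (\<Sum>i\<in>(UNIV::'n set). 1 / N)" unfolding power_sum_def by (intro sum_mono)
  then show ?thesis using N by (simp add: lp_ball_power_sum N_def)
qed

definition mahler_constant :: "nat \<Rightarrow> real" where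
  "mahler_constant m = 4 ^ m / fact m"

lemma emeasure_polar_section:
  fixes n :: "real ^ 'n"
  assumes pq: "1 < p" "1 < q" "1/p + 1/q = 1" and n: "norm n = 1"
  defines "H \<equiv> hyperplane n"
  shows "ennreal (mahler_constant (CARD('n) - 1)) \<le>
     emeasure (subspace_lborel H) (lp_ball p \<inter> H) * emeasure (subspace_lborel H) (polar_in H (lp_ball p \<inter> H))"
proof -
  have nn: "n \<bullet> n = 1" using n by (simp add: norm_eq_1)
  have "flatten n ` lp_ball q \<subseteq> polar_in H (lp_ball p \<inter> H)"
  proof
    fix y assume "y \<in> flatten n ` lp_ball q"
    then obtain z where z: "z \<in> lp_ball q" "y = z - (n \<bullet> z) *\<^sub>R n" by auto
    have "x \<bullet> y \<le> 1" if "x \<in> lp_ball p \<inter> H" for x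
      using lp_ball_inner_le[OF pq, of x z] that z by (simp add: H_def inner_diff_right inner_commute)
    then show "y \<in> polar_in H (lp_ball p \<inter> H)"
      by (auto simp: polar_in_def H_def z inner_diff_right nn)
  qed
  then have "emeasure (subspace_lborel H) (flatten n ` lp_ball q) \<le> emeasure (subspace_lborel H) (polar_in H (lp_ball p \<inter> H))"
    using closed_polar_in[of H "lp_ball p \<inter> H"] by (intro emeasure_mono) (auto simp: H_def closed_hyperplane)
  then show ?thesis
    unfolding mahler_constant_def H_def by (intro order_trans[OF section_projection_volume[OF pq n]] mult_left_mono) auto
qed

text \<open>Let \<open>e\<close> be the direction of the projection and \<open>E\<close> its orthogonal hyperplane. The orthogonal projection
  to \<open>E\<close> maps \<open>P B\<^sub>p\<close> to the orthogonal projection of \<open>B\<^sub>p\<close>, and the transpose of \<open>P\<close>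
  maps the polar of \<open>P B\<^sub>p\<close> in \<open>H\<close> into \<open>E\<close> with an image containing \<open>B\<^sub>q \<inter> E\<close>. The first changes volume by the factor \<open>n \<bullet> e\<close>
  and the second by its reciprocal.\<close>

lemma emeasure_polar_projection:
  fixes n :: "real ^ 'n"
  assumes pq: "1 < p" "1 < q" "1/p + 1/q = 1" and n: "norm n = 1"
  defines "H \<equiv> hyperplane n"
  assumes P: "linear_projection_onto H P"
  shows "ennreal (mahler_constant (CARD('n) - 1)) \<le>
     emeasure (subspace_lborel H) (P ` lp_ball p) * emeasure (subspace_lborel H) (polar_in H (P ` lp_ball p))"
proof -
  have lin: "linear P" and PP: "P (P x) = P x" and ran: "range P = H" for x
    using P by (auto simp: linear_projection_onto_def fun_eq_iff)
  have PH: "P x = x" if "x \<in> H" for x using that ran PP by (metis rangeE)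
  have nP: "n \<bullet> P x = 0" for x using ran by (auto simp: H_def)
  have nn: "n \<bullet> n = 1" using n by (simp add: norm_eq_1)
  \<comment> \<open>The kernel of \<open>P\<close> is spanned by \<open>v\<close>.\<close>
  define v where "v = n - P n"
  have nv: "n \<bullet> v = 1" by (simp add: v_def inner_diff_right nn nP)
  then have v0: "v \<noteq> 0" by auto
  have Pv: "P x = x - (n \<bullet> x) *\<^sub>R v" for x
  proof -
    have "x - (n \<bullet> x) *\<^sub>R n \<in> H" by (simp add: H_def inner_diff_right nn)
    then have "P (x - (n \<bullet> x) *\<^sub>R n) = x - (n \<bullet> x) *\<^sub>R n" by (rule PH)
    then show ?thesis by (simp add: linear_diff[OF lin] linear_scale[OF lin] v_def algebra_simps)
  qed
  define e where "e = (1 / norm v) *\<^sub>R v"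
  have e1: "norm e = 1" using v0 by (simp add: e_def)
  then have ee: "e \<bullet> e = 1" by (simp add: norm_eq_1)
  have c: "n \<bullet> e = 1 / norm v" by (simp add: e_def nv)
  have c0: "0 < n \<bullet> e" "0 < e \<bullet> n" using v0 by (simp_all add: c inner_commute[of e])
  have Pe: "P x = x - ((n \<bullet> x) / (e \<bullet> n)) *\<^sub>R e" for x
    using v0 by (simp add: Pv inner_commute[of e n] c) (simp add: e_def)
  have P0: "P e = 0" using c0 by (simp add: Pe inner_commute)
  define E where "E = hyperplane e"
  let ?MH = "subspace_lborel H" and ?ME = "subspace_lborel E"
  let ?T = "\<lambda>w. w - ((e \<bullet> w) / (n \<bullet> e)) *\<^sub>R n"
  have K: "P ` lp_ball p \<in> sets borel"
    using compact_continuous_image[OF linear_continuous_on[OF lin[unfolded linear_conv_bounded_linear]] compact_lp_ball[of p]] pq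
    by (intro borel_compact) auto
  have sec: "lp_ball q \<inter> E \<in> sets borel" "flatten e ` lp_ball p \<in> sets borel"
    using borel_section[of q e] borel_section[of p e] pq by (auto simp: E_def)
  have pol: "polar_in H (P ` lp_ball p) \<in> sets borel"
    using closed_polar_in[of H "P ` lp_ball p"] by (simp add: H_def closed_hyperplane borel_closed)
  have "emeasure ?ME (flatten e ` lp_ball p) \<le> emeasure ?ME (P -` (P ` lp_ball p))"
  proof (rule emeasure_mono)
    show "flatten e ` lp_ball p \<subseteq> P -` P ` lp_ball p"
      by (auto simp: linear_diff[OF lin] linear_scale[OF lin] P0)
    have "P \<in> borel_measurable borel" using lin
      by (intro borel_measurable_continuous_onI linear_continuous_on) (simp add: linear_conv_bounded_linear)
    from measurable_sets[OF this K] show "P -` P ` lp_ball p \<in> sets ?ME" by simp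
  qed
  also have "P -` (P ` lp_ball p) = (\<lambda>w. w - ((n \<bullet> w) / (e \<bullet> n)) *\<^sub>R e) -` (P ` lp_ball p)"
    by (auto simp: Pe)
  also have "emeasure ?ME \<dots> = ennreal (e \<bullet> n) * emeasure ?MH (P ` lp_ball p)"
    unfolding E_def H_def by (rule emeasure_oblique_section[OF e1 n c0(2) K])
  finally have 1: "emeasure ?ME (flatten e ` lp_ball p) \<le> ennreal (n \<bullet> e) * emeasure ?MH (P ` lp_ball p)"
    by (simp add: inner_commute)
  have 2: "ennreal (n \<bullet> e) * emeasure ?ME (lp_ball q \<inter> E) \<le> emeasure ?MH (polar_in H (P ` lp_ball p))"
  proof -
    have "ennreal (n \<bullet> e) * emeasure ?ME (lp_ball q \<inter> E) = emeasure ?MH (?T -` (lp_ball q \<inter> E))"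
      unfolding E_def H_def by (rule emeasure_oblique_section[OF n e1 c0(1), symmetric]) (use sec in \<open>simp add: E_def\<close>)
    also have "\<dots> \<le> emeasure ?MH (polar_in H (P ` lp_ball p))"
    proof (rule emeasure_mono_AE)
      show "AE w in ?MH. w \<in> ?T -` (lp_ball q \<inter> E) \<longrightarrow> w \<in> polar_in H (P ` lp_ball p)"
        using AE_subspace_lborel_hyperplane[OF n] unfolding H_def[symmetric]
      proof eventually_elim
        case w: (elim w)
        show ?case
        proof
          assume "w \<in> ?T -` (lp_ball q \<inter> E)"
          then have T: "?T w \<in> lp_ball q" by simp
          have "P x \<bullet> w \<le> 1" if "x \<in> lp_ball p" for x
          proof -
            have "P x \<bullet> w = x \<bullet> ?T w"
              by (simp add: Pe inner_diff_left inner_diff_right inner_commute[of e n] inner_commute[of x n])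
            also have "\<dots> \<le> 1" by (rule lp_ball_inner_le[OF pq that T])
            finally show ?thesis .
          qed
          then show "w \<in> polar_in H (P ` lp_ball p)" using w by (auto simp: polar_in_def H_def)
        qed
      qed
    qed (use pol in simp)
    finally show ?thesis .
  qed
  have "ennreal (n \<bullet> e) * ennreal (mahler_constant (CARD('n) - 1))
     \<le> ennreal (n \<bullet> e) * (emeasure ?ME (lp_ball q \<inter> E) * emeasure ?ME (flatten e ` lp_ball p))"
    using section_projection_volume[OF pq(2,1) _ e1] pq(3) unfolding E_def mahler_constant_def
    by (intro mult_left_mono) (auto simp: add.commute)
  also have "\<dots> = (ennreal (n \<bullet> e) * emeasure ?ME (lp_ball q \<inter> E)) * emeasure ?ME (flatten e ` lp_ball p)"
    by (simp only: mult.assoc)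
  also have "\<dots> \<le> emeasure ?MH (polar_in H (P ` lp_ball p)) * (ennreal (n \<bullet> e) * emeasure ?MH (P ` lp_ball p))"
    by (intro mult_mono 1 2) auto
  also have "\<dots> = ennreal (n \<bullet> e) * (emeasure ?MH (P ` lp_ball p) * emeasure ?MH (polar_in H (P ` lp_ball p)))"
    by (simp only: mult_ac)
  finally show ?thesis using c0 by (subst (asm) ennreal_mult_le_mult_iff) auto
qed

text \<open>Passage from extended nonnegative volumes to real ones, for which
  both volumes must be finite. The polar is bounded because \<open>K\<close> contains a ball around the origin.\<close>

lemma subspace_vol_bound:
  fixes n :: "'a::euclidean_space"
  assumes n: "norm n = 1" and K: "K \<in> sets borel" "bounded K"
    and r: "0 < r" "\<And>x. n \<bullet> x = 0 \<Longrightarrow> norm x \<le> r \<Longrightarrow> x \<in> K"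
    and b: "ennreal b \<le> emeasure (hyperplane_lborel n) K * emeasure (hyperplane_lborel n) (polar_in (hyperplane n) K)"
  shows "b \<le> subspace_vol (hyperplane n) K * subspace_vol (hyperplane n) (polar_in (hyperplane n) K)"
proof -
  let ?H = "(hyperplane n)"
  let ?M = "subspace_lborel ?H"
  have cl: "polar_in ?H K \<in> sets borel" using closed_polar_in[OF closed_hyperplane] by (rule borel_closed)
  have bd: "bounded (polar_in ?H K)"
    by (rule bounded_polar_in[OF subspace_hyperplane r(1)]) (use r in auto)
  have "emeasure ?M K * emeasure ?M (polar_in ?H K) = ennreal (measure ?M K * measure ?M (polar_in ?H K))"
    using emeasure_subspace_lborel_bounded[OF n K] emeasure_subspace_lborel_bounded[OF n cl bd]
    by (simp add: emeasure_eq_ennreal_measure less_top ennreal_mult)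
  then show ?thesis using b by (simp add: subspace_vol_def)
qed

text \<open>Transfers a bound from \<open>L\<close> to a body \<open>K\<close> close to it. It is applied to sequences
  of bodies \<open>L\<close> for which the product \<open>r s\<close> tends to 1.\<close>

lemma mahler_product_scaled:
  fixes n :: "'a::euclidean_space"
  assumes n: "norm n = 1"
  defines "H \<equiv> hyperplane n"
  assumes K: "K \<in> sets borel" "bounded K" and L: "L \<in> sets borel"
    and \<rho>: "0 < \<rho>" "\<And>x. x \<in> H \<Longrightarrow> norm x \<le> \<rho> \<Longrightarrow> x \<in> K"
    and r: "0 < r" "\<And>x. x \<in> L \<Longrightarrow> r *\<^sub>R x \<in> K"
    and s: "0 < s" "\<And>y. y \<in> polar_in H L \<Longrightarrow> s *\<^sub>R y \<in> polar_in H K"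
    and b: "b \<le> subspace_vol H L * subspace_vol H (polar_in H L)"
  shows "(r * s) ^ (DIM('a) - 1) * b \<le> subspace_vol H K * subspace_vol H (polar_in H K)"
proof -
  let ?M = "subspace_lborel H"
  have scale: "measure ?M ((\<lambda>x. t *\<^sub>R x) ` S) = t ^ (DIM('a) - 1) * measure ?M S"
    if "S \<in> sets borel" "0 < t" for S t
    using emeasure_subspace_scaleR[OF n that] that(2) unfolding H_def
    by (simp add: measure_def enn2real_mult)
  have mono: "measure ?M S \<le> measure ?M T" if "S \<subseteq> T" "T \<in> sets borel" "bounded T" for S T
    using emeasure_mono[OF that(1), of ?M] emeasure_subspace_lborel_bounded[OF n that(2,3)] that(2)
    unfolding measure_def by (intro enn2real_mono) (auto simp: H_def)
  have clL: "polar_in H L \<in> sets borel" and clK: "polar_in H K \<in> sets borel"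
    unfolding H_def using closed_polar_in[OF closed_hyperplane] by (auto intro: borel_closed)
  have bd: "bounded (polar_in H K)" unfolding H_def
    by (rule bounded_polar_in[OF subspace_hyperplane \<rho>(1)]) (use \<rho>(2) in \<open>auto simp: H_def\<close>)
  have 1: "r ^ (DIM('a) - 1) * measure ?M L \<le> measure ?M K"
    unfolding scale[OF L r(1), symmetric] using r K by (intro mono) auto
  have 2: "s ^ (DIM('a) - 1) * measure ?M (polar_in H L) \<le> measure ?M (polar_in H K)"
    unfolding scale[OF clL s(1), symmetric] using s clK bd by (intro mono) auto
  have "(r * s) ^ (DIM('a) - 1) * b \<le> (r * s) ^ (DIM('a) - 1) * (measure ?M L * measure ?M (polar_in H L))"
    using b r s by (intro mult_left_mono) (auto simp: subspace_vol_def)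
  also have "\<dots> = (r ^ (DIM('a) - 1) * measure ?M L) * (s ^ (DIM('a) - 1) * measure ?M (polar_in H L))"
    by (simp add: power_mult_distrib)
  also have "\<dots> \<le> measure ?M K * measure ?M (polar_in H K)"
    using r s by (intro mult_mono 1 2) auto
  finally show ?thesis by (simp add: subspace_vol_def)
qed

section \<open>Mahler's inequality for the four families of bodies\<close>

lemma conjugate_exponent:
  fixes p :: real
  assumes "1 < p"
  obtains q where "1 < q" "1/p + 1/q = 1"
proof
  show "1 < p / (p - 1)" "1/p + 1/(p / (p - 1)) = 1" using assms by (simp_all add: field_simps)
qed

lemma mahler_section:
  fixes n :: "real ^ 'n"
  assumes p: "1 < p" and n: "norm n = 1"
  defines "H \<equiv> hyperplane n"
  shows "mahler_constant (CARD('n) - 1) \<le> subspace_vol H (lp_ball p \<inter> H) * subspace_vol H (polar_in H (lp_ball p \<inter> H))"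
proof -
  obtain q where q: "1 < q" "1/p + 1/q = 1" using conjugate_exponent[OF p] .
  show ?thesis unfolding H_def
  proof (rule subspace_vol_bound[OF n])
    show "lp_ball p \<inter> hyperplane n \<in> sets borel" using p by (intro borel_section) auto
    show "bounded (lp_ball p \<inter> hyperplane n)"
      using compact_imp_bounded[OF compact_lp_ball[of p]] p by (auto intro: bounded_subset)
    show "0 < 1 / real CARD('n)" by simp
    show "x \<in> lp_ball p \<inter> hyperplane n" if "n \<bullet> x = 0" "norm x \<le> 1 / real CARD('n)" for x
      using that p lp_ball_contains_ball[of p x] by auto
  qed (rule emeasure_polar_section[OF p q n])
qed

lemma linear_image_lp_ball:
  fixes P :: "real ^ 'n \<Rightarrow> real ^ 'n"
  assumes p: "0 < p" and P: "linear P"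
  shows "P ` lp_ball p \<in> sets borel" "bounded (P ` lp_ball p)"
proof -
  have "compact (P ` lp_ball p)"
    by (rule compact_continuous_image[OF linear_continuous_on compact_lp_ball[OF p]])
       (use P in \<open>simp add: linear_conv_bounded_linear\<close>)
  then show "P ` lp_ball p \<in> sets borel" "bounded (P ` lp_ball p)"
    by (auto intro: borel_compact compact_imp_bounded)
qed

lemma projection_lp_ball_contains:
  fixes P :: "real ^ 'n \<Rightarrow> real ^ 'n"
  assumes p: "1 \<le> p" and P: "linear_projection_onto H P" and x: "x \<in> H" "norm x \<le> 1 / CARD('n)"
  shows "x \<in> P ` lp_ball p"
proof -
  obtain z where "x = P z" using P x(1) by (auto simp: linear_projection_onto_def)
  then have "P x = x" using P by (auto simp: linear_projection_onto_def fun_eq_iff)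
  then show ?thesis using lp_ball_contains_ball[OF p x(2)] by (metis imageI)
qed

lemma mahler_projection:
  fixes n :: "real ^ 'n"
  assumes p: "1 < p" and n: "norm n = 1"
  defines "H \<equiv> hyperplane n"
  assumes P: "linear_projection_onto H P"
  shows "mahler_constant (CARD('n) - 1) \<le> subspace_vol H (P ` lp_ball p) * subspace_vol H (polar_in H (P ` lp_ball p))"
proof -
  obtain q where q: "1 < q" "1/p + 1/q = 1" using conjugate_exponent[OF p] .
  have lin: "linear P" using P by (simp add: linear_projection_onto_def)
  show ?thesis unfolding H_def
  proof (rule subspace_vol_bound[OF n])
    show "P ` lp_ball p \<in> sets borel" "bounded (P ` lp_ball p)" using linear_image_lp_ball[OF _ lin] p by auto
    show "0 < 1 / real CARD('n)" by simp
    show "x \<in> P ` lp_ball p" if "n \<bullet> x = 0" "norm x \<le> 1 / real CARD('n)" for x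
      using that p by (intro projection_lp_ball_contains[OF _ P]) (auto simp: H_def)
  qed (rule emeasure_polar_projection[OF p q n P[unfolded H_def]])
qed

text \<open>The cube lies between \<open>B\<^sub>p\<close> and \<open>N\<^sup>1\<^sup>/\<^sup>p B\<^sub>p\<close>, and \<open>N\<^sup>1\<^sup>/\<^sup>p\<close> tends to 1 as \<open>p\<close> tends to
  infinity.\<close>

lemma mahler_cube_section:
  fixes n :: "real ^ 'n"
  assumes n: "norm n = 1"
  defines "H \<equiv> hyperplane n"
  shows "mahler_constant (CARD('n) - 1) \<le> subspace_vol H (cube \<inter> H) * subspace_vol H (polar_in H (cube \<inter> H))"
proof -
  define N where "N = real CARD('n)"
  have N: "1 \<le> N" unfolding N_def by (simp add: Suc_leI)
  define V where "V = subspace_vol H (cube \<inter> H) * subspace_vol H (polar_in H (cube \<inter> H))"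
  define s where "s k = N powr (- (1 / real (Suc k)))" for k :: nat
  have cb: "cube = cbox (\<chi> i. -1) ((\<chi> i. 1) :: real ^ 'n)"
    by (auto simp: cube_def mem_box_cart)
  have "compact (cube \<inter> H)" unfolding cb H_def
    by (intro compact_Int_closed compact_cbox closed_hyperplane)
  then have K: "cube \<inter> H \<in> sets borel" "bounded (cube \<inter> H)" by (auto intro: borel_compact compact_imp_bounded)
  have "(1 * s k) ^ (DIM(real ^ 'n) - 1) * mahler_constant (CARD('n) - 1) \<le> V" if "0 < k" for k
    unfolding V_def H_def
  proof (rule mahler_product_scaled[OF n K[unfolded H_def]])
    define p where "p = real (Suc k)"
    have p: "1 < p" using that by (simp add: p_def)
    show "lp_ball p \<inter> hyperplane n \<in> sets borel" using p by (intro borel_section) auto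
    show "0 < 1 / N" using N by simp
    show "x \<in> cube \<inter> hyperplane n" if "x \<in> hyperplane n" "norm x \<le> 1 / N" for x
      using that lp_ball_coordinate[OF _ lp_ball_contains_ball[of 1 x]] by (auto simp: cube_def N_def abs_le_iff)
    show "1 *\<^sub>R x \<in> cube \<inter> hyperplane n" if "x \<in> lp_ball p \<inter> hyperplane n" for x
      using that p lp_ball_coordinate[of p x] by (auto simp: cube_def abs_le_iff minus_le_iff)
    show "0 < s k" using N by (simp add: s_def)
    show "s k *\<^sub>R y \<in> polar_in (hyperplane n) (cube \<inter> hyperplane n)"
      if y: "y \<in> polar_in (hyperplane n) (lp_ball p \<inter> hyperplane n)" for y
    proof -
      have "x \<bullet> (s k *\<^sub>R y) \<le> 1" if x: "x \<in> cube \<inter> hyperplane n" for x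
      proof -
        have "power_sum p x \<le> (\<Sum>i\<in>(UNIV :: 'n set). 1)" unfolding power_sum_def
        proof (rule sum_mono)
          fix i
          have "\<bar>x $ i\<bar> powr p \<le> 1 powr p" using x p by (intro powr_mono2) (auto simp: cube_def abs_le_iff)
          then show "\<bar>x $ i\<bar> powr p \<le> 1" by simp
        qed
        moreover have "\<bar>s k\<bar> powr p = 1 / N"
        proof -
          have "\<bar>s k\<bar> powr p = N powr (- (1 / p) * p)"
            by (simp only: s_def p_def abs_of_nonneg[OF powr_ge_zero] powr_powr)
          also have "- (1 / p) * p = - 1" using p by simp
          finally show ?thesis using N by (simp add: powr_minus_divide)
        qed
        ultimately have "power_sum p (s k *\<^sub>R x) \<le> 1 / N * N"
          unfolding power_sum_scaleR using N by (intro mult_mono) (auto simp: N_def power_sum_nonneg)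
        then have "power_sum p (s k *\<^sub>R x) \<le> 1" using N by simp
        then have "s k *\<^sub>R x \<in> lp_ball p \<inter> hyperplane n" using x by (simp add: lp_ball_power_sum)
        then have "(s k *\<^sub>R x) \<bullet> y \<le> 1" using y unfolding polar_in_def by blast
        then show ?thesis by simp
      qed
      then show ?thesis using y by (auto simp: polar_in_def)
    qed
    show "mahler_constant (CARD('n) - 1) \<le> subspace_vol (hyperplane n) (lp_ball p \<inter> hyperplane n) *
       subspace_vol (hyperplane n) (polar_in (hyperplane n) (lp_ball p \<inter> hyperplane n))"
      by (rule mahler_section[OF p n])
  qed simp
  moreover have "(\<lambda>k. (1 * s k) ^ (DIM(real ^ 'n) - 1) * mahler_constant (CARD('n) - 1)) \<longlonglongrightarrow> (1 * N powr (- 0)) ^ (DIM(real ^ 'n) - 1) * mahler_constant (CARD('n) - 1)"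
    unfolding s_def using N by (intro tendsto_intros LIMSEQ_Suc lim_1_over_n) auto
  ultimately have "(1 * N powr (- 0)) ^ (DIM(real ^ 'n) - 1) * mahler_constant (CARD('n) - 1) \<le> V"
    by (intro LIMSEQ_le_const2) (auto intro!: exI[of _ 1])
  then show ?thesis using N by (simp add: V_def)
qed

text \<open>By Young's inequality \<open>\<bar>u\<bar> \<le> \<bar>u\<bar>\<^sup>p / p + 1 / q\<close>, so \<open>B\<^sub>p\<close> is
  contained in \<open>1/p + N/q\<close> times the cross-polytope. This factor tends to 1 as \<open>q\<close> tends to infinity.\<close>

lemma mahler_cross_polytope_projection:
  fixes n :: "real ^ 'n"
  assumes n: "norm n = 1"
  defines "H \<equiv> hyperplane n"
  assumes P: "linear_projection_onto H P"
  shows "mahler_constant (CARD('n) - 1) \<le> subspace_vol H (P ` cross_polytope) * subspace_vol H (polar_in H (P ` cross_polytope))"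
proof -
  define N where "N = real CARD('n)"
  have N: "1 \<le> N" unfolding N_def by (simp add: Suc_leI)
  have lin: "linear P" using P by (simp add: linear_projection_onto_def)
  have C: "cross_polytope = (lp_ball 1 :: (real ^ 'n) set)" by (simp add: cross_polytope_def lp_ball_def)
  define V where "V = subspace_vol H (P ` lp_ball 1) * subspace_vol H (polar_in H (P ` lp_ball 1))"
  define r where "r k = 1 / ((1 - 1 / real (Suc k)) + N * (1 / real (Suc k)))" for k :: nat
  have "(r k * 1) ^ (DIM(real ^ 'n) - 1) * mahler_constant (CARD('n) - 1) \<le> V" if "0 < k" for k
  proof -
    define q where "q = real (Suc k)"
    have q: "1 < q" using that by (simp add: q_def)
    obtain p where p: "1 < p" "1/q + 1/p = 1" using conjugate_exponent[OF q] .
    define t where "t = 1/p + N * (1/q)"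
    have t: "0 < t" using p q N by (auto simp: t_def intro!: add_pos_nonneg)
    have ip: "1/p = 1 - 1/q" using p by simp
    have rk: "r k = 1 / t" unfolding t_def ip by (simp only: r_def q_def)
    show ?thesis unfolding V_def H_def rk
    proof (rule mahler_product_scaled[OF n])
      show "P ` lp_ball 1 \<in> sets borel" "bounded (P ` lp_ball 1)" "P ` lp_ball p \<in> sets borel"
        using linear_image_lp_ball[OF _ lin] p by auto
      show "0 < 1 / N" using N by simp
      show "x \<in> P ` lp_ball 1" if "x \<in> hyperplane n" "norm x \<le> 1 / N" for x
        using that by (intro projection_lp_ball_contains[OF _ P]) (auto simp: H_def N_def)
      show "0 < 1 / t" using t by simp
      show "(1 / t) *\<^sub>R x \<in> P ` lp_ball 1" if x: "x \<in> P ` lp_ball p" for x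
      proof -
        obtain z where z: "z \<in> lp_ball p" "x = P z" using x by auto
        have "power_sum 1 z \<le> (\<Sum>i\<in>UNIV. \<bar>z $ i\<bar> powr p / p + 1 / q)" unfolding power_sum_def
        proof (rule sum_mono)
          fix i
          show "\<bar>z $ i\<bar> powr 1 \<le> \<bar>z $ i\<bar> powr p / p + 1 / q"
            using Youngs_inequality[OF p(1) q, of "\<bar>z $ i\<bar>" 1] p(2) by (simp add: add.commute)
        qed
        also have "\<dots> = power_sum p z / p + N * (1 / q)" by (simp add: power_sum_def sum.distrib sum_divide_distrib N_def)
        also have "\<dots> \<le> t" unfolding t_def using z p by (intro add_mono divide_right_mono) (auto simp: lp_ball_power_sum)
        finally have "(1 / t) *\<^sub>R z \<in> lp_ball 1" using lp_ball_scaleR_iff[OF t, of 1 z] t by simp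
        then have "P ((1 / t) *\<^sub>R z) \<in> P ` lp_ball 1" by (rule imageI)
        then show ?thesis by (simp add: linear_scale[OF lin] z(2))
      qed
      have "lp_ball 1 \<subseteq> (lp_ball p :: (real ^ 'n) set)"
      proof
        fix z :: "real ^ 'n" assume z: "z \<in> lp_ball 1"
        have "power_sum p z \<le> power_sum 1 z" unfolding power_sum_def
          using lp_ball_coordinate[OF _ z] p by (intro sum_mono powr_mono') auto
        then show "z \<in> lp_ball p" using z by (simp add: lp_ball_power_sum)
      qed
      then show "1 *\<^sub>R y \<in> polar_in (hyperplane n) (P ` lp_ball 1)"
        if "y \<in> polar_in (hyperplane n) (P ` lp_ball p)" for y
        using that unfolding polar_in_def by auto
      show "mahler_constant (CARD('n) - 1) \<le> subspace_vol (hyperplane n) (P ` lp_ball p) *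
         subspace_vol (hyperplane n) (polar_in (hyperplane n) (P ` lp_ball p))"
        by (rule mahler_projection[OF p(1) n P[unfolded H_def]])
    qed simp
  qed
  moreover have "(\<lambda>k. (r k * 1) ^ (DIM(real ^ 'n) - 1) * mahler_constant (CARD('n) - 1))
     \<longlonglongrightarrow> (1 / ((1 - 0) + N * 0) * 1) ^ (DIM(real ^ 'n) - 1) * mahler_constant (CARD('n) - 1)"
    unfolding r_def by (intro tendsto_intros LIMSEQ_Suc lim_1_over_n) auto
  ultimately have "(1 / ((1 - 0) + N * 0) * 1) ^ (DIM(real ^ 'n) - 1) * mahler_constant (CARD('n) - 1) \<le> V"
    by (intro LIMSEQ_le_const2) (auto intro!: exI[of _ 1])
  then show ?thesis by (simp add: V_def C)
qed

lemma hyperplane_unit_normal: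
  fixes H :: "'a::euclidean_space set"
  assumes H: "subspace H" "dim H = DIM('a) - 1"
  obtains n where "norm n = 1" "H = hyperplane n"
proof -
  have "dim H < DIM('a)" using H(2) by (simp add: less_le_trans)
  then obtain a where a: "a \<noteq> 0" "\<And>x. x \<in> span H \<Longrightarrow> orthogonal a x"
    using orthogonal_to_subspace_exists[of H] by (metis orthogonal_commute)
  define n where "n = (1 / norm a) *\<^sub>R a"
  have n: "norm n = 1" using a by (simp add: n_def)
  have "H \<subseteq> (hyperplane n)"
    using a(2) span_superset[of H] by (auto simp: n_def orthogonal_def)
  moreover have "dim (hyperplane n) = DIM('a) - 1" using n by (intro dim_hyperplane) auto
  ultimately have "H = hyperplane n"
    using H by (intro subspace_dim_equal subspace_hyperplane) auto
  then show thesis using n that by blast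
qed

theorem theorem4p2:
  fixes H :: "(real ^ 'n) set"
  assumes "CARD('n) \<ge> 2"
    and "subspace H" and "dim H = CARD('n) - 1"
  shows "(\<forall>p K. 1 < p \<and>
            (K = lp_ball p \<inter> H \<or> (\<exists>P. linear_projection_onto H P \<and> K = P ` lp_ball p)) \<longrightarrow>
            subspace_vol H K * subspace_vol H (polar_in H K)
              \<ge> 4 ^ (CARD('n) - 1) / fact (CARD('n) - 1)) \<and>
         (\<forall>K. K = cube \<inter> H \<or> (\<exists>P. linear_projection_onto H P \<and> K = P ` cross_polytope) \<longrightarrow>
            subspace_vol H K * subspace_vol H (polar_in H K)
              \<ge> 4 ^ (CARD('n) - 1) / fact (CARD('n) - 1))"
proof -
  obtain n where n: "norm n = 1" "H = hyperplane n"
    using hyperplane_unit_normal[of H] assms(2,3) by auto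
  show ?thesis
    using mahler_section[OF _ n(1)] mahler_projection[OF _ n(1)] mahler_cube_section[OF n(1)]
      mahler_cross_polytope_projection[OF n(1)]
    unfolding n(2) mahler_constant_def by blast
qed

end
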